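(* Consider the conditions: (J) (jump process condition) there exists an event of full $\mathbb P$-probability on which, for all $x,y\in\mathbb Z^2$, every point of $\operatorname{supp}\mu_{x,y}$ is isolated; (N) (no non-trivial bi-infinite geodesics) there exists an event of full $\mathbb P$-probability on which the only bi-infinite geodesics are the trivial ones $x+\mathbb Ze_i$, $x\in\mathbb Z^2$, $i\in\{1,2\}$. The following hold for $\mathbb P$-almost every $\omega$ and all $\zeta\preceq\eta$ in $\operatorname{ri}\mathcal U$ such that $[\zeta,\eta]\cap\mathcal V^\omega\ne\varnothing$. The case $\zeta=\eta=\xi$ is included unless otherwise stated. (a) $x^*$ is a branch point in $\mathcal S^*_{[\zeta,\eta]}$ if and only if $\xi_*(T_{x^*-\hat e^*}\omega)\in[\zeta,\eta]$. (b) If $\zeta\prec\eta$, then any $[\zeta,\eta]$-instability points $x^*,y^*$ have a common descendant: there exists a $[\zeta,\eta]$-instability point $z^*$ such that $x^*$ and $y^*$ are both ancestors of $z^*$ in $\mathcal S^*_{[\zeta,\eta]}$. If we assume (N), then the same statement holds also for the case $\zeta=\eta=\xi$. (c) Assume (J). Then any $[\zeta,\eta]$-instability points $x^*,y^*$ have a common ancestor in $\mathcal S^*_{[\zeta,\eta]}$. (d) Suppose $\zeta\prec\eta$ are such that $]\zeta,\eta[\,\cap\mathcal V^\omega\ne\varnothing$. Then for any $z\in\mathbb Z^2$ there is a coordinatewise strictly ordered infinite sequence $z<z_1^*<z_2^*<\dotsm<z_n^*<\dotsm$ such that each $z_n^*$ is a branch point in $\mathcal S^*_{[\zeta,\eta]}$.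 There are also infinitely many coalescence points in $\mathcal S^*_{[\zeta,\eta]}$. (e) If (J) holds and $\xi\in\mathcal V^\omega$, then for any $z\in\mathbb Z^2$ there is a coordinatewise strictly ordered infinite sequence $z<z_1^*<z_2^*<\dotsm<z_n^*<\dotsm$ such that each $z_n^*$ is a branch point in $\mathcal S^*_{\xi}=\mathcal S^*_{[\xi,\xi]}$. If additionally (N) holds, then there are infinitely many coalescence points in $\mathcal S^*_\xi$.
   Context: Directions. $e_1=e_+=(1,0)$, $e_2=e_-=(0,1)$, $\hat e=e_1+e_2$, $\hat e^*=\hat e/2$. $\mathcal U=\{te_1+(1-t)e_2:0\le t\le1\}$, $\operatorname{ri}\mathcal U=\mathcal U\setminus\{e_1,e_2\}$. For $\zeta,\eta\in\mathbb R^2$ with $\zeta\cdot\hat e=\eta\cdot\hat e$, $\zeta\prec\eta$ (resp. $\zeta\preceq\eta$) means $\zeta\cdot e_1<\eta\cdot e_1$ (resp. $\le$). Intervals $[\zeta,\eta]$, $]\zeta,\eta[$ etc. in $\mathcal U$ and monotone limits $\zeta\nearrow\xi$, $\zeta\searrow\xi$ refer to this order. Vector inequalities $x\le y$, $x<y$ are coordinatewise. $\sigma$ denotes a sign in $\{-,+\}$. Last-passage percolation. $(\Omega,\mathcal F,\mathbb P)$ is a Polish probability space with a group $\{T_x\}_{x\in\mathbb Z^2}$ of measurable $\mathbb P$-preserving bijections ($T_0=$ identity, $T_xT_y=T_{x+y}$) and real random variables (weights) $\omega_x$, $x\in\mathbb Z^2$, with $\omega_y(T_x\omega)=\omega_{x+y}(\omega)$,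 that are i.i.d. with continuous distribution, positive variance, and $\mathbb E|\omega_0|^p<\infty$ for some $p>2$. An up-right path has steps in $\{e_1,e_2\}$ and is indexed so that $\pi_k\cdot\hat e=k$. For $x\le y$, $k=x\cdot\hat e$, $m=y\cdot\hat e$, $G_{x,y}=\max\sum_{i=k}^{m-1}\omega_{\pi_i}$ over up-right paths from $x$ to $y$; a maximizer is a (finite) geodesic. A bi-infinite geodesic is a bi-infinite up-right path all of whose finite segments are geodesics. The shape function is the deterministic, concave, symmetric, 1-homogeneous $g:\mathbb R_+^2\to\mathbb R$ with a.s. $\lim_n\max_{x\in\mathbb Z_+^2,|x|_1=n}|G_{0,x}-g(x)|/n=0$. For $\xi\in\operatorname{ri}\mathcal U$: $\nabla g(\xi\pm)\cdot e_1=\lim_{\varepsilon\searrow0}\frac{g(\xi\pm\varepsilon e_1)-g(\xi)}{\pm\varepsilon}$, $\nabla g(\xi\pm)\cdot e_2=\lim_{\varepsilon\searrow0}\frac{g(\xi\mp\varepsilon e_2)-g(\xi)}{\mp\varepsilon}$. $\mathcal D=\{\xi\in\operatorname{ri}\mathcal U: g\text{ differentiable at }\xi\}$. $\mathcal U_{\xi\sigma}=\{\zeta\in\operatorname{ri}\mathcal U:g(\zeta)-g(\xi)=\nabla g(\xi\sigma)\cdot(\zeta-\xi)\}$, $\mathcal U_\xi=\mathcal U_{\xi-}\cup\mathcal U_{\xi+}=[\underline\xi,\overline\xi]$. Busemann process. On $\Omega$ there is a fixed family of real random variables $B^{\xi\sigma}(x,y)=B^{\xi\sigma}_{x,y}$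 ($x,y\in\mathbb Z^2$, $\xi\in\operatorname{ri}\mathcal U$, $\sigma\in\{-,+\}$), measurable in $(x,y,\omega,\xi)$, constructed in earlier work, with these properties. (B1) On one $T$-invariant event of probability one, for all $x,y,z,\xi,\sigma$: $B^{\xi\sigma}(x+z,y+z,\omega)=B^{\xi\sigma}(x,y,T_z\omega)$; $B^{\xi\sigma}(x,y)+B^{\xi\sigma}(y,z)=B^{\xi\sigma}(x,z)$; $\min_{i}B^{\xi\sigma}(x,x+e_i)=\omega_x$; for $\xi\prec\xi'$, $B^{\xi-}(x,x+e_1)\ge B^{\xi+}(x,x+e_1)\ge B^{\xi'-}(x,x+e_1)\ge B^{\xi'+}(x,x+e_1)$ and the reversed inequalities with $e_2$ in place of $e_1$; $B^{\xi-}(x,y)=\lim_{\zeta\nearrow\xi}B^{\zeta\sigma}(x,y)$ and $B^{\xi+}(x,y)=\lim_{\zeta\searrow\xi}B^{\zeta\sigma}(x,y)$; $B^{\xi\sigma}(x,x+e_i)\to\infty$ as $\xi\to e_{3-i}$. (B2) $B^{\xi\sigma}(x,y)$ is integrable and $\mathbb E[B^{\xi\sigma}(x,x+e_i)]=\nabla g(\xi\sigma)\cdot e_i$. (B3) If $\nabla g(\zeta\sigma)=\nabla g(\eta\sigma)$ then $B^{\zeta\sigma}\equiv B^{\eta\sigma}$. (B4) For any $I\subset\mathbb Z^2$, $\{(\omega_x,B^{\xi\sigma}(x,y)):x\in I,y\ge x,\sigma,\xi\}$ is independent of $\{\omega_x: x\not\ge z\ \forall z\in I\}$. (B5) For each fixed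 $\xi$, a.s.: $B^{\xi\sigma}(x,x+e_1)\ne B^{\xi\sigma}(x,x+e_2)$ for all $x,\sigma$; $n^{-1}\max_{x\in\mathbb Z_+^2,|x|_1=n}|B^{\xi\sigma}(0,x)-x\cdot\nabla g(\xi\sigma)|\to0$; if $\xi\in\mathcal D$ then $B^{\xi+}=B^{\xi-}$; if $\xi,\underline\xi,\overline\xi\in\mathcal D$ then $B^{\xi\pm}(x,y)=\lim_n(G_{x,v_n}-G_{y,v_n})$ whenever $|v_n|\to\infty$, $v_n/n\to\xi$. Competition interface direction. $\xi_*(\omega)\in\operatorname{ri}\mathcal U$ is the (a.s. existing and unique) direction such that $B^{\zeta\pm}(e_1,e_2)<0$ if $\zeta\prec\xi_*(\omega)$ and $B^{\zeta\pm}(e_1,e_2)>0$ if $\zeta\succ\xi_*(\omega)$. Busemann measures. For $x,y\in\mathbb Z^2$ and a compact interval $K\subset\operatorname{ri}\mathcal U$, $\mu^K_{x,y}$ is the signed measure on $K$ with $\mu^K_{x,y}(]\zeta,\eta])=B^{\eta+}_{x,y}-B^{\zeta+}_{x,y}$ and $\mu^K_{x,y}([\zeta,\eta[)=B^{\eta-}_{x,y}-B^{\zeta-}_{x,y}$ for $\zeta\prec\eta$, $[\zeta,\eta]\subset K$. $\operatorname{supp}\mu_{x,y}=\bigcup_{\zeta\prec\eta\text{ in }\operatorname{ri}\mathcal U}\operatorname{supp}\mu^{[\zeta,\eta]}_{x,y}$ (support = smallest closed set whose complement has zero total variation measure). $\mathcal V^\omega=\bigcup_{x,y\in\mathbb Z^2}\operatorname{supp}\mu_{x,y}$.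 Graphs. $\mathcal G_{\xi\sigma}$ is the directed graph on $\mathbb Z^2$ in which each $x$ has exactly one outgoing edge: to $x+e_1$ if $B^{\xi\sigma}(x,x+e_1)<B^{\xi\sigma}(x,x+e_2)$, to $x+e_2$ if $>$ holds, to $x+e_\sigma$ if equality holds. $\mathcal G^*_{\xi\sigma}$ is the directed graph on the dual lattice $\mathbb Z^{2*}=\hat e^*+\mathbb Z^2$ in which $x+\hat e^*$ points to $x+\hat e^*-e_i$ if and only if $x$ points to $x+e_i$ in $\mathcal G_{\xi\sigma}$. $\mathcal G^*_{\cup[\zeta,\eta]}$ is the union of the graphs $\mathcal G^*_{\xi\sigma}$ over $\xi\in[\zeta,\eta]$, $\sigma\in\{-,+\}$. A dual point $x+\hat e^*$ ($x\in\mathbb Z^2$) is a $[\zeta,\eta]$-instability point if $[\zeta,\eta]\cap\operatorname{supp}\mu_{x+e_1,x+e_2}\ne\varnothing$. The instability graph $\mathcal S^*_{[\zeta,\eta]}$ is the subgraph of $\mathcal G^*_{\cup[\zeta,\eta]}$ whose vertices are the $[\zeta,\eta]$-instability points and whose edges are the directed edges of $\mathcal G^*_{\cup[\zeta,\eta]}$ between such points. If there is a directed path from $y^*$ to $x^*$ in $\mathcal S^*_{[\zeta,\eta]}$, then $y^*$ is an ancestor of $x^*$ and $x^*$ is a descendant of $y^*$. A $[\zeta,\eta]$-instability point $x^*$ is a branch point in $\mathcal S^*_{[\zeta,\eta]}$ if it is an ancestor of both $x^*-e_1$ and $x^*-e_2$, and a coalescence point if both $x^*+e_1$ and $x^*+e_2$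 are ancestors of $x^*$. *)

theory Defs
  imports "HOL-Probability.Probability"
begin

text \<open>
  Lattice points have type \<^typ>\<open>int \<times> int\<close>; directions and dual lattice points have type
  \<^typ>\<open>real \<times> real\<close>. On pairs, \<open>\<le>\<close> is the coordinatewise order of the library; the library's
  \<open><\<close> on pairs is \<^emph>\<open>not\<close> strict in both coordinates, hence \<open>cless\<close> below.
\<close>

definition e1 :: "'a::comm_ring_1 \<times> 'a" where "e1 = (1, 0)"
definition e2 :: "'a::comm_ring_1 \<times> 'a" where "e2 = (0, 1)"

definition ehat :: "real \<times> real" where "ehat = e1 + e2"
definition ehat_star :: "real \<times> real" where "ehat_star = ehat /\<^sub>R 2"

datatype sign = Sminus | Splus

fun sign_val :: "sign \<Rightarrow> real" where
  "sign_val Sminus = -1"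
| "sign_val Splus = 1"

fun e_sign :: "sign \<Rightarrow> int \<times> int" where
  "e_sign Sminus = e2"
| "e_sign Splus = e1"

definition cless :: "real \<times> real \<Rightarrow> real \<times> real \<Rightarrow> bool" where
  "cless x y \<longleftrightarrow> fst x < fst y \<and> snd x < snd y"

definition rvec :: "int \<times> int \<Rightarrow> real \<times> real" where
  "rvec x = (real_of_int (fst x), real_of_int (snd x))"

definition dual :: "int \<times> int \<Rightarrow> real \<times> real" where
  "dual x = rvec x + ehat_star"

definition norm1 :: "int \<times> int \<Rightarrow> int" where
  "norm1 x = \<bar>fst x\<bar> + \<bar>snd x\<bar>"

definition level :: "int \<times> int \<Rightarrow> int" where
  "level x = fst x + snd x"

definition dirs :: "(real \<times> real) set" where
  "dirs = {t *\<^sub>R e1 + (1 - t) *\<^sub>R e2 | t. 0 \<le> t \<and> t \<le> 1}"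

definition ri_dirs :: "(real \<times> real) set" where
  "ri_dirs = dirs - {e1, e2}"

definition dir_less :: "real \<times> real \<Rightarrow> real \<times> real \<Rightarrow> bool" (infix "\<prec>\<^sub>1" 50) where
  "\<zeta> \<prec>\<^sub>1 \<eta> \<longleftrightarrow> \<zeta> \<bullet> ehat = \<eta> \<bullet> ehat \<and> \<zeta> \<bullet> e1 < \<eta> \<bullet> e1"

definition dir_le :: "real \<times> real \<Rightarrow> real \<times> real \<Rightarrow> bool" (infix "\<preceq>\<^sub>1" 50) where
  "\<zeta> \<preceq>\<^sub>1 \<eta> \<longleftrightarrow> \<zeta> \<bullet> ehat = \<eta> \<bullet> ehat \<and> \<zeta> \<bullet> e1 \<le> \<eta> \<bullet> e1"

definition dir_cc :: "real \<times> real \<Rightarrow> real \<times> real \<Rightarrow> (real \<times> real) set" where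
  "dir_cc \<zeta> \<eta> = {\<xi> \<in> dirs. \<zeta> \<preceq>\<^sub>1 \<xi> \<and> \<xi> \<preceq>\<^sub>1 \<eta>}"

definition dir_oc :: "real \<times> real \<Rightarrow> real \<times> real \<Rightarrow> (real \<times> real) set" where
  "dir_oc \<zeta> \<eta> = {\<xi> \<in> dirs. \<zeta> \<prec>\<^sub>1 \<xi> \<and> \<xi> \<preceq>\<^sub>1 \<eta>}"

definition dir_co :: "real \<times> real \<Rightarrow> real \<times> real \<Rightarrow> (real \<times> real) set" where
  "dir_co \<zeta> \<eta> = {\<xi> \<in> dirs. \<zeta> \<preceq>\<^sub>1 \<xi> \<and> \<xi> \<prec>\<^sub>1 \<eta>}"

definition dir_oo :: "real \<times> real \<Rightarrow> real \<times> real \<Rightarrow> (real \<times> real) set" where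
  "dir_oo \<zeta> \<eta> = {\<xi> \<in> dirs. \<zeta> \<prec>\<^sub>1 \<xi> \<and> \<xi> \<prec>\<^sub>1 \<eta>}"

text \<open>A path segment between levels \<open>k\<close> and \<open>m\<close> is a function on all of \<^typ>\<open>int\<close> of which only
  the values on \<open>{k..m}\<close> matter. Below, \<open>w\<close> is one realization of the weights.\<close>

definition up_right_paths :: "int \<times> int \<Rightarrow> int \<times> int \<Rightarrow> (int \<Rightarrow> int \<times> int) set" where
  "up_right_paths x y = {\<pi>. \<pi> (level x) = x \<and> \<pi> (level y) = y \<and>
     (\<forall>i. level x \<le> i \<and> i \<le> level y \<longrightarrow> level (\<pi> i) = i) \<and>
     (\<forall>i. level x \<le> i \<and> i < level y \<longrightarrow> \<pi> (i + 1) - \<pi> i \<in> {e1, e2})}"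

definition path_weight :: "(int \<times> int \<Rightarrow> real) \<Rightarrow> int \<Rightarrow> int \<Rightarrow> (int \<Rightarrow> int \<times> int) \<Rightarrow> real" where
  "path_weight w k m \<pi> = (\<Sum>i\<in>{k..<m}. w (\<pi> i))"

definition passage_time :: "(int \<times> int \<Rightarrow> real) \<Rightarrow> int \<times> int \<Rightarrow> int \<times> int \<Rightarrow> real" where
  "passage_time w x y = Max (path_weight w (level x) (level y) ` up_right_paths x y)"

definition geodesic :: "(int \<times> int \<Rightarrow> real) \<Rightarrow> int \<times> int \<Rightarrow> int \<times> int \<Rightarrow> (int \<Rightarrow> int \<times> int) \<Rightarrow> bool" where
  "geodesic w x y \<pi> \<longleftrightarrow> \<pi> \<in> up_right_paths x y \<and>
     path_weight w (level x) (level y) \<pi> = passage_time w x y"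

definition biinfinite_geodesic :: "(int \<times> int \<Rightarrow> real) \<Rightarrow> (int \<Rightarrow> int \<times> int) \<Rightarrow> bool" where
  "biinfinite_geodesic w \<pi> \<longleftrightarrow>
     (\<forall>i. level (\<pi> i) = i \<and> \<pi> (i + 1) - \<pi> i \<in> {e1, e2}) \<and>
     (\<forall>k m. k \<le> m \<longrightarrow> geodesic w (\<pi> k) (\<pi> m) \<pi>)"

definition trivial_path :: "(int \<Rightarrow> int \<times> int) \<Rightarrow> bool" where
  "trivial_path \<pi> \<longleftrightarrow> (\<exists>x. \<exists>e\<in>{e1, e2}. range \<pi> = range (\<lambda>j::int. x + (j * fst e, j * snd e)))"

locale lpp_environment = prob_space M
  for M :: "'w::polish_space measure" +
  fixes T :: "int \<times> int \<Rightarrow> 'w \<Rightarrow> 'w"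
    and W :: "int \<times> int \<Rightarrow> 'w \<Rightarrow> real"
  assumes sets_M: "sets M = sets borel"
    and T_zero: "T 0 = id"
    and T_add: "T x \<circ> T y = T (x + y)"
    and T_bij: "bij (T x)"
    and T_measurable: "T x \<in> measurable M M"
    and T_preserving: "distr M M (T x) = M"
    and W_measurable: "W x \<in> borel_measurable M"
    and W_shift: "W y (T x \<omega>) = W (x + y) \<omega>"
    and W_indep: "indep_vars (\<lambda>_. borel) W UNIV"
    and W_ident: "distr M borel (W x) = distr M borel (W 0)"
    and W_continuous: "prob {\<omega> \<in> space M. W 0 \<omega> = r} = 0"
    and W_variance: "variance (W 0) > 0"
    and W_moment: "\<exists>p>2. integrable M (\<lambda>\<omega>. \<bar>W 0 \<omega>\<bar> powr p)"

definition grad :: "(real \<times> real \<Rightarrow> real) \<Rightarrow> real \<times> real \<Rightarrow> sign \<Rightarrow> real \<times> real" where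
  "grad g \<xi> \<sigma> =
     (Lim (at_right 0) (\<lambda>\<epsilon>. (g (\<xi> + (sign_val \<sigma> * \<epsilon>) *\<^sub>R e1) - g \<xi>) / (sign_val \<sigma> * \<epsilon>)),
      Lim (at_right 0) (\<lambda>\<epsilon>. (g (\<xi> - (sign_val \<sigma> * \<epsilon>) *\<^sub>R e2) - g \<xi>) / - (sign_val \<sigma> * \<epsilon>)))"

definition diff_dirs :: "(real \<times> real \<Rightarrow> real) \<Rightarrow> (real \<times> real) set" where
  "diff_dirs g = {\<xi> \<in> ri_dirs. g differentiable (at \<xi>)}"

definition lin_seg_sign :: "(real \<times> real \<Rightarrow> real) \<Rightarrow> real \<times> real \<Rightarrow> sign \<Rightarrow> (real \<times> real) set" where
  "lin_seg_sign g \<xi> \<sigma> = {\<zeta> \<in> ri_dirs. g \<zeta> - g \<xi> = grad g \<xi> \<sigma> \<bullet> (\<zeta> - \<xi>)}"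

definition lin_seg :: "(real \<times> real \<Rightarrow> real) \<Rightarrow> real \<times> real \<Rightarrow> (real \<times> real) set" where
  "lin_seg g \<xi> = lin_seg_sign g \<xi> Sminus \<union> lin_seg_sign g \<xi> Splus"

locale lpp_shape = lpp_environment M T W
  for M :: "'w::polish_space measure" and T W +
  fixes g :: "real \<times> real \<Rightarrow> real"
  assumes g_concave: "concave_on {x. 0 \<le> x} g"
    and g_symmetric: "0 \<le> a \<Longrightarrow> 0 \<le> b \<Longrightarrow> g (a, b) = g (b, a)"
    and g_homogeneous: "0 \<le> c \<Longrightarrow> 0 \<le> x \<Longrightarrow> g (c *\<^sub>R x) = c * g x"
    and g_shape: "AE \<omega> in M.
      (\<lambda>n. (MAX x\<in>{x. 0 \<le> x \<and> norm1 x = int n}.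
              \<bar>passage_time (\<lambda>z. W z \<omega>) 0 x - g (rvec x)\<bar>) / real n) \<longlonglongrightarrow> 0"

definition generated_events :: "'w measure \<Rightarrow> ('w \<Rightarrow> real) set \<Rightarrow> 'w set set" where
  "generated_events M F =
     sigma_sets (space M) {f -` A \<inter> space M | f A. f \<in> F \<and> A \<in> sets borel}"

text \<open>In \<open>B_limit_G\<close>, the directions \<open>\<xi>lo\<close>, \<open>\<xi>hi\<close> are the end points of the segment \<open>lin_seg g \<xi>\<close>.\<close>

locale busemann_process = lpp_shape M T W g
  for M :: "'w::polish_space measure" and T W g +
  fixes B :: "real \<times> real \<Rightarrow> sign \<Rightarrow> int \<times> int \<Rightarrow> int \<times> int \<Rightarrow> 'w \<Rightarrow> real"
  assumes B_measurable:
      "(\<lambda>(\<omega>, \<xi>). B \<xi> \<sigma> x y \<omega>) \<in> borel_measurable (M \<Otimes>\<^sub>M restrict_space borel ri_dirs)"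
    and B_event: "\<exists>\<Omega>0\<in>events. prob \<Omega>0 = 1 \<and> (\<forall>z. T z -` \<Omega>0 \<inter> space M = \<Omega>0) \<and>
      (\<forall>\<omega>\<in>\<Omega>0. \<forall>\<xi>\<in>ri_dirs. \<forall>\<sigma> x y z.
         B \<xi> \<sigma> (x + z) (y + z) \<omega> = B \<xi> \<sigma> x y (T z \<omega>) \<and>
         B \<xi> \<sigma> x y \<omega> + B \<xi> \<sigma> y z \<omega> = B \<xi> \<sigma> x z \<omega> \<and>
         min (B \<xi> \<sigma> x (x + e1) \<omega>) (B \<xi> \<sigma> x (x + e2) \<omega>) = W x \<omega>) \<and>
      (\<forall>\<omega>\<in>\<Omega>0. \<forall>\<xi>\<in>ri_dirs. \<forall>\<xi>'\<in>ri_dirs. \<forall>x. \<xi> \<prec>\<^sub>1 \<xi>' \<longrightarrow>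
         B \<xi> Sminus x (x + e1) \<omega> \<ge> B \<xi> Splus x (x + e1) \<omega> \<and>
         B \<xi> Splus x (x + e1) \<omega> \<ge> B \<xi>' Sminus x (x + e1) \<omega> \<and>
         B \<xi>' Sminus x (x + e1) \<omega> \<ge> B \<xi>' Splus x (x + e1) \<omega> \<and>
         B \<xi> Sminus x (x + e2) \<omega> \<le> B \<xi> Splus x (x + e2) \<omega> \<and>
         B \<xi> Splus x (x + e2) \<omega> \<le> B \<xi>' Sminus x (x + e2) \<omega> \<and>
         B \<xi>' Sminus x (x + e2) \<omega> \<le> B \<xi>' Splus x (x + e2) \<omega>) \<and>
      (\<forall>\<omega>\<in>\<Omega>0. \<forall>\<xi>\<in>ri_dirs. \<forall>\<sigma> x y.
         ((\<lambda>\<zeta>. B \<zeta> \<sigma> x y \<omega>) \<longlongrightarrow> B \<xi> Sminus x y \<omega>) (at \<xi> within {\<zeta> \<in> ri_dirs. \<zeta> \<prec>\<^sub>1 \<xi>}) \<and>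
         ((\<lambda>\<zeta>. B \<zeta> \<sigma> x y \<omega>) \<longlongrightarrow> B \<xi> Splus x y \<omega>) (at \<xi> within {\<zeta> \<in> ri_dirs. \<xi> \<prec>\<^sub>1 \<zeta>})) \<and>
      (\<forall>\<omega>\<in>\<Omega>0. \<forall>\<sigma> x.
         filterlim (\<lambda>\<xi>. B \<xi> \<sigma> x (x + e1) \<omega>) at_top (at e2 within ri_dirs) \<and>
         filterlim (\<lambda>\<xi>. B \<xi> \<sigma> x (x + e2) \<omega>) at_top (at e1 within ri_dirs))"
    and B_integrable: "\<xi> \<in> ri_dirs \<Longrightarrow> integrable M (B \<xi> \<sigma> x y)"
    and B_expectation1: "\<xi> \<in> ri_dirs \<Longrightarrow> expectation (B \<xi> \<sigma> x (x + e1)) = grad g \<xi> \<sigma> \<bullet> e1"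
    and B_expectation2: "\<xi> \<in> ri_dirs \<Longrightarrow> expectation (B \<xi> \<sigma> x (x + e2)) = grad g \<xi> \<sigma> \<bullet> e2"
    and B_grad: "\<zeta> \<in> ri_dirs \<Longrightarrow> \<eta> \<in> ri_dirs \<Longrightarrow> grad g \<zeta> \<sigma> = grad g \<eta> \<sigma> \<Longrightarrow> B \<zeta> \<sigma> = B \<eta> \<sigma>"
    and B_indep: "indep_set
      (generated_events M ({W x | x. x \<in> I} \<union>
        {B \<xi> \<sigma> x y | \<xi> \<sigma> x y. \<xi> \<in> ri_dirs \<and> x \<in> I \<and> x \<le> y}))
      (generated_events M {W x | x. \<forall>z\<in>I. \<not> z \<le> x})"
    and B_no_tie: "\<xi> \<in> ri_dirs \<Longrightarrow>
      AE \<omega> in M. \<forall>x \<sigma>. B \<xi> \<sigma> x (x + e1) \<omega> \<noteq> B \<xi> \<sigma> x (x + e2) \<omega>"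
    and B_shape: "\<xi> \<in> ri_dirs \<Longrightarrow>
      AE \<omega> in M. \<forall>\<sigma>. (\<lambda>n. (MAX x\<in>{x. 0 \<le> x \<and> norm1 x = int n}.
              \<bar>B \<xi> \<sigma> 0 x \<omega> - rvec x \<bullet> grad g \<xi> \<sigma>\<bar>) / real n) \<longlonglongrightarrow> 0"
    and B_differentiable: "\<xi> \<in> diff_dirs g \<Longrightarrow>
      AE \<omega> in M. \<forall>x y. B \<xi> Splus x y \<omega> = B \<xi> Sminus x y \<omega>"
    and B_limit_G: "{\<xi>, \<xi>lo, \<xi>hi} \<subseteq> diff_dirs g \<Longrightarrow> lin_seg g \<xi> = dir_cc \<xi>lo \<xi>hi \<Longrightarrow>
      AE \<omega> in M. \<forall>v::nat \<Rightarrow> int \<times> int.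
        filterlim (\<lambda>n. norm (rvec (v n))) at_top sequentially \<longrightarrow>
        (\<lambda>n. rvec (v n) /\<^sub>R real n) \<longlonglongrightarrow> \<xi> \<longrightarrow>
        (\<forall>\<sigma> x y. (\<lambda>n. passage_time (\<lambda>z. W z \<omega>) x (v n) - passage_time (\<lambda>z. W z \<omega>) y (v n))
                   \<longlonglongrightarrow> B \<xi> \<sigma> x y \<omega>)"

text \<open>From here on, \<open>b \<xi> \<sigma> x y\<close> is one realization of the Busemann process.\<close>

type_synonym busemann = "real \<times> real \<Rightarrow> sign \<Rightarrow> int \<times> int \<Rightarrow> int \<times> int \<Rightarrow> real"

definition realization ::
  "(real \<times> real \<Rightarrow> sign \<Rightarrow> int \<times> int \<Rightarrow> int \<times> int \<Rightarrow> 'w \<Rightarrow> real) \<Rightarrow> 'w \<Rightarrow> busemann" where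
  "realization B \<omega> = (\<lambda>\<xi> \<sigma> x y. B \<xi> \<sigma> x y \<omega>)"

definition competition_direction :: "busemann \<Rightarrow> real \<times> real" where
  "competition_direction b = (THE \<xi>. \<xi> \<in> ri_dirs \<and>
     (\<forall>\<zeta>\<in>ri_dirs. \<forall>\<sigma>. (\<zeta> \<prec>\<^sub>1 \<xi> \<longrightarrow> b \<zeta> \<sigma> e1 e2 < 0) \<and> (\<xi> \<prec>\<^sub>1 \<zeta> \<longrightarrow> b \<zeta> \<sigma> e1 e2 > 0)))"

definition signed_measure_on :: "(real \<times> real) set \<Rightarrow> ((real \<times> real) set \<Rightarrow> real) \<Rightarrow> bool" where
  "signed_measure_on K \<nu> \<longleftrightarrow> \<nu> {} = 0 \<and>
     (\<forall>A::nat \<Rightarrow> (real \<times> real) set. range A \<subseteq> sets (restrict_space borel K) \<longrightarrow> disjoint_family A \<longrightarrow>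
        (\<lambda>n. \<nu> (A n)) sums \<nu> (\<Union>n. A n))"

definition total_variation :: "((real \<times> real) set \<Rightarrow> real) \<Rightarrow> (real \<times> real) set \<Rightarrow> ennreal" where
  "total_variation \<nu> A =
     (SUP P\<in>{P. finite P \<and> disjoint P \<and> P \<subseteq> sets borel \<and> \<Union>P = A}. \<Sum>C\<in>P. ennreal \<bar>\<nu> C\<bar>)"

definition signed_support :: "(real \<times> real) set \<Rightarrow> ((real \<times> real) set \<Rightarrow> real) \<Rightarrow> (real \<times> real) set" where
  "signed_support K \<nu> = \<Inter>{C. closed C \<and> C \<subseteq> K \<and> total_variation \<nu> (K - C) = 0}"

text \<open>The conditions determine the signed measure on the Borel subsets of a nondegenerate \<open>K\<close>, which
  is all that its support depends on.\<close>

definition busemann_measure ::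
  "busemann \<Rightarrow> int \<times> int \<Rightarrow> int \<times> int \<Rightarrow> (real \<times> real) set \<Rightarrow> (real \<times> real) set \<Rightarrow> real" where
  "busemann_measure b x y K = (SOME \<nu>. signed_measure_on K \<nu> \<and>
     (\<forall>\<zeta> \<eta>. \<zeta> \<prec>\<^sub>1 \<eta> \<and> \<zeta> \<in> ri_dirs \<and> \<eta> \<in> ri_dirs \<and> dir_cc \<zeta> \<eta> \<subseteq> K \<longrightarrow>
        \<nu> (dir_oc \<zeta> \<eta>) = b \<eta> Splus x y - b \<zeta> Splus x y \<and>
        \<nu> (dir_co \<zeta> \<eta>) = b \<eta> Sminus x y - b \<zeta> Sminus x y))"

definition busemann_supp :: "busemann \<Rightarrow> int \<times> int \<Rightarrow> int \<times> int \<Rightarrow> (real \<times> real) set" where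
  "busemann_supp b x y =
     \<Union>{signed_support (dir_cc \<zeta> \<eta>) (busemann_measure b x y (dir_cc \<zeta> \<eta>)) | \<zeta> \<eta>.
         \<zeta> \<in> ri_dirs \<and> \<eta> \<in> ri_dirs \<and> \<zeta> \<prec>\<^sub>1 \<eta>}"

definition exceptional_dirs :: "busemann \<Rightarrow> (real \<times> real) set" where
  "exceptional_dirs b = (\<Union>x. \<Union>y. busemann_supp b x y)"

definition busemann_graph :: "busemann \<Rightarrow> real \<times> real \<Rightarrow> sign \<Rightarrow> ((int \<times> int) \<times> (int \<times> int)) set" where
  "busemann_graph b \<xi> \<sigma> = {(x, y).
     y = (if b \<xi> \<sigma> x (x + e1) < b \<xi> \<sigma> x (x + e2) then x + e1
          else if b \<xi> \<sigma> x (x + e1) > b \<xi> \<sigma> x (x + e2) then x + e2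
          else x + e_sign \<sigma>)}"

definition dual_graph :: "busemann \<Rightarrow> real \<times> real \<Rightarrow> sign \<Rightarrow> ((real \<times> real) \<times> (real \<times> real)) set" where
  "dual_graph b \<xi> \<sigma> =
     {(dual x, dual x - rvec e) | x e. e \<in> {e1, e2} \<and> (x, x + e) \<in> busemann_graph b \<xi> \<sigma>}"

definition dual_graph_union ::
  "busemann \<Rightarrow> real \<times> real \<Rightarrow> real \<times> real \<Rightarrow> ((real \<times> real) \<times> (real \<times> real)) set" where
  "dual_graph_union b \<zeta> \<eta> = (\<Union>\<xi>\<in>dir_cc \<zeta> \<eta>. \<Union>\<sigma>. dual_graph b \<xi> \<sigma>)"

definition instability_points :: "busemann \<Rightarrow> real \<times> real \<Rightarrow> real \<times> real \<Rightarrow> (real \<times> real) set" where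
  "instability_points b \<zeta> \<eta> =
     {dual x | x. dir_cc \<zeta> \<eta> \<inter> busemann_supp b (x + e1) (x + e2) \<noteq> {}}"

definition instability_edges ::
  "busemann \<Rightarrow> real \<times> real \<Rightarrow> real \<times> real \<Rightarrow> ((real \<times> real) \<times> (real \<times> real)) set" where
  "instability_edges b \<zeta> \<eta> = dual_graph_union b \<zeta> \<eta> \<inter>
     (instability_points b \<zeta> \<eta> \<times> instability_points b \<zeta> \<eta>)"

text \<open>Paths have at least one edge, so that no point is an ancestor of itself.\<close>

definition ancestor ::
  "busemann \<Rightarrow> real \<times> real \<Rightarrow> real \<times> real \<Rightarrow> real \<times> real \<Rightarrow> real \<times> real \<Rightarrow> bool" where
  "ancestor b \<zeta> \<eta> u v \<longleftrightarrow> (u, v) \<in> (instability_edges b \<zeta> \<eta>)\<^sup>+"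

definition branch_point :: "busemann \<Rightarrow> real \<times> real \<Rightarrow> real \<times> real \<Rightarrow> real \<times> real \<Rightarrow> bool" where
  "branch_point b \<zeta> \<eta> u \<longleftrightarrow> u \<in> instability_points b \<zeta> \<eta> \<and>
     ancestor b \<zeta> \<eta> u (u - e1) \<and> ancestor b \<zeta> \<eta> u (u - e2)"

definition coalescence_point :: "busemann \<Rightarrow> real \<times> real \<Rightarrow> real \<times> real \<Rightarrow> real \<times> real \<Rightarrow> bool" where
  "coalescence_point b \<zeta> \<eta> u \<longleftrightarrow> u \<in> instability_points b \<zeta> \<eta> \<and>
     ancestor b \<zeta> \<eta> (u + e1) u \<and> ancestor b \<zeta> \<eta> (u + e2) u"

definition branch_sequence ::
  "busemann \<Rightarrow> real \<times> real \<Rightarrow> real \<times> real \<Rightarrow> int \<times> int \<Rightarrow> (nat \<Rightarrow> real \<times> real) \<Rightarrow> bool" where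
  "branch_sequence b \<zeta> \<eta> z s \<longleftrightarrow> cless (rvec z) (s 0) \<and> (\<forall>n. cless (s n) (s (Suc n))) \<and>
     (\<forall>n. branch_point b \<zeta> \<eta> (s n))"

definition jump_condition ::
  "'w measure \<Rightarrow> (real \<times> real \<Rightarrow> sign \<Rightarrow> int \<times> int \<Rightarrow> int \<times> int \<Rightarrow> 'w \<Rightarrow> real) \<Rightarrow> bool" where
  "jump_condition M B \<longleftrightarrow> (AE \<omega> in M. \<forall>x y. \<forall>\<xi>\<in>busemann_supp (realization B \<omega>) x y.
     \<xi> isolated_in busemann_supp (realization B \<omega>) x y)"

definition no_nontrivial_biinfinite :: "'w measure \<Rightarrow> (int \<times> int \<Rightarrow> 'w \<Rightarrow> real) \<Rightarrow> bool" where
  "no_nontrivial_biinfinite M W \<longleftrightarrow>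
     (AE \<omega> in M. \<forall>\<pi>. biinfinite_geodesic (\<lambda>z. W z \<omega>) \<pi> \<longrightarrow> trivial_path \<pi>)"

end

theory Submission
  imports Defs
begin

text \<open>
  The probabilistic input is that, in a fixed direction, the Busemann graph has no backward infinite
  path. A point has on average one ancestor in a level far below it. If it kept having ancestors
  with positive probability, then with probability bounded below these would form a window of
  bounded size with bounded Busemann increments, and the independent weights below the window would
  then cut off all backward paths with a probability bounded below; these events are disjoint along a
  sequence of levels. By planarity the dual paths merge, by mass transport the dual graph has no
  backward infinite path either, and by planarity again the paths of the graph coalesce.

  The rest is deterministic. An instability point passes each direction of its support on to the end
  points of its outgoing edges and receives it from one of its predecessors. Two descending paths of
  the instability graph that never met would enclose a backward infinite path of a fixed direction,
  respectively, for a single direction, a nontrivial bi-infinite geodesic. The leftmost and rightmost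
  paths of the Busemann graphs from the two sides of a point with a jump in \<open>[\<zeta>, \<eta>]\<close> never meet
  again. Since each of the two graphs coalesces, this holds from some level on for the paths from
  arbitrary points, which gives branch points; and the descending paths from a point with a jump
  between them, far enough up, enclose any given instability points.
\<close>

section \<open>Lattice paths\<close>

text \<open>The obstacle is that almost sure statements are available for one direction at a time,
  while the theorem concerns all directions at once, including the random ones with ties.
  Probability therefore enters only through rational directions. If the interval is nondegenerate, a
  rational direction lies inside it, and monotonicity in the direction places its graph between the
  extreme graphs of the interval. For a single direction nothing fits in between. There (N) replaces
  the missing information on descendants: a trivial geodesic is a straight line, and such a line
  would persist in the graph of a rational direction to one side. For common ancestors, and for
  branch points of a single direction, the extreme one-sided graphs themselves have to coalesce.
  Here (J) makes the increments locally constant on each side of a direction; since finite signed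
  sums of weights coincide only trivially, such a constant fixes the finite loop closed by two
  coalescing paths, so that coalescence passes to the one-sided limit. At an instability point, the
  direction in which the increment changes sign alone decides which outgoing edges exist.\<close>

definition stp :: "bool \<Rightarrow> int \<times> int" where
  "stp c = (if c then e1 else e2)"

definition up :: "(int \<times> int \<Rightarrow> bool) \<Rightarrow> int \<times> int \<Rightarrow> int \<times> int" where
  "up s x = x + stp (s x)"

text \<open>Edge of the dual graph, with the dual point \<open>x + ehat_star\<close> represented by
  \<open>x\<close>: it steps back by the same vector by which \<open>up s\<close> steps forward at
  \<open>x\<close>.\<close>

definition dn :: "(int \<times> int \<Rightarrow> bool) \<Rightarrow> int \<times> int \<Rightarrow> int \<times> int" where
  "dn s x = x - stp (s x)"

text \<open>Asking for ancestors of every depth keeps this a countable, hence measurable, condition.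
  Since a point has at most two predecessors, it yields an infinite path, see
  \<open>ex_biinfinite_path\<close>.\<close>

definition backward_infinite :: "(int \<times> int \<Rightarrow> bool) \<Rightarrow> int \<times> int \<Rightarrow> bool" where
  "backward_infinite s v \<longleftrightarrow> (\<forall>n. \<exists>u. (up s ^^ n) u = v)"

definition coalescing :: "(int \<times> int \<Rightarrow> bool) \<Rightarrow> bool" where
  "coalescing s \<longleftrightarrow> (\<forall>v v'. level v = level v' \<longrightarrow> (\<exists>n. (up s ^^ n) v = (up s ^^ n) v'))"

lemmas lattice_defs = e1_def e2_def level_def plus_prod_def minus_prod_def

lemma level_fst_eqI: "level x = level y \<Longrightarrow> fst x = fst y \<Longrightarrow> x = y"
  by (cases x; cases y) (auto simp: level_def)

lemma level_up [simp]: "level (up s x) = level x + 1"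
  and level_dn [simp]: "level (dn s x) = level x - 1"
  by (auto simp: up_def dn_def stp_def lattice_defs)

lemma level_up_pow [simp]: "level ((up s ^^ n) x) = level x + int n"
  by (induction n) auto

lemma level_dn_pow [simp]: "level ((dn s ^^ n) x) = level x - int n"
  by (induction n) auto

lemma fst_up: "fst (up s x) = fst x + (if s x then 1 else 0)"
  and fst_dn: "fst (dn s x) = fst x - (if s x then 1 else 0)"
  by (auto simp: up_def dn_def stp_def lattice_defs)

text \<open>Distinct points of one level differ by at least 1 in the first coordinate and a step
  adds at most 1, so only paths at the same point need the comparison of \<open>s\<close> and
  \<open>s'\<close>.\<close>

lemma up_mono:
  assumes "\<And>x. s x \<Longrightarrow> s' x" "level x = level y" "fst x \<le> fst y"
  shows "fst (up s x) \<le> fst (up s' y)"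
  using assms level_fst_eqI[of x y] by (cases "fst x = fst y") (auto simp: fst_up)

lemma up_pow_mono:
  assumes "\<And>x. s x \<Longrightarrow> s' x" "level x = level y" "fst x \<le> fst y"
  shows "fst ((up s ^^ n) x) \<le> fst ((up s' ^^ n) y)"
  by (induction n) (use assms in \<open>auto intro!: up_mono\<close>)

lemma up_ge: "x \<le> up s x"
  by (auto simp: up_def stp_def lattice_defs less_eq_prod_def)

lemma up_pow_ge: "x \<le> (up s ^^ n) x"
  by (induction n) (auto intro: order_trans up_ge)

text \<open>In the next four lemmas a dual path starts at the dual point \<open>y + ehat_star\<close>, which lies
  between the lattice points with first coordinates \<open>fst y\<close> and \<open>fst y + 1\<close> of the next level.\<close>

lemma dn_left_of_up:
  assumes "\<And>x. s x \<Longrightarrow> s' x" "level y = level v" "fst y < fst (up s v)"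
  shows "fst (dn s' y) < fst v"
  using assms level_fst_eqI[of y v] by (cases "fst y = fst v") (auto simp: fst_up fst_dn split: if_splits)

lemma dn_right_of_up:
  assumes "\<And>x. s' x \<Longrightarrow> s x" "level y = level v" "fst (up s v) \<le> fst y"
  shows "fst v \<le> fst (dn s' y)"
  using assms(2,3) assms(1)[of y] level_fst_eqI[of y v]
  by (cases "fst y = fst v") (auto simp: fst_up fst_dn split: if_splits)

lemma dn_pow_left_of_up_pow:
  assumes "\<And>x. s x \<Longrightarrow> s' x" "level y + 1 = level v + int n" "fst y < fst ((up s ^^ n) v)"
  shows "fst ((dn s' ^^ n) y) < fst v"
  using assms(2,3)
proof (induction n arbitrary: y)
  case (Suc n)
  have "fst (dn s' y) < fst ((up s ^^ n) v)"
    using Suc.prems by (intro dn_left_of_up[OF assms(1)]) auto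
  then have "fst ((dn s' ^^ n) (dn s' y)) < fst v"
    using Suc.prems by (intro Suc.IH) auto
  then show ?case by (simp add: funpow_swap1)
qed auto

lemma dn_pow_right_of_up_pow:
  assumes "\<And>x. s' x \<Longrightarrow> s x" "level y + 1 = level v + int n" "fst ((up s ^^ n) v) \<le> fst y"
  shows "fst v \<le> fst ((dn s' ^^ n) y)"
  using assms(2,3)
proof (induction n arbitrary: y)
  case (Suc n)
  have "fst ((up s ^^ n) v) \<le> fst (dn s' y)"
    using Suc.prems by (intro dn_right_of_up[OF assms(1)]) auto
  then have "fst v \<le> fst ((dn s' ^^ n) (dn s' y))"
    using Suc.prems by (intro Suc.IH) auto
  then show ?case by (simp add: funpow_swap1)
qed auto

lemma ancestors_antimono:
  assumes "(up s ^^ n) u = v" "m \<le> n"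
  shows "\<exists>u'. (up s ^^ m) u' = v"
  using assms by (metis funpow_add le_add_diff_inverse o_apply)

text \<open>Dual paths that never meet bound a strip. At every depth some lattice point lies inside,
  its \<open>s\<close> path cannot leave the strip, and so it reaches the finite set
  \<open>F\<close> of lattice points between the two starting points. By the pigeonhole principle
  one point of \<open>F\<close> has ancestors of every depth.\<close>

lemma dual_paths_meet_or_backward_infinite:
  assumes AC: "\<And>x. sA x \<Longrightarrow> s x" "\<And>x. s x \<Longrightarrow> sC x"
    and xy: "level x = level y" "fst x < fst y"
    and nomeet: "\<And>n. (dn sA ^^ n) x \<noteq> (dn sC ^^ n) y"
  shows "\<exists>v. backward_infinite s v"
proof -
  have lt: "fst ((dn sA ^^ n) x) < fst ((dn sC ^^ n) y)" for n
  proof (induction n)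
    case (Suc n)
    have "fst ((dn sA ^^ Suc n) x) \<le> fst ((dn sC ^^ Suc n) y)"
      using Suc by (auto simp: fst_dn)
    moreover have "fst ((dn sA ^^ Suc n) x) \<noteq> fst ((dn sC ^^ Suc n) y)"
      using nomeet[of "Suc n"] xy level_fst_eqI[of "(dn sA ^^ Suc n) x" "(dn sC ^^ Suc n) y"]
      by (auto simp del: funpow.simps)
    ultimately show ?case by linarith
  qed (use xy in auto)
  define F where "F = {v. level v = level x + 1 \<and> fst x < fst v \<and> fst v \<le> fst y}"
  have "F \<subseteq> (\<lambda>i. (i, level x + 1 - i)) ` {fst x..fst y}"
    by (auto simp: F_def level_def image_iff)
  then have "finite F" by (rule finite_subset) auto
  have "\<exists>v\<in>F. \<exists>u. (up s ^^ n) u = v" for n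
  proof -
    \<comment> \<open>The lattice point immediately to the left of the right-hand dual point at
      depth \<open>n\<close>; by \<open>lt\<close> it is still to the right of the left-hand
      one.\<close>
    define u where "u = (let i = fst ((dn sC ^^ n) y) in (i, level x - int n + 1 - i))"
    have u: "level u = level x - int n + 1" "fst u = fst ((dn sC ^^ n) y)"
      by (auto simp: u_def Let_def level_def)
    have "fst x < fst ((up s ^^ n) u)"
      using dn_pow_right_of_up_pow[of sA s x u n] AC u lt[of n] by force
    moreover have "fst ((up s ^^ n) u) \<le> fst y"
      using dn_pow_left_of_up_pow[of s sC y u n] AC u xy by force
    moreover have "level ((up s ^^ n) u) = level x + 1"
      using u by simp
    ultimately show ?thesis unfolding F_def by blast
  qed
  then obtain f where f: "\<And>n. f n \<in> F" "\<And>n. \<exists>u. (up s ^^ n) u = f n" by metis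
  then have "finite (range f)" using \<open>finite F\<close> by (meson finite_subset image_subsetI)
  then obtain n0 where n0: "infinite {n. f n = f n0}"
    using pigeonhole_infinite[of UNIV f] by auto
  have "backward_infinite s (f n0)"
    unfolding backward_infinite_def
  proof
    fix n
    obtain m where "m > n" "f m = f n0" using n0 by (auto simp: infinite_nat_iff_unbounded)
    then show "\<exists>u. (up s ^^ n) u = f n0" using f(2)[of m] ancestors_antimono[of m s _ "f n0" n] by auto
  qed
  then show ?thesis by blast
qed

lemma dn_eq_up_reflect: "dn s x = - up (\<lambda>z. s (- z)) (- x)"
  by (simp add: up_def dn_def)

lemma dn_pow_reflect: "(dn s ^^ n) x = - (up (\<lambda>z. s (- z)) ^^ n) (- x)"
  by (induction n) (auto simp: dn_eq_up_reflect)

lemma up_pow_reflect: "(up s ^^ n) x = - (dn (\<lambda>z. s (- z)) ^^ n) (- x)"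
  by (simp add: dn_pow_reflect)

lemma level_uminus [simp]: "level (- x) = - level x"
  by (simp add: level_def)

lemma dual_paths_coalesce:
  assumes "\<And>v. \<not> backward_infinite s v" "level x = level y"
  shows "\<exists>n. (dn s ^^ n) x = (dn s ^^ n) y"
proof (rule ccontr)
  assume *: "\<not> ?thesis"
  have "fst x \<noteq> fst y"
    using * assms(2) level_fst_eqI[of x y] by (metis funpow_0)
  then consider "fst x < fst y" | "fst y < fst x" by linarith
  then show False
    using dual_paths_meet_or_backward_infinite[of s s s x y] dual_paths_meet_or_backward_infinite[of s s s y x]
      assms * by cases metis+
qed

text \<open>The paths of \<open>s\<close> are the point reflections of the dual paths of the
  reflected field, to which \<open>dual_paths_coalesce\<close> applies.\<close>

lemma coalescing_if_no_dual_backward_infinite: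
  assumes "\<And>v. \<not> backward_infinite (\<lambda>z. s (- z)) v"
  shows "coalescing s"
  unfolding coalescing_def up_pow_reflect
  using dual_paths_coalesce[OF assms] by (metis level_uminus)

lemma coalescing_upto:
  assumes "coalescing s"
  shows "\<exists>m n. (up s ^^ m) v = (up s ^^ n) v'"
proof -
  have "level ((up s ^^ nat (level v' - level v)) v) = level ((up s ^^ nat (level v - level v')) v')"
    by simp
  then show ?thesis
    using assms unfolding coalescing_def by (metis funpow_add o_apply)
qed

lemma up_pow_shift: "(up s ^^ n) (x + z) = (up (\<lambda>y. s (y + z)) ^^ n) x + z"
  by (induction n) (auto simp: up_def algebra_simps)

lemma cocycle_path_le:
  fixes \<beta> :: "int \<times> int \<Rightarrow> int \<times> int \<Rightarrow> real"
  assumes cocycle: "\<And>x y z. \<beta> x y + \<beta> y z = \<beta> x z"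
    and step: "\<And>m. m < n \<Longrightarrow> c \<le> \<beta> (p m) (p (Suc m))"
  shows "real n * c \<le> \<beta> (p 0) (p n)"
  using step
proof (induction n)
  case 0
  then show ?case using cocycle[of "p 0" "p 0" "p 0"] by simp
next
  case (Suc n)
  then have "real n * c \<le> \<beta> (p 0) (p n)" "c \<le> \<beta> (p n) (p (Suc n))" by auto
  then show ?case using cocycle[of "p 0" "p n" "p (Suc n)"] by (simp add: algebra_simps)
qed

lemma cocycle_path_ge:
  fixes \<beta> :: "int \<times> int \<Rightarrow> int \<times> int \<Rightarrow> real"
  assumes cocycle: "\<And>x y z. \<beta> x y + \<beta> y z = \<beta> x z"
    and step: "\<And>m. m < n \<Longrightarrow> \<beta> (p m) (p (Suc m)) \<le> c"
  shows "\<beta> (p 0) (p n) \<le> real n * c"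
  using cocycle_path_le[of "\<lambda>x y. - \<beta> x y" n "- c" p] assms by (simp add: algebra_simps)

text \<open>The window of the points strictly between \<open>v + (0, c)\<close> and \<open>v + (c, 0)\<close> loses all its backward
  paths of length \<open>M\<close> when the weights are large on the two rays that end at these two points and
  small otherwise: a path into the window avoids both rays, and one of them is a better way up.\<close>

lemma window_has_no_long_backward_path:
  fixes \<beta> :: "int \<times> int \<Rightarrow> int \<times> int \<Rightarrow> real" and c :: int and M :: nat
  assumes cocycle: "\<And>x y z. \<beta> x y + \<beta> y z = \<beta> x z"
    and w: "\<And>x. min (\<beta> x (x + e1)) (\<beta> x (x + e2)) = w x"
    and s: "\<And>x. s x \<longleftrightarrow> \<beta> x (x + e1) \<le> \<beta> x (x + e2)"
    and K: "\<And>i. 0 \<le> i \<Longrightarrow> i < c \<Longrightarrow> \<bar>\<beta> (v + (i, c - i)) (v + (i + 1, c - i - 1))\<bar> \<le> K"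
    and weights: "\<And>i j. i \<le> c \<Longrightarrow> j \<le> c \<Longrightarrow> c - int M \<le> i + j \<Longrightarrow> i + j < c \<Longrightarrow>
      w (v + (i, j)) \<in> (if j = c \<and> i < 0 \<or> i = c \<and> j < 0 then {hi..} else {lo..a})"
    and M: "real_of_int c * K < (real M - real_of_int c) / 2 * (hi - lo) - real M * (a - lo)"
    and c: "c < int M" "lo \<le> hi"
    and x: "(up s ^^ M) x = v + (r, c - r)" and r: "0 < r" "r < c"
  shows False
proof -
  have up_eq: "\<beta> y (up s y) = w y" for y
    using s[of y] w[of y] by (auto simp: up_def stp_def)
  have w_le: "w y \<le> \<beta> y (y + e1)" "w y \<le> \<beta> y (y + e2)" for y
    using w[of y] by linarith+
  obtain i j where ij: "x = v + (i, j)"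
    by (metis add_diff_cancel_left' diff_add_cancel prod.exhaust add.commute)
  have "level x = level v + c - int M"
    using level_up_pow[where s = s and n = M and x = x] by (simp add: x) (simp add: level_def)
  then have sum: "i + j = c - int M" by (simp add: ij level_def)
  have "x \<le> v + (r, c - r)"
    using up_pow_ge[of x M s] x by simp
  then have ij_le: "i \<le> r" "j \<le> c - r" by (auto simp: ij less_eq_prod_def)
  \<comment> \<open>Along the graph the increments equal the weights. A path that ends strictly
    inside the window keeps both coordinates below \<open>c\<close>, so it avoids the two rays and
    sees only weights at most \<open>a\<close>.\<close>
  have into: "\<beta> x (v + (r, c - r)) \<le> real M * a"
  proof -
    have "\<beta> ((up s ^^ 0) x) ((up s ^^ M) x) \<le> real M * a"
    proof (rule cocycle_path_ge[of \<beta>, OF cocycle])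
      fix m assume m: "m < M"
      define y where "y = (up s ^^ m) x"
      obtain i' j' where y: "y = v + (i', j')"
        by (metis add_diff_cancel_left' diff_add_cancel prod.exhaust add.commute)
      have "level y = level x + int m" by (simp add: y_def)
      then have lev: "i' + j' = c - int M + int m" using sum by (simp add: y ij level_def)
      have "(up s ^^ M) x = (up s ^^ (M - m)) y"
        using m unfolding y_def by (metis add.commute funpow_add le_add_diff_inverse less_imp_le o_apply)
      then have "y \<le> v + (r, c - r)" using up_pow_ge[of y "M - m" s] x by simp
      then have "i' \<le> r" "j' \<le> c - r" by (auto simp: y less_eq_prod_def)
      with weights[of i' j'] lev m r have "w y \<le> a" by (auto simp: y split: if_splits)
      then show "\<beta> ((up s ^^ m) x) ((up s ^^ Suc m) x) \<le> a"
        using up_eq[of y] by (simp add: y_def)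
    qed
    then show ?thesis using x by simp
  qed
  have telescope: "\<bar>\<beta> (v + (i, c - i)) (v + (i + int n, c - i - int n))\<bar> \<le> real n * K"
    if "0 \<le> i" "i + int n \<le> c" for i n
    using that
  proof (induction n)
    case 0
    then show ?case using cocycle[of "v + (i, c - i)" "v + (i, c - i)" "v + (i, c - i)"] by simp
  next
    case (Suc n)
    have "\<bar>\<beta> (v + (i + int n, c - (i + int n))) (v + (i + int n + 1, c - (i + int n) - 1))\<bar> \<le> K"
      using Suc.prems by (intro K) auto
    moreover have "\<bar>\<beta> (v + (i, c - i)) (v + (i + int n, c - i - int n))\<bar> \<le> real n * K"
      using Suc by auto
    moreover have "\<beta> (v + (i, c - i)) (v + (i + int n, c - i - int n)) +
        \<beta> (v + (i + int n, c - i - int n)) (v + (i + int n + 1, c - i - int n - 1)) =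
        \<beta> (v + (i, c - i)) (v + (i + int n + 1, c - i - int n - 1))"
      by (rule cocycle)
    ultimately show ?case by (simp add: algebra_simps)
  qed
  have K0: "0 \<le> K" using K[of 0] r by force
  \<comment> \<open>Since \<open>i + j = c - M\<close>, the starting point lies far out on one side.
    In the first case, going straight up to height \<open>c\<close> and then along the ray to its
    end gains at least \<open>n * lo + m * hi\<close>, where \<open>m\<close> is at least half of
    \<open>M - c\<close>. The path into the window gains at most \<open>M * a\<close>, and inside
    the window the function varies by at most \<open>c * K\<close>. The second case is the mirror
    image.\<close>
  consider "2 * i \<le> c - int M" | "2 * j \<le> c - int M" using sum by linarith
  then show False
  proof cases
    case 1
    define n where "n = nat (c - j)"
    define m where "m = nat (- i)"
    have nm: "int n = c - j" "int m = - i" using 1 ij_le r c by (auto simp: n_def m_def)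
    have "real n * lo \<le> \<beta> (v + (i, j + int 0)) (v + (i, j + int n))"
    proof (rule cocycle_path_le[of \<beta>, OF cocycle])
      fix k assume k: "k < n"
      have "lo \<le> w (v + (i, j + int k))"
        using weights[of i "j + int k"] k nm 1 c sum r by (auto split: if_splits)
      also have "\<dots> \<le> \<beta> (v + (i, j + int k)) (v + (i, j + int k) + e2)" by (rule w_le)
      finally show "lo \<le> \<beta> (v + (i, j + int k)) (v + (i, j + int (Suc k)))"
        by (simp add: e2_def algebra_simps)
    qed
    moreover have "real m * hi \<le> \<beta> (v + (i + int 0, c)) (v + (i + int m, c))"
    proof (rule cocycle_path_le[of \<beta>, OF cocycle])
      fix k assume k: "k < m"
      have "hi \<le> w (v + (i + int k, c))"
        using weights[of "i + int k" c] k nm 1 c sum r ij_le by (auto split: if_splits)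
      also have "\<dots> \<le> \<beta> (v + (i + int k, c)) (v + (i + int k, c) + e1)" by (rule w_le)
      finally show "hi \<le> \<beta> (v + (i + int k, c)) (v + (i + int (Suc k), c))"
        by (simp add: e1_def algebra_simps)
    qed
    moreover have "\<beta> x (v + (i, c)) + \<beta> (v + (i, c)) (v + (0, c)) = \<beta> x (v + (0, c))"
      by (rule cocycle)
    ultimately have up: "real n * lo + real m * hi \<le> \<beta> x (v + (0, c))"
      using nm by (simp add: ij)
    have "\<bar>\<beta> (v + (0, c)) (v + (r, c - r))\<bar> \<le> real_of_int r * K"
      using telescope[of 0 "nat r"] r by simp
    also have "\<dots> \<le> real_of_int c * K" using r K0 by (intro mult_right_mono) auto
    finally have "real n * lo + real m * hi - real M * a \<le> real_of_int c * K"
      using up into cocycle[of x "v + (0, c)" "v + (r, c - r)"] by linarith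
    moreover have "real n = real M - real m"
      using nm sum by linarith
    moreover have "(real M - real_of_int c) / 2 * (hi - lo) \<le> real m * (hi - lo)"
    proof (rule mult_right_mono)
      have "real_of_int (int M - c) \<le> real_of_int (2 * int m)"
        using 1 nm by (simp only: of_int_le_iff)
      then show "(real M - real_of_int c) / 2 \<le> real m" by simp
      show "0 \<le> hi - lo" using c by simp
    qed
    ultimately show False using M by (simp add: algebra_simps)
  next
    case 2
    define n where "n = nat (c - i)"
    define m where "m = nat (- j)"
    have nm: "int n = c - i" "int m = - j" using 2 ij_le r c by (auto simp: n_def m_def)
    have "real n * lo \<le> \<beta> (v + (i + int 0, j)) (v + (i + int n, j))"
    proof (rule cocycle_path_le[of \<beta>, OF cocycle])
      fix k assume k: "k < n"
      have "lo \<le> w (v + (i + int k, j))"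
        using weights[of "i + int k" j] k nm 2 c sum r by (auto split: if_splits)
      also have "\<dots> \<le> \<beta> (v + (i + int k, j)) (v + (i + int k, j) + e1)" by (rule w_le)
      finally show "lo \<le> \<beta> (v + (i + int k, j)) (v + (i + int (Suc k), j))"
        by (simp add: e1_def algebra_simps)
    qed
    moreover have "real m * hi \<le> \<beta> (v + (c, j + int 0)) (v + (c, j + int m))"
    proof (rule cocycle_path_le[of \<beta>, OF cocycle])
      fix k assume k: "k < m"
      have "hi \<le> w (v + (c, j + int k))"
        using weights[of c "j + int k"] k nm 2 c sum r ij_le by (auto split: if_splits)
      also have "\<dots> \<le> \<beta> (v + (c, j + int k)) (v + (c, j + int k) + e2)" by (rule w_le)
      finally show "hi \<le> \<beta> (v + (c, j + int k)) (v + (c, j + int (Suc k)))"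
        by (simp add: e2_def algebra_simps)
    qed
    moreover have "\<beta> x (v + (c, j)) + \<beta> (v + (c, j)) (v + (c, 0)) = \<beta> x (v + (c, 0))"
      by (rule cocycle)
    ultimately have up: "real n * lo + real m * hi \<le> \<beta> x (v + (c, 0))"
      using nm by (simp add: ij)
    have "\<bar>\<beta> (v + (r, c - r)) (v + (c, 0))\<bar> \<le> real_of_int (c - r) * K"
      using telescope[of r "nat (c - r)"] r by simp
    also have "\<dots> \<le> real_of_int c * K" using r K0 by (intro mult_right_mono) auto
    finally have "real n * lo + real m * hi - real M * a \<le> real_of_int c * K"
      using up into cocycle[of x "v + (r, c - r)" "v + (c, 0)"] by linarith
    moreover have "real n = real M - real m"
      using nm sum by linarith
    moreover have "(real M - real_of_int c) / 2 * (hi - lo) \<le> real m * (hi - lo)"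
    proof (rule mult_right_mono)
      have "real_of_int (int M - c) \<le> real_of_int (2 * int m)"
        using 2 nm by (simp only: of_int_le_iff)
      then show "(real M - real_of_int c) / 2 \<le> real m" by simp
      show "0 \<le> hi - lo" using c by simp
    qed
    ultimately show False using M by (simp add: algebra_simps)
  qed
qed

section \<open>Stationary fields\<close>

text \<open>One step before the first meeting the two paths are at distinct points with the same
  successor, and both points have inherited backward infinity. This is the configuration that
  stationarity excludes.\<close>

lemma coalescing_backward_infinite_meet:
  assumes "coalescing s" "backward_infinite s x" "backward_infinite s y" "level x = level y" "x \<noteq> y"
  shows "\<exists>v. (s (v - e1) \<and> backward_infinite s (v - e1)) \<and> (\<not> s (v - e2) \<and> backward_infinite s (v - e2))"
proof -
  have BI_pow: "backward_infinite s ((up s ^^ n) u)" if "backward_infinite s u" for n u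
    unfolding backward_infinite_def
  proof
    fix m
    obtain u' where "(up s ^^ (m - n)) u' = u" using \<open>backward_infinite s u\<close> unfolding backward_infinite_def by blast
    then have "(up s ^^ (n + (m - n))) u' = (up s ^^ n) u" by (simp add: funpow_add)
    then show "\<exists>u'. (up s ^^ m) u' = (up s ^^ n) u" by (rule ancestors_antimono) simp
  qed
  define n where "n = (LEAST n. (up s ^^ n) x = (up s ^^ n) y)"
  have n: "(up s ^^ n) x = (up s ^^ n) y"
    unfolding n_def using assms(1,4) by (metis (mono_tags, lifting) LeastI_ex coalescing_def)
  with \<open>x \<noteq> y\<close> obtain m where m: "n = Suc m" by (cases n) auto
  define u u' where "u = (up s ^^ m) x" and "u' = (up s ^^ m) y"
  have ne: "u \<noteq> u'" using not_less_Least[of m "\<lambda>n. (up s ^^ n) x = (up s ^^ n) y"] m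
    by (auto simp: n_def u_def u'_def)
  have eq: "up s u = up s u'" using n by (simp add: m u_def u'_def)
  have BI: "backward_infinite s u" "backward_infinite s u'"
    using BI_pow assms by (auto simp: u_def u'_def)
  have "s u \<noteq> s u'"
  proof
    assume "s u = s u'"
    with eq ne show False by (simp add: up_def)
  qed
  then consider "s u" "\<not> s u'" | "s u'" "\<not> s u" by blast
  then show ?thesis
  proof cases
    case 1
    then have "up s u - e1 = u" "up s u - e2 = u'"
      using eq by (simp_all add: up_def stp_def) (metis add_diff_cancel_right')
    with 1 BI show ?thesis by metis
  next
    case 2
    then have "up s u - e1 = u'" "up s u - e2 = u"
      using eq by (simp_all add: up_def stp_def) (metis add_diff_cancel_right')
    with 2 BI show ?thesis by metis
  qed
qed

text \<open>Compactness for binary branching: if each of the two candidate predecessors failed at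
  some depth, then the larger of the two depths would be unreachable from \<open>v\<close>.\<close>

lemma backward_infinite_iff:
  "backward_infinite s v \<longleftrightarrow>
     s (v - e1) \<and> backward_infinite s (v - e1) \<or> \<not> s (v - e2) \<and> backward_infinite s (v - e2)"
proof
  assume *: "backward_infinite s v"
  show "s (v - e1) \<and> backward_infinite s (v - e1) \<or> \<not> s (v - e2) \<and> backward_infinite s (v - e2)"
  proof (rule ccontr)
    assume neg: "\<not> ?thesis"
    have *: "\<exists>u p. (up s ^^ n) u = p \<and> up s p = v" for n
      using *[unfolded backward_infinite_def, rule_format, of "Suc n"] by auto
    have pred: "p = v - e1 \<and> s (v - e1) \<or> p = v - e2 \<and> \<not> s (v - e2)" if "up s p = v" for p
      using that by (cases "s p") (auto simp: up_def stp_def)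
    obtain n1 where n1: "s (v - e1) \<longrightarrow> (\<forall>u. (up s ^^ n1) u \<noteq> v - e1)"
      using neg unfolding backward_infinite_def by blast
    obtain n2 where n2: "\<not> s (v - e2) \<longrightarrow> (\<forall>u. (up s ^^ n2) u \<noteq> v - e2)"
      using neg unfolding backward_infinite_def by blast
    obtain u p where up: "(up s ^^ max n1 n2) u = p" "up s p = v" using * by blast
    then show False
      using pred[of p] n1 n2 ancestors_antimono[OF up(1), of n1] ancestors_antimono[OF up(1), of n2]
      by auto
  qed
next
  have step: "backward_infinite s (up s u)" if "backward_infinite s u" for u
    unfolding backward_infinite_def
  proof
    fix n
    obtain u' where "(up s ^^ (n - 1)) u' = u"
      using \<open>backward_infinite s u\<close> unfolding backward_infinite_def by blast
    then have "(up s ^^ (Suc (n - 1))) u' = up s u" by simp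
    then show "\<exists>u'. (up s ^^ n) u' = up s u" by (rule ancestors_antimono) simp
  qed
  assume "s (v - e1) \<and> backward_infinite s (v - e1) \<or> \<not> s (v - e2) \<and> backward_infinite s (v - e2)"
  then show "backward_infinite s v"
    using step[of "v - e1"] step[of "v - e2"] by (auto simp: up_def stp_def)
qed

context prob_space
begin

lemma prob_shift_eq:
  assumes T: "T \<in> measurable M M" "distr M M T = M"
    and meas: "Measurable.pred M P" "Measurable.pred M Q"
    and eq: "AE \<omega> in M. Q \<omega> = P (T \<omega>)"
  shows "prob {\<omega> \<in> space M. Q \<omega>} = prob {\<omega> \<in> space M. P \<omega>}"
proof -
  have "prob {\<omega> \<in> space M. P \<omega>} = measure (distr M M T) {\<omega> \<in> space M. P \<omega>}"
    by (simp add: T)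
  also have "\<dots> = prob (T -` {\<omega> \<in> space M. P \<omega>} \<inter> space M)"
    using T meas by (intro measure_distr) auto
  also have "T -` {\<omega> \<in> space M. P \<omega>} \<inter> space M = {\<omega> \<in> space M. P (T \<omega>)}"
    using measurable_space[OF T(1)] by auto
  also have "prob {\<omega> \<in> space M. P (T \<omega>)} = prob {\<omega> \<in> space M. Q \<omega>}"
    using eq T(1) meas by (intro prob_eq_AE) auto
  finally show ?thesis ..
qed

lemma sum_indicator_eq_card:
  assumes "finite I" "\<omega> \<in> space M"
  shows "(\<Sum>i\<in>I. indicat_real {\<omega> \<in> space M. P i \<omega>} \<omega>) = real (card {i \<in> I. P i \<omega>})"
proof -
  have "(\<Sum>i\<in>I. indicat_real {\<omega> \<in> space M. P i \<omega>} \<omega>) = (\<Sum>i\<in>I. if P i \<omega> then 1 else 0)"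
    using assms by (intro sum.cong) (auto simp: indicator_def)
  then show ?thesis using \<open>finite I\<close> by (simp add: sum.If_cases Int_def conj_commute)
qed

lemma sum_prob_le_if_AE_card_le:
  assumes "finite I" "\<And>i. i \<in> I \<Longrightarrow> Measurable.pred M (P i)" "AE \<omega> in M. card {i \<in> I. P i \<omega>} \<le> n"
  shows "(\<Sum>i\<in>I. prob {\<omega> \<in> space M. P i \<omega>}) \<le> real n"
proof -
  have int: "integrable M (\<lambda>\<omega>. indicat_real {\<omega> \<in> space M. P i \<omega>} \<omega>)" if "i \<in> I" for i
    using assms(2)[OF that] by (auto simp: emeasure_eq_measure)
  have "(\<Sum>i\<in>I. prob {\<omega> \<in> space M. P i \<omega>}) = (\<Sum>i\<in>I. expectation (indicat_real {\<omega> \<in> space M. P i \<omega>}))"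
    using assms(2) by (intro sum.cong) auto
  also have "\<dots> = expectation (\<lambda>\<omega>. \<Sum>i\<in>I. indicat_real {\<omega> \<in> space M. P i \<omega>} \<omega>)"
    using int by simp
  also have "\<dots> \<le> expectation (\<lambda>_. real n)"
  proof (rule integral_mono_AE)
    show "AE \<omega> in M. (\<Sum>i\<in>I. indicat_real {\<omega> \<in> space M. P i \<omega>} \<omega>) \<le> real n"
      using assms(3) AE_space
    proof eventually_elim
      case (elim \<omega>)
      then show ?case
        using sum_indicator_eq_card[OF \<open>finite I\<close>, of \<omega> P] by simp
    qed
  qed (use int in auto)
  finally show ?thesis by (simp add: prob_space)
qed

lemma card_ge_events:
  assumes "finite I" "\<And>i. i \<in> I \<Longrightarrow> Measurable.pred M (P i)"
  shows "{\<omega> \<in> space M. n \<le> card {i \<in> I. P i \<omega>}} \<in> events"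
proof -
  have "{\<omega> \<in> space M. real n \<le> (\<Sum>i\<in>I. indicat_real {\<omega> \<in> space M. P i \<omega>} \<omega>)} \<in> events"
    using assms by measurable
  also have "{\<omega> \<in> space M. real n \<le> (\<Sum>i\<in>I. indicat_real {\<omega> \<in> space M. P i \<omega>} \<omega>)} =
      {\<omega> \<in> space M. n \<le> card {i \<in> I. P i \<omega>}}"
    using sum_indicator_eq_card[OF \<open>finite I\<close>] by auto
  finally show ?thesis .
qed

text \<open>Markov's inequality for the number of indices whose event occurs.\<close>

lemma prob_card_ge_le:
  assumes "finite I" "\<And>i. i \<in> I \<Longrightarrow> Measurable.pred M (P i)"
  shows "real n * prob {\<omega> \<in> space M. n \<le> card {i \<in> I. P i \<omega>}} \<le> (\<Sum>i\<in>I. prob {\<omega> \<in> space M. P i \<omega>})"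
proof -
  have int: "integrable M (\<lambda>\<omega>. indicat_real {\<omega> \<in> space M. P i \<omega>} \<omega>)" if "i \<in> I" for i
    using assms(2)[OF that] by (auto simp: emeasure_eq_measure)
  note card = sum_indicator_eq_card[OF \<open>finite I\<close>]
  have meas: "{\<omega> \<in> space M. n \<le> card {i \<in> I. P i \<omega>}} \<in> events"
    using assms by (rule card_ge_events)
  have "real n * prob {\<omega> \<in> space M. n \<le> card {i \<in> I. P i \<omega>}} =
      expectation (\<lambda>\<omega>. real n * indicat_real {\<omega> \<in> space M. n \<le> card {i \<in> I. P i \<omega>}} \<omega>)"
    using meas by simp
  also have "\<dots> \<le> expectation (\<lambda>\<omega>. \<Sum>i\<in>I. indicat_real {\<omega> \<in> space M. P i \<omega>} \<omega>)"
  proof (rule integral_mono)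
    show "real n * indicat_real {\<omega> \<in> space M. n \<le> card {i \<in> I. P i \<omega>}} \<omega> \<le>
        (\<Sum>i\<in>I. indicat_real {\<omega> \<in> space M. P i \<omega>} \<omega>)" if "\<omega> \<in> space M" for \<omega>
      using card[OF that, of P] by (auto simp: indicator_def)
  qed (use meas int in \<open>auto simp: emeasure_eq_measure\<close>)
  also have "\<dots> = (\<Sum>i\<in>I. expectation (indicat_real {\<omega> \<in> space M. P i \<omega>}))"
    using int by simp
  also have "\<dots> = (\<Sum>i\<in>I. prob {\<omega> \<in> space M. P i \<omega>})"
    using assms(2) by (intro sum.cong) auto
  finally show ?thesis .
qed

end

locale stationary_field = prob_space M for M :: "'w measure" +
  fixes T :: "int \<times> int \<Rightarrow> 'w \<Rightarrow> 'w" and s :: "int \<times> int \<Rightarrow> 'w \<Rightarrow> bool"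
  assumes T_meas: "T z \<in> measurable M M"
    and T_pres: "distr M M (T z) = M"
    and s_meas [measurable]: "Measurable.pred M (s x)"
    and s_shift: "AE \<omega> in M. \<forall>x. s (x + z) \<omega> = s x (T z \<omega>)"
begin

abbreviation field :: "'w \<Rightarrow> int \<times> int \<Rightarrow> bool" where
  "field \<omega> \<equiv> \<lambda>x. s x \<omega>"

lemma up_pow_meas [measurable]: "Measurable.pred M (\<lambda>\<omega>. (up (field \<omega>) ^^ n) x = y)"
proof (induction n arbitrary: y)
  case (Suc n)
  have "(up (field \<omega>) ^^ Suc n) x = y \<longleftrightarrow>
      (up (field \<omega>) ^^ n) x = y - e1 \<and> s (y - e1) \<omega> \<or> (up (field \<omega>) ^^ n) x = y - e2 \<and> \<not> s (y - e2) \<omega>" for \<omega>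
    by (auto simp: up_def stp_def)
  then show ?case using Suc by simp
qed simp

lemma backward_infinite_meas [measurable]: "Measurable.pred M (\<lambda>\<omega>. backward_infinite (field \<omega>) v)"
  unfolding backward_infinite_def by measurable

lemma AE_up_pow_shift: "AE \<omega> in M. \<forall>x n. (up (field \<omega>) ^^ n) (x + z) = (up (field (T z \<omega>)) ^^ n) x + z"
  using s_shift[of z]
proof eventually_elim
  case (elim \<omega>)
  then have "(\<lambda>x. s (x + z) \<omega>) = field (T z \<omega>)" by blast
  then show ?case by (simp only: up_pow_shift) simp
qed

lemma AE_backward_infinite_shift:
  "AE \<omega> in M. \<forall>v. backward_infinite (field \<omega>) (v + z) = backward_infinite (field (T z \<omega>)) v"
  using AE_up_pow_shift[of z]
proof eventually_elim
  case (elim \<omega>)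
  show ?case
  proof
    fix v
    have "(\<exists>u. (up (field \<omega>) ^^ n) u = v + z) \<longleftrightarrow> (\<exists>u. (up (field (T z \<omega>)) ^^ n) u = v)" for n
      using elim by (metis add_right_cancel diff_add_cancel)
    then show "backward_infinite (field \<omega>) (v + z) = backward_infinite (field (T z \<omega>)) v"
      by (simp add: backward_infinite_def)
  qed
qed

lemma prob_shift:
  assumes "Measurable.pred M P" "Measurable.pred M Q" "AE \<omega> in M. Q \<omega> = P (T z \<omega>)"
  shows "prob {\<omega> \<in> space M. Q \<omega>} = prob {\<omega> \<in> space M. P \<omega>}"
  using prob_shift_eq[OF T_meas T_pres assms] .

text \<open>Every point has exactly one successor, so by stationarity a backward infinite point has on
  average one backward infinite predecessor, hence exactly one. If all paths coalesce, then a level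
  contains at most one backward infinite point, which is impossible for a stationary field.\<close>

lemma AE_no_backward_infinite_if_coalescing:
  assumes coal: "AE \<omega> in M. coalescing (field \<omega>)"
  shows "AE \<omega> in M. \<forall>v. \<not> backward_infinite (field \<omega>) v"
proof -
  define p where "p = prob {\<omega> \<in> space M. backward_infinite (field \<omega>) 0}"
  have p: "prob {\<omega> \<in> space M. backward_infinite (field \<omega>) v} = p" for v
    unfolding p_def
  proof (rule prob_shift[where z = v])
    show "AE \<omega> in M. backward_infinite (field \<omega>) v = backward_infinite (field (T v \<omega>)) 0"
      using AE_backward_infinite_shift[of v] by eventually_elim (metis add_0)
  qed auto
  have A: "prob {\<omega> \<in> space M. s v \<omega> \<and> backward_infinite (field \<omega>) v} =
      prob {\<omega> \<in> space M. s 0 \<omega> \<and> backward_infinite (field \<omega>) 0}" for v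
  proof (rule prob_shift[where z = v])
    show "AE \<omega> in M. (s v \<omega> \<and> backward_infinite (field \<omega>) v) =
        (s 0 (T v \<omega>) \<and> backward_infinite (field (T v \<omega>)) 0)"
      using AE_backward_infinite_shift[of v] s_shift[of v]
      by eventually_elim (metis add_0)
  qed auto
  have C: "prob {\<omega> \<in> space M. \<not> s v \<omega> \<and> backward_infinite (field \<omega>) v} =
      prob {\<omega> \<in> space M. \<not> s 0 \<omega> \<and> backward_infinite (field \<omega>) 0}" for v
  proof (rule prob_shift[where z = v])
    show "AE \<omega> in M. (\<not> s v \<omega> \<and> backward_infinite (field \<omega>) v) =
        (\<not> s 0 (T v \<omega>) \<and> backward_infinite (field (T v \<omega>)) 0)"
      using AE_backward_infinite_shift[of v] s_shift[of v]
      by eventually_elim (metis add_0)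
  qed auto
  have "AE \<omega> in M. \<not> ((s (v - e1) \<omega> \<and> backward_infinite (field \<omega>) (v - e1)) \<and>
      (\<not> s (v - e2) \<omega> \<and> backward_infinite (field \<omega>) (v - e2)))" (is "AE \<omega> in M. \<not> (?A \<omega> \<and> ?C \<omega>)") for v
  proof -
    \<comment> \<open>Shifted to the origin, the two events split the event of probability
      \<open>p\<close> according to the outgoing edge, so their probabilities add up to
      \<open>p\<close>. Their union has probability \<open>p\<close> as well, hence the overlap is
      null.\<close>
    have "{\<omega> \<in> space M. backward_infinite (field \<omega>) v} = {\<omega> \<in> space M. ?A \<omega>} \<union> {\<omega> \<in> space M. ?C \<omega>}"
      by (subst backward_infinite_iff) auto
    then have "p = prob ({\<omega> \<in> space M. ?A \<omega>} \<union> {\<omega> \<in> space M. ?C \<omega>})" using p[of v] by simp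
    also have "\<dots> = prob {\<omega> \<in> space M. ?A \<omega>} + prob {\<omega> \<in> space M. ?C \<omega>} -
        prob ({\<omega> \<in> space M. ?A \<omega>} \<inter> {\<omega> \<in> space M. ?C \<omega>})"
      by (intro measure_Un3) (auto simp: fmeasurable_eq_sets)
    also have "prob {\<omega> \<in> space M. ?A \<omega>} + prob {\<omega> \<in> space M. ?C \<omega>} =
        prob ({\<omega> \<in> space M. s 0 \<omega> \<and> backward_infinite (field \<omega>) 0} \<union>
              {\<omega> \<in> space M. \<not> s 0 \<omega> \<and> backward_infinite (field \<omega>) 0})"
      unfolding A[of "v - e1"] C[of "v - e2"] by (intro finite_measure_Union[symmetric]) auto
    also have "{\<omega> \<in> space M. s 0 \<omega> \<and> backward_infinite (field \<omega>) 0} \<union>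
              {\<omega> \<in> space M. \<not> s 0 \<omega> \<and> backward_infinite (field \<omega>) 0} =
        {\<omega> \<in> space M. backward_infinite (field \<omega>) 0}" by auto
    finally have "prob ({\<omega> \<in> space M. ?A \<omega>} \<inter> {\<omega> \<in> space M. ?C \<omega>}) = 0" by (simp add: p_def)
    moreover have "{\<omega> \<in> space M. ?A \<omega>} \<inter> {\<omega> \<in> space M. ?C \<omega>} = {\<omega> \<in> space M. ?A \<omega> \<and> ?C \<omega>}" by auto
    ultimately have "prob {\<omega> \<in> space M. ?A \<omega> \<and> ?C \<omega>} = 0" by simp
    then have "AE \<omega> in M. \<omega> \<notin> {\<omega> \<in> space M. ?A \<omega> \<and> ?C \<omega>}"
      by (subst (asm) prob_eq_0) auto
    then show ?thesis using AE_space by eventually_elim blast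
  qed
  then have "AE \<omega> in M. \<forall>v. \<not> ((s (v - e1) \<omega> \<and> backward_infinite (field \<omega>) (v - e1)) \<and>
      (\<not> s (v - e2) \<omega> \<and> backward_infinite (field \<omega>) (v - e2)))"
    by (simp add: AE_all_countable)
  then have one: "AE \<omega> in M. \<forall>x y. level x = level y \<and> backward_infinite (field \<omega>) x \<and>
      backward_infinite (field \<omega>) y \<longrightarrow> x = y"
    using coal by eventually_elim (metis coalescing_backward_infinite_meet)
  have np: "real n * p \<le> 1" for n
  proof -
    have "(\<Sum>i<n. prob {\<omega> \<in> space M. backward_infinite (field \<omega>) (int i, - int i)}) \<le> real 1"
    proof (rule sum_prob_le_if_AE_card_le)
      show "AE \<omega> in M. card {i \<in> {..<n}. backward_infinite (field \<omega>) (int i, - int i)} \<le> 1"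
        using one
      proof eventually_elim
        case (elim \<omega>)
        have "i = j" if "backward_infinite (field \<omega>) (int i, - int i)"
          "backward_infinite (field \<omega>) (int j, - int j)" for i j
          using elim[rule_format, of "(int i, - int i)" "(int j, - int j)"] that by (simp add: level_def)
        then show ?case by (intro card_le_Suc0_iff_eq[THEN iffD2, unfolded One_nat_def[symmetric]]) auto
      qed
    qed auto
    then show ?thesis by (simp add: p)
  qed
  have "p = 0"
  proof (rule ccontr)
    assume "p \<noteq> 0"
    then have "p > 0" by (simp add: p_def zero_less_measure_iff)
    then obtain n where "1 < real n * p" using reals_Archimedean3 by blast
    with np[of n] show False by linarith
  qed
  have "AE \<omega> in M. \<not> backward_infinite (field \<omega>) v" for v
  proof -
    have "AE \<omega> in M. \<omega> \<notin> {\<omega> \<in> space M. backward_infinite (field \<omega>) v}"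
      using p[of v] \<open>p = 0\<close> by (subst prob_eq_0[symmetric]) auto
    then show ?thesis using AE_space by eventually_elim blast
  qed
  then show ?thesis by (simp add: AE_all_countable)
qed

end

text \<open>The point reflection turns the dual graph into a graph of the same kind.\<close>

lemma (in stationary_field) AE_coalescing_if_no_backward_infinite:
  assumes "AE \<omega> in M. \<forall>v. \<not> backward_infinite (field \<omega>) v"
  shows "AE \<omega> in M. coalescing (field \<omega>)"
proof -
  interpret R: stationary_field M "\<lambda>z. T (- z)" "\<lambda>z. s (- z)"
  proof
    show "AE \<omega> in M. \<forall>x. s (- (x + z)) \<omega> = s (- x) (T (- z) \<omega>)" for z
      using s_shift[of "- z"] by eventually_elim (metis minus_add_distrib)
  qed (auto simp: T_meas T_pres)
  have "AE \<omega> in M. coalescing (R.field \<omega>)"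
    using assms
  proof eventually_elim
    case (elim \<omega>)
    show ?case
      unfolding coalescing_def
    proof (intro allI impI)
      fix v v' :: "int \<times> int"
      assume "level v = level v'"
      then have "level (- v) = level (- v')" by simp
      from dual_paths_coalesce[OF _ this, of "field \<omega>"] elim
      obtain n where "(dn (field \<omega>) ^^ n) (- v) = (dn (field \<omega>) ^^ n) (- v')" by blast
      then show "\<exists>n. (up (R.field \<omega>) ^^ n) v = (up (R.field \<omega>) ^^ n) v'"
        by (auto simp: dn_pow_reflect)
    qed
  qed
  then have "AE \<omega> in M. \<forall>v. \<not> backward_infinite (R.field \<omega>) v"
    by (rule R.AE_no_backward_infinite_if_coalescing)
  then show ?thesis
    by eventually_elim (intro coalescing_if_no_dual_backward_infinite, auto)
qed

section \<open>Signed measures on directions\<close>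

text \<open>The first coordinate as parameter turns the order of directions into the order of the
  reals.\<close>

definition dir :: "real \<Rightarrow> real \<times> real" where
  "dir t = (t, 1 - t)"

lemma dir_eq_iff [simp]: "dir s = dir t \<longleftrightarrow> s = t"
  by (simp add: dir_def)

lemma inj_dir: "inj dir"
  by (simp add: inj_def)

lemma dirs_eq: "dirs = dir ` {0..1}"
  by (auto simp: dirs_def dir_def e1_def e2_def)

lemma ri_dirs_eq: "ri_dirs = dir ` {0<..<1}"
  unfolding ri_dirs_def dirs_eq by (force simp: dir_def e1_def e2_def)

lemma dir_less_iff [simp]: "dir s \<prec>\<^sub>1 dir t \<longleftrightarrow> s < t"
  and dir_le_iff [simp]: "dir s \<preceq>\<^sub>1 dir t \<longleftrightarrow> s \<le> t"
  by (auto simp: dir_less_def dir_le_def dir_def e1_def e2_def ehat_def inner_prod_def)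

lemma dir_in_ri_dirs [simp]: "dir t \<in> ri_dirs \<longleftrightarrow> 0 < t \<and> t < 1"
  by (auto simp: ri_dirs_eq)

lemma dir_intervals:
  assumes "0 \<le> s" "t \<le> 1"
  shows "dir_cc (dir s) (dir t) = dir ` {s..t}"
    and "dir_oc (dir s) (dir t) = dir ` {s<..t}"
    and "dir_co (dir s) (dir t) = dir ` {s..<t}"
    and "dir_oo (dir s) (dir t) = dir ` {s<..<t}"
  unfolding dir_cc_def dir_oc_def dir_co_def dir_oo_def dirs_eq using assms by auto

lemma continuous_dir: "continuous_on A dir"
  unfolding dir_def by (intro continuous_intros)

lemma dir_image_borel:
  assumes "A \<in> sets borel"
  shows "dir ` A \<in> sets borel"
proof -
  have "dir ` A = {p. fst p + snd p = 1} \<inter> fst -` A"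
    by (force simp: dir_def image_iff)
  moreover have "{p :: real \<times> real. fst p + snd p = 1} \<in> sets borel"
    by (intro borel_closed closed_Collect_eq continuous_intros)
  moreover have "fst -` A \<in> sets (borel :: (real \<times> real) measure)"
    using measurable_sets[OF borel_measurable_continuous_onI[OF continuous_on_fst[OF continuous_on_id]], of A] assms
    by simp
  ultimately show ?thesis by simp
qed

lemma dir_vimage_borel: "A \<in> sets borel \<Longrightarrow> dir -` A \<in> sets borel"
  using measurable_sets[OF borel_measurable_continuous_onI[OF continuous_dir], of A] by simp

lemma compact_dir_image: "compact (dir ` {s..t})"
  by (intro compact_continuous_image continuous_dir) simp

lemma sets_restrict_dir:
  "A \<in> sets (restrict_space borel (dir ` {s..t})) \<longleftrightarrow> A \<subseteq> dir ` {s..t} \<and> A \<in> sets borel"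
  using compact_imp_closed[OF compact_dir_image[of s t]]
  by (subst sets_restrict_space_iff) auto

lemma signed_measure_empty: "signed_measure_on K \<nu> \<Longrightarrow> \<nu> {} = 0"
  by (simp add: signed_measure_on_def)

lemma signed_measure_Un:
  assumes "signed_measure_on K \<nu>" "A \<in> sets (restrict_space borel K)" "C \<in> sets (restrict_space borel K)"
    "A \<inter> C = {}"
  shows "\<nu> (A \<union> C) = \<nu> A + \<nu> C"
proof -
  have "range (binaryset A C) \<subseteq> sets (restrict_space borel K)" "disjoint_family (binaryset A C)"
    using assms by (auto simp: binaryset_def disjoint_family_on_def)
  then have "(\<lambda>n. \<nu> (binaryset A C n)) sums \<nu> (\<Union>n. binaryset A C n)"
    using assms(1) by (simp add: signed_measure_on_def)
  moreover have "(\<lambda>n. \<nu> (binaryset A C n)) sums (\<nu> A + \<nu> C)"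
    using assms(1) by (intro binaryset_sums) (simp add: signed_measure_empty)
  ultimately show ?thesis by (simp add: sums_unique2 UN_binaryset_eq)
qed

text \<open>\<open>f\<close> and \<open>g\<close> play the roles of the left- and the right-continuous version of a process.\<close>

definition stieltjes_on ::
  "real \<Rightarrow> real \<Rightarrow> (real \<Rightarrow> real) \<Rightarrow> (real \<Rightarrow> real) \<Rightarrow> ((real \<times> real) set \<Rightarrow> real) \<Rightarrow> bool" where
  "stieltjes_on s0 r0 f g \<nu> \<longleftrightarrow> signed_measure_on (dir ` {s0..r0}) \<nu> \<and>
     (\<forall>s r. s0 \<le> s \<and> s < r \<and> r \<le> r0 \<longrightarrow>
        \<nu> (dir ` {s<..r}) = g r - g s \<and> \<nu> (dir ` {s..<r}) = f r - f s)"

lemma stieltjes_on_uminus: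
  assumes "stieltjes_on s0 r0 f g \<nu>"
  shows "stieltjes_on s0 r0 (\<lambda>t. - f t) (\<lambda>t. - g t) (\<lambda>A. - \<nu> A)"
  using assms unfolding stieltjes_on_def signed_measure_on_def by (auto intro: sums_minus)

lemma stieltjes_on_cong:
  assumes "stieltjes_on s0 r0 f g \<nu>" "\<And>t. s0 \<le> t \<Longrightarrow> t \<le> r0 \<Longrightarrow> f' t = f t \<and> g' t = g t"
  shows "stieltjes_on s0 r0 f' g' \<nu>"
  using assms unfolding stieltjes_on_def by auto

lemma stieltjes_on_add:
  assumes "stieltjes_on s0 r0 f g \<nu>" "stieltjes_on s0 r0 f' g' \<nu>'"
  shows "stieltjes_on s0 r0 (\<lambda>t. f t + f' t) (\<lambda>t. g t + g' t) (\<lambda>A. \<nu> A + \<nu>' A)"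
  using assms unfolding stieltjes_on_def signed_measure_on_def by (auto intro!: sums_add)

text \<open>This is the Lebesgue-Stieltjes measure of the right-continuous version \<open>g\<close>,
  made constant outside the interval; the left limits \<open>f\<close> give the masses of the
  left-closed intervals.\<close>

lemma ex_stieltjes_on_if_mono:
  assumes "0 < s0" "s0 < r0" "r0 < 1"
    and mono: "\<And>s t. 0 < s \<Longrightarrow> s < t \<Longrightarrow> t < 1 \<Longrightarrow> f s \<le> g s \<and> g s \<le> f t"
    and right: "\<And>t. 0 < t \<Longrightarrow> t < 1 \<Longrightarrow> (g \<longlongrightarrow> g t) (at_right t)"
    and left: "\<And>t. 0 < t \<Longrightarrow> t < 1 \<Longrightarrow> (g \<longlongrightarrow> f t) (at_left t)"
  shows "\<exists>\<nu>. stieltjes_on s0 r0 f g \<nu>"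
proof -
  \<comment> \<open>The value \<open>f s0\<close>, not \<open>g s0\<close>, to the left of
    \<open>s0\<close> creates the atom \<open>g s0 - f s0\<close> at the end point, which the
    left-closed intervals starting at \<open>s0\<close> require.\<close>
  define F where "F t = (if t < s0 then f s0 else if t < r0 then g t else g r0)" for t
  have fg: "f t \<le> g t" if "0 < t" "t < 1" for t
    using mono[of t "(t + 1) / 2"] that by simp
  have gg: "g s \<le> g t" if "0 < s" "s \<le> t" "t < 1" for s t
    using mono[of s t] fg[of t] that by (cases "s = t") auto
  have F_mono: "F s \<le> F t" if "s \<le> t" for s t
    using that assms(1-3) fg[of s0] gg[of s0 t] gg[of s0 r0] gg[of s t] gg[of s r0]
    by (auto simp: F_def)
  have F_right: "(F \<longlongrightarrow> F t) (at_right t)" for t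
  proof -
    consider "t < s0" | "s0 \<le> t" "t < r0" | "r0 \<le> t" by linarith
    then show ?thesis
    proof cases
      case 1
      then have "eventually (\<lambda>u. F u = f s0) (at_right t)"
        using eventually_at_right[of t s0] by (auto simp: F_def)
      then show ?thesis using 1 by (simp add: F_def tendsto_eventually)
    next
      case 2
      have "eventually (\<lambda>u. g u = F u) (at_right t)"
        using eventually_at_right[of t r0] 2 by (auto simp: F_def)
      moreover have "(g \<longlongrightarrow> F t) (at_right t)"
        using right[of t] 2 assms by (simp add: F_def)
      ultimately show ?thesis by (rule Lim_transform_eventually[rotated])
    next
      case 3
      then have "eventually (\<lambda>u. F u = g r0) (at_right t)"
        using eventually_at_right[of t "t + 1"] assms by (auto simp: F_def intro!: exI[of _ "t + 1"])
      then show ?thesis using 3 assms by (simp add: F_def tendsto_eventually)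
    qed
  qed
  have F_left: "(F \<longlongrightarrow> f t) (at_left t)" if "s0 \<le> t" "t \<le> r0" for t
  proof (cases "t = s0")
    case True
    have "eventually (\<lambda>u. F u = f s0) (at_left t)"
      using eventually_at_left[of "t - 1" t] True by (auto simp: F_def intro!: exI[of _ "t - 1"])
    then show ?thesis using True by (simp add: tendsto_eventually)
  next
    case False
    have "eventually (\<lambda>u. g u = F u) (at_left t)"
      using eventually_at_left[of s0 t] False that by (auto simp: F_def intro!: exI[of _ s0])
    moreover have "(g \<longlongrightarrow> f t) (at_left t)"
      using left[of t] that assms by simp
    ultimately show ?thesis by (rule Lim_transform_eventually[rotated])
  qed
  define m where "m = interval_measure F"
  have sets_m [simp]: "sets m = sets borel" and space_m [simp]: "space m = UNIV"
    by (simp_all add: m_def)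
  have m_Ioc: "emeasure m {a<..c} = ennreal (F c - F a)" if "a \<le> c" for a c
    unfolding m_def using that F_mono F_right
    by (intro emeasure_interval_measure_Ioc) (auto simp: continuous_within)
  have m_finite: "emeasure m A \<noteq> \<infinity>" if "A \<subseteq> {a<..c}" "a \<le> c" for A a c
    using emeasure_mono[OF that(1), of m] m_Ioc[OF that(2)] by (auto simp: top_unique)
  have m_Ioc': "measure m {a<..c} = F c - F a" if "a \<le> c" for a c
    using m_Ioc[OF that] F_mono[OF that] by (simp add: measure_def)
  have m_Ioo: "measure m {a<..<t} = f t - F a" if t: "s0 \<le> t" "t \<le> r0" and "a < t" for a t
  proof -
    define u where "u n = t - (t - a) / real (Suc n)" for n
    have u: "a \<le> u n" "u n < t" for n
    proof -
      have "(t - a) / real (Suc n) \<le> (t - a) / 1" using \<open>a < t\<close> by (intro divide_left_mono) auto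
      then show "a \<le> u n" by (simp add: u_def)
    qed (use \<open>a < t\<close> in \<open>simp add: u_def\<close>)
    have "incseq u" unfolding incseq_def u_def using \<open>a < t\<close>
      by (auto intro!: divide_left_mono)
    have u_lim: "u \<longlonglongrightarrow> t"
    proof -
      have "(\<lambda>n. t - (t - a) * (1 / real (Suc n))) \<longlonglongrightarrow> t - (t - a) * 0"
        by (intro tendsto_intros LIMSEQ_Suc lim_1_over_n)
      then show ?thesis by (simp add: u_def[abs_def])
    qed
    have "(\<lambda>n. measure m {a<..u n}) \<longlonglongrightarrow> measure m (\<Union>n. {a<..u n})"
    proof (rule Lim_measure_incseq)
      show "incseq (\<lambda>n. {a<..u n})"
        using \<open>incseq u\<close> by (force simp: incseq_def)
      have "(\<Union>n. {a<..u n}) \<subseteq> {a<..t}" by (auto intro: order_trans[OF _ less_imp_le[OF u(2)]])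
      then show "emeasure m (\<Union>n. {a<..u n}) \<noteq> \<infinity>" using m_finite \<open>a < t\<close> by (meson less_imp_le)
    qed auto
    also have "(\<Union>n. {a<..u n}) = {a<..<t}"
    proof (intro equalityI subsetI)
      fix y assume y: "y \<in> {a<..<t}"
      then have "eventually (\<lambda>n. y < u n) sequentially" using u_lim by (intro order_tendstoD) auto
      then obtain n where "y < u n" by (auto simp: eventually_sequentially)
      with y show "y \<in> (\<Union>n. {a<..u n})" by (auto intro: less_imp_le)
    next
      fix y assume "y \<in> (\<Union>n. {a<..u n})"
      then obtain n where "a < y" "y \<le> u n" by auto
      with u(2)[of n] show "y \<in> {a<..<t}" by auto
    qed
    finally have "(\<lambda>n. F (u n) - F a) \<longlonglongrightarrow> measure m {a<..<t}"
      using u by (simp add: m_Ioc')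
    moreover have "(\<lambda>n. F (u n) - F a) \<longlonglongrightarrow> f t - F a"
    proof (intro tendsto_intros filterlim_compose[OF F_left[OF t]])
      show "filterlim u (at_left t) sequentially"
        using u_lim u(2) by (auto simp: filterlim_at less_imp_neq intro!: always_eventually)
    qed
    ultimately show ?thesis by (rule LIMSEQ_unique)
  qed
  define \<nu> where "\<nu> A = measure m (dir -` A)" for A
  have vim: "dir -` dir ` A = A" for A by (simp add: inj_dir inj_vimage_image_eq)
  have "stieltjes_on s0 r0 f g \<nu>"
    unfolding stieltjes_on_def
  proof (intro conjI allI impI; (elim conjE)?)
    show "signed_measure_on (dir ` {s0..r0}) \<nu>"
      unfolding signed_measure_on_def
    proof (intro conjI allI impI)
      fix A :: "nat \<Rightarrow> (real \<times> real) set"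
      assume A: "range A \<subseteq> sets (restrict_space borel (dir ` {s0..r0}))" "disjoint_family A"
      have "A i \<in> sets borel" "A i \<subseteq> dir ` {s0..r0}" for i
        using A(1) sets_restrict_dir[of "A i" s0 r0] by auto
      have "(\<lambda>n. measure m (dir -` A n)) sums measure m (\<Union>n. dir -` A n)"
      proof (rule measure_UNION)
        show "range (\<lambda>n. dir -` A n) \<subseteq> sets m"
          using \<open>\<And>i. A i \<in> sets borel\<close> by (auto intro: dir_vimage_borel)
        show "disjoint_family (\<lambda>n. dir -` A n)"
          using A(2) by (simp add: disjoint_family_on_def flip: vimage_Int)
        have "(\<Union>n. dir -` A n) \<subseteq> {s0 - 1<..r0}"
          using \<open>\<And>i. A i \<subseteq> dir ` {s0..r0}\<close> by fastforce
        then show "emeasure m (\<Union>n. dir -` A n) \<noteq> \<infinity>"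
          using assms by (intro m_finite) auto
      qed
      then show "(\<lambda>n. \<nu> (A n)) sums \<nu> (\<Union>n. A n)" by (simp add: \<nu>_def vimage_UN)
    qed (simp add: \<nu>_def)
  next
    fix s r assume sr: "s0 \<le> s" "s < r" "r \<le> r0"
    then show "\<nu> (dir ` {s<..r}) = g r - g s"
      by (simp add: \<nu>_def vim m_Ioc') (use sr in \<open>auto simp: F_def\<close>)
    have "measure m ({s0 - 1<..<r} - {s0 - 1<..<s}) = measure m {s0 - 1<..<r} - measure m {s0 - 1<..<s}"
    proof (rule measure_Diff)
      show "emeasure m {s0 - 1<..<r} \<noteq> \<infinity>"
        by (rule m_finite[of _ "s0 - 1" r]) (use sr in auto)
    qed (use sr in auto)
    moreover have "{s0 - 1<..<r} - {s0 - 1<..<s} = {s..<r}" using sr by auto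
    ultimately have "measure m {s..<r} = measure m {s0 - 1<..<r} - measure m {s0 - 1<..<s}" by simp
    then show "\<nu> (dir ` {s..<r}) = f r - f s"
      using sr by (simp add: \<nu>_def vim m_Ioo)
  qed
  then show ?thesis by blast
qed

text \<open>Total variation involves all Borel subsets, and a signed measure is not monotone.
  Vanishing is therefore extended from traces of half-lines to Borel sets by a Dynkin class
  argument.\<close>

lemma stieltjes_vanish:
  assumes st: "stieltjes_on s0 r0 f g \<nu>"
    and const: "\<And>u. s \<le> u \<Longrightarrow> u \<le> r \<Longrightarrow> f u = c \<and> g u = c"
    and t: "s < t" "t < r" "s0 \<le> t" "t \<le> r0" "s0 < r0"
    and A: "A \<in> sets borel"
  shows "\<nu> (dir ` (A \<inter> ({s<..r} \<inter> {s0..r0}))) = 0"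
proof -
  define U where "U = {s<..r} \<inter> {s0..r0}"
  have sm: "signed_measure_on (dir ` {s0..r0}) \<nu>" using st by (simp add: stieltjes_on_def)
  have Un: "\<nu> (dir ` (X \<union> Y)) = \<nu> (dir ` X) + \<nu> (dir ` Y)"
    if "X \<in> sets borel" "Y \<in> sets borel" "X \<subseteq> {s0..r0}" "Y \<subseteq> {s0..r0}" "X \<inter> Y = {}" for X Y
  proof -
    have "dir ` X \<inter> dir ` Y = {}" using that inj_dir by (auto simp: inj_def)
    then show ?thesis
      unfolding image_Un using that
      by (intro signed_measure_Un[OF sm]) (auto simp: sets_restrict_dir dir_image_borel)
  qed
  have Ioc: "\<nu> (dir ` {x<..y}) = 0" if "s0 \<le> x" "y \<le> r0" "s \<le> x" "y \<le> r" for x y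
  proof (cases "x < y")
    case True
    then show ?thesis using st that const[of x] const[of y] by (simp add: stieltjes_on_def)
  qed (simp add: signed_measure_empty[OF sm])
  have Ico: "\<nu> (dir ` {x..<y}) = 0" if "s0 \<le> x" "y \<le> r0" "s \<le> x" "y \<le> r" for x y
  proof (cases "x < y")
    case True
    then show ?thesis using st that const[of x] const[of y] by (simp add: stieltjes_on_def)
  qed (simp add: signed_measure_empty[OF sm])
  \<comment> \<open>When the constancy interval sticks out to the left of \<open>s0\<close>, it
    contains the end point \<open>s0\<close>, which no left-open interval inside the domain covers.
    The mass of this point is that of \<open>{s0..<e}\<close> minus that of
    \<open>{s0<..<e}\<close>, and the latter is a countable union of left-closed pieces of mass
    zero.\<close>
  have atom: "\<nu> (dir ` {s0}) = 0" if "s < s0"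
  proof -
    define e where "e = min r r0"
    have e: "s0 < e" "e \<le> r" "e \<le> r0" using t by (auto simp: e_def)
    define u where "u n = s0 + (e - s0) / real (Suc n)" for n
    have u: "s0 < u n" "u n \<le> e" "u (Suc n) \<le> u n" for n
    proof -
      have "(e - s0) / real (Suc n) \<le> (e - s0) / 1" using e by (intro divide_left_mono) auto
      then show "u n \<le> e" by (simp add: u_def)
      show "u (Suc n) \<le> u n" using e by (simp add: u_def) (auto intro!: divide_left_mono)
    qed (use e in \<open>simp add: u_def\<close>)
    have u_lim: "u \<longlonglongrightarrow> s0"
    proof -
      have "(\<lambda>n. s0 + (e - s0) * (1 / real (Suc n))) \<longlonglongrightarrow> s0 + (e - s0) * 0"
        by (intro tendsto_intros LIMSEQ_Suc lim_1_over_n)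
      then show ?thesis by (simp add: u_def[abs_def])
    qed
    have "decseq u" using u(3) by (rule decseq_SucI)
    have disj: "disjoint_family (\<lambda>n. {u (Suc n)..<u n})"
      unfolding disjoint_family_on_def
    proof (intro ballI impI)
      fix m n :: nat assume "m \<noteq> n"
      then consider "Suc m \<le> n" | "Suc n \<le> m" by linarith
      then show "{u (Suc m)..<u m} \<inter> {u (Suc n)..<u n} = {}"
        using decseqD[OF \<open>decseq u\<close>, of "Suc m" n] decseqD[OF \<open>decseq u\<close>, of "Suc n" m] by cases auto
    qed
    have union: "(\<Union>n. {u (Suc n)..<u n}) = {s0<..<e}"
    proof (intro equalityI subsetI)
      fix y assume "y \<in> (\<Union>n. {u (Suc n)..<u n})"
      then obtain n where "u (Suc n) \<le> y" "y < u n" by auto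
      then show "y \<in> {s0<..<e}" using u(1)[of "Suc n"] u(2)[of n] by auto
    next
      fix y assume y: "y \<in> {s0<..<e}"
      then have "eventually (\<lambda>n. u n < y) sequentially" using u_lim by (intro order_tendstoD) auto
      then obtain n where n: "u n < y" by (auto simp: eventually_sequentially)
      define k where "k = (LEAST n. u n \<le> y)"
      have k: "u k \<le> y" unfolding k_def by (rule LeastI[of _ n]) (use n in simp)
      have "u 0 = e" by (simp add: u_def)
      with k y obtain j where j: "k = Suc j" by (cases k) auto
      have "\<not> u j \<le> y" using not_less_Least[of j "\<lambda>n. u n \<le> y"] j by (simp add: k_def)
      with k j show "y \<in> (\<Union>n. {u (Suc n)..<u n})" by (auto intro!: exI[of _ j])
    qed
    have "(\<lambda>n. \<nu> (dir ` {u (Suc n)..<u n})) sums \<nu> (\<Union>n. dir ` {u (Suc n)..<u n})"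
    proof -
      have "range (\<lambda>n. dir ` {u (Suc n)..<u n}) \<subseteq> sets (restrict_space borel (dir ` {s0..r0}))"
      proof safe
        fix n
        have "{u (Suc n)..<u n} \<subseteq> {s0..r0}" using u(1)[of "Suc n"] u(2)[of n] e by auto
        then show "dir ` {u (Suc n)..<u n} \<in> sets (restrict_space borel (dir ` {s0..r0}))"
          by (auto simp: sets_restrict_dir dir_image_borel)
      qed
      moreover have "disjoint_family (\<lambda>n. dir ` {u (Suc n)..<u n})"
        using disj inj_dir by (fastforce simp: disjoint_family_on_def inj_def)
      ultimately show ?thesis using sm by (simp add: signed_measure_on_def)
    qed
    moreover have "\<nu> (dir ` {u (Suc n)..<u n}) = 0" for n
      using u(1)[of "Suc n"] u(2)[of n] e that by (intro Ico) auto
    ultimately have "\<nu> (dir ` {s0<..<e}) = 0"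
      by (simp add: image_UN[symmetric] union sums_iff)
    moreover have "{s0..<e} = {s0} \<union> {s0<..<e}" using e by auto
    then have "\<nu> (dir ` {s0..<e}) = \<nu> (dir ` {s0}) + \<nu> (dir ` {s0<..<e})"
      using e by (simp only:, intro Un) auto
    ultimately show ?thesis using Ico[of s0 e] e that by simp
  qed
  have Iic: "\<nu> (dir ` ({..y} \<inter> U)) = 0" for y
  proof -
    define z where "z = min y (min r r0)"
    show ?thesis
    proof (cases "s0 \<le> s")
      case True
      then have "{..y} \<inter> U = {s<..z}" by (auto simp: U_def z_def)
      then show ?thesis using Ioc[of s z] True by (simp add: z_def)
    next
      case False
      show ?thesis
      proof (cases "s0 \<le> z")
        case True
        then have "{..y} \<inter> U = {s0} \<union> {s0<..z}" using False t by (auto simp: U_def z_def)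
        then have "\<nu> (dir ` ({..y} \<inter> U)) = \<nu> (dir ` {s0}) + \<nu> (dir ` {s0<..z})"
          using t by (simp only:, intro Un) (auto simp: z_def)
        then show ?thesis using atom Ioc[of s0 z] False by (simp add: z_def)
      next
        case False
        then have "{..y} \<inter> U = {}" using \<open>\<not> s0 \<le> s\<close> t by (auto simp: U_def z_def)
        then show ?thesis by (simp add: signed_measure_empty[OF sm])
      qed
    qed
  qed
  have U_borel: "U \<in> sets borel" "U \<subseteq> {s0..r0}" by (auto simp: U_def)
  have U0: "\<nu> (dir ` U) = 0"
    using Iic[of r0] U_borel(2) by (simp add: Int_absorb1 subset_iff)
  have borel_sets: "A \<in> sets borel \<longleftrightarrow> A \<in> sigma_sets UNIV (range (atMost :: real \<Rightarrow> real set))" for A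
    by (simp add: borel_eq_atMost sets_measure_of_conv)
  have Int_st: "Int_stable (range (atMost :: real \<Rightarrow> real set))"
    by (auto simp: Int_stable_def)
  have "\<nu> (dir ` (A \<inter> U)) = 0"
    using Int_st top_greatest[of "range atMost", folded Pow_UNIV] A[unfolded borel_sets]
  proof (induction rule: sigma_sets_induct_disjoint)
    case (basic A)
    then show ?case using Iic by auto
  next
    case empty
    then show ?case by (simp add: signed_measure_empty[OF sm])
  next
    case (compl A)
    then have "A \<in> sets borel" by (simp add: borel_sets)
    then have "\<nu> (dir ` (A \<inter> U \<union> (UNIV - A) \<inter> U)) = \<nu> (dir ` (A \<inter> U)) + \<nu> (dir ` ((UNIV - A) \<inter> U))"
      using U_borel by (intro Un) auto
    moreover have "A \<inter> U \<union> (UNIV - A) \<inter> U = U" by auto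
    ultimately show ?case using compl U0 by simp
  next
    case (union A)
    then have "A i \<in> sets borel" for i by (auto simp: borel_sets image_subset_iff)
    then have "range (\<lambda>i. dir ` (A i \<inter> U)) \<subseteq> sets (restrict_space borel (dir ` {s0..r0}))"
    proof safe
      fix i
      have "A i \<inter> U \<subseteq> {s0..r0}" using U_borel(2) by blast
      then show "dir ` (A i \<inter> U) \<in> sets (restrict_space borel (dir ` {s0..r0}))"
        using U_borel(1) \<open>\<And>i. A i \<in> sets borel\<close>
        by (auto simp: sets_restrict_dir intro!: dir_image_borel image_mono)
    qed
    moreover have "disjoint_family (\<lambda>i. dir ` (A i \<inter> U))"
      using \<open>disjoint_family A\<close> inj_dir by (fastforce simp: disjoint_family_on_def inj_def)
    ultimately have "(\<lambda>i. \<nu> (dir ` (A i \<inter> U))) sums \<nu> (\<Union>i. dir ` (A i \<inter> U))"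
      using sm by (simp add: signed_measure_on_def)
    then show ?case using union by (simp add: image_UN[symmetric] sums_iff)
  qed
  then show ?thesis by (simp add: U_def)
qed

text \<open>The whole interval is itself one of the closed sets in the intersection, because a
  partition of the empty set contains at most the empty set.\<close>

lemma signed_support_subset:
  assumes st: "stieltjes_on s0 r0 f g \<nu>"
  shows "signed_support (dir ` {s0..r0}) \<nu> \<subseteq> dir ` {s0..r0}"
proof -
  have "total_variation \<nu> {} \<le> 0"
    unfolding total_variation_def
  proof (rule SUP_least)
    fix P :: "(real \<times> real) set set"
    assume "P \<in> {P. finite P \<and> disjoint P \<and> P \<subseteq> sets borel \<and> \<Union>P = {}}"
    then have "P \<subseteq> {{}}" by auto
    then show "(\<Sum>C\<in>P. ennreal \<bar>\<nu> C\<bar>) \<le> 0"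
      using st by (auto simp: stieltjes_on_def signed_measure_empty subset_singleton_iff)
  qed
  then have "total_variation \<nu> (dir ` {s0..r0} - dir ` {s0..r0}) = 0" by simp
  then show ?thesis
    using compact_imp_closed[OF compact_dir_image[of s0 r0]] unfolding signed_support_def by blast
qed

lemma notin_signed_support_if_constant:
  assumes st: "stieltjes_on s0 r0 f g \<nu>" and "s0 < r0"
    and const: "\<And>u. s < u \<Longrightarrow> u < r \<Longrightarrow> f u = c \<and> g u = c"
    and t: "s < t" "t < r"
  shows "dir t \<notin> signed_support (dir ` {s0..r0}) \<nu>"
proof (cases "s0 \<le> t \<and> t \<le> r0")
  case True
  \<comment> \<open>A strictly smaller interval, since \<open>stieltjes_vanish\<close> needs
    constancy up to and including its end points.\<close>
  obtain s' r' where s'r': "s < s'" "s' < t" "t < r'" "r' < r"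
    using dense[of s t] dense[of t r] t by auto
  define C where "C = dir ` ({s0..r0} - {s'<..<r'})"
  have "compact ({s0..r0} - {s'<..<r'})" by (intro compact_diff) auto
  then have "closed C"
    unfolding C_def by (intro compact_imp_closed compact_continuous_image continuous_dir)
  moreover have "C \<subseteq> dir ` {s0..r0}" by (auto simp: C_def)
  moreover have "total_variation \<nu> (dir ` {s0..r0} - C) = 0"
  proof -
    have "\<nu> P = 0" if "P \<in> sets borel" "P \<subseteq> dir ` {s0..r0} - C" for P
    proof -
      have "P = dir ` (dir -` P \<inter> ({s'<..r'} \<inter> {s0..r0}))"
      proof (intro equalityI subsetI)
        fix x assume "x \<in> P"
        with that(2) obtain u where u: "x = dir u" "u \<in> {s0..r0}" "dir u \<notin> C" by blast
        then have "u \<in> {s'<..<r'}" by (auto simp: C_def)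
        with u \<open>x \<in> P\<close> show "x \<in> dir ` (dir -` P \<inter> ({s'<..r'} \<inter> {s0..r0}))"
          by (intro image_eqI[of _ _ u]) auto
      qed auto
      moreover have "\<nu> (dir ` (dir -` P \<inter> ({s'<..r'} \<inter> {s0..r0}))) = 0"
        by (rule stieltjes_vanish[OF st, where c = c and t = t])
           (use const s'r' True \<open>s0 < r0\<close> that(1) in \<open>auto intro: dir_vimage_borel\<close>)
      ultimately show ?thesis by simp
    qed
    then have "(\<Sum>P\<in>\<P>. ennreal \<bar>\<nu> P\<bar>) = 0" if "\<P> \<subseteq> sets borel" "\<Union>\<P> = dir ` {s0..r0} - C" for \<P>
    proof (intro sum.neutral ballI)
      fix P assume "P \<in> \<P>"
      then have "P \<in> sets borel" "P \<subseteq> dir ` {s0..r0} - C" using that by blast+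
      then show "ennreal \<bar>\<nu> P\<bar> = 0" using \<open>\<And>P. P \<in> sets borel \<Longrightarrow> P \<subseteq> dir ` {s0..r0} - C \<Longrightarrow> \<nu> P = 0\<close> by simp
    qed
    then have "total_variation \<nu> (dir ` {s0..r0} - C) \<le> 0"
      unfolding total_variation_def by (intro SUP_least) simp
    then show ?thesis by simp
  qed
  moreover have "dir t \<notin> C" using s'r' by (auto simp: C_def)
  ultimately show ?thesis unfolding signed_support_def by blast
next
  case False
  then have "dir t \<notin> dir ` {s0..r0}" by auto
  then show ?thesis using signed_support_subset[OF st] by blast
qed

text \<open>A closed set that misses \<open>dir t\<close> also misses a left-open interval around
  it, and this interval has nonzero mass. Completing it to a two-element partition of the complement
  makes the total variation there positive.\<close>

lemma in_signed_support_if_increasing: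
  assumes st: "stieltjes_on s0 r0 f g \<nu>" and t: "s0 < t" "t < r0"
    and incr: "\<And>s r. s0 < s \<Longrightarrow> s < t \<Longrightarrow> t < r \<Longrightarrow> r < r0 \<Longrightarrow> g s \<noteq> g r"
  shows "dir t \<in> signed_support (dir ` {s0..r0}) \<nu>"
  unfolding signed_support_def
proof (intro InterI, elim CollectE conjE)
  fix C assume C: "closed C" "C \<subseteq> dir ` {s0..r0}" "total_variation \<nu> (dir ` {s0..r0} - C) = 0"
  show "dir t \<in> C"
  proof (rule ccontr)
    assume "dir t \<notin> C"
    have "open (dir -` (- C))" using C(1) continuous_dir by (intro open_vimage) auto
    moreover have "t \<in> dir -` (- C)" using \<open>dir t \<notin> C\<close> by simp
    ultimately obtain \<delta> where \<delta>: "\<delta> > 0" "\<And>u. dist u t < \<delta> \<Longrightarrow> dir u \<notin> C"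
      unfolding open_dist by blast
    define s r where "s = t - min (\<delta> / 2) ((t - s0) / 2)" and "r = t + min (\<delta> / 2) ((r0 - t) / 2)"
    have sr: "s0 < s" "s < t" "t < r" "r < r0" "t - \<delta> < s" "r < t + \<delta>"
      using \<delta>(1) t by (auto simp: s_def r_def min_def field_simps)
    define P where "P = dir ` {s<..r}"
    define Q where "Q = dir ` {s0..r0} - C - P"
    have P: "P \<in> sets borel" "P \<subseteq> dir ` {s0..r0} - C"
      using sr \<delta>(2) by (auto simp: P_def dir_image_borel dist_real_def)
    have Q: "Q \<in> sets borel"
      unfolding Q_def using P(1) borel_closed[OF C(1)] dir_image_borel[of "{s0..r0}"] by auto
    have "\<nu> P \<noteq> 0"
      using st sr incr[of s r] by (simp add: stieltjes_on_def P_def)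
    have "ennreal \<bar>\<nu> P\<bar> \<le> (\<Sum>X\<in>{P, Q}. ennreal \<bar>\<nu> X\<bar>)"
      by (intro member_le_sum) auto
    also have "\<dots> \<le> total_variation \<nu> (dir ` {s0..r0} - C)"
      unfolding total_variation_def
      using P Q by (intro SUP_upper) (auto simp: disjoint_def Q_def)
    finally show False using C(3) \<open>\<nu> P \<noteq> 0\<close> by simp
  qed
qed

section \<open>Coalescence in a fixed direction\<close>

declare split_paired_All [simp del] split_paired_Ex [simp del]

text \<open>A path inspects the field only at levels not below its start. Hence it is measurable
  with respect to a smaller sigma-algebra \<open>N\<close> that describes only these levels, which
  is what the independence argument needs.\<close>

lemma up_pow_measurable:
  assumes "\<And>y. level x \<le> level y \<Longrightarrow> Measurable.pred N (s y)"
  shows "Measurable.pred N (\<lambda>\<omega>. (up (\<lambda>z. s z \<omega>) ^^ n) x = y)"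
proof (induction n arbitrary: y)
  case (Suc n)
  show ?case
  proof (cases "level y = level x + 1 + int n")
    case True
    have "level (y - e1) = level y - 1" "level (y - e2) = level y - 1"
      by (auto simp: lattice_defs)
    then have [measurable]: "Measurable.pred N (s (y - e1))" "Measurable.pred N (s (y - e2))"
      using True by (auto intro!: assms)
    have "(up (\<lambda>z. s z \<omega>) ^^ Suc n) x = y \<longleftrightarrow>
        (up (\<lambda>z. s z \<omega>) ^^ n) x = y - e1 \<and> s (y - e1) \<omega> \<or>
        (up (\<lambda>z. s z \<omega>) ^^ n) x = y - e2 \<and> \<not> s (y - e2) \<omega>" for \<omega>
      by (auto simp: up_def stp_def)
    then show ?thesis using Suc by simp
  next
    case False
    then have "(up (\<lambda>z. s z \<omega>) ^^ Suc n) x \<noteq> y" for \<omega>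
      using level_up_pow[where s = "\<lambda>z. s z \<omega>" and n = "Suc n" and x = x] by auto
    then show ?thesis by simp
  qed
qed simp

context prob_space
begin

lemma ex_prob_Collect_pos:
  assumes "\<And>m::nat. Measurable.pred M (P m)" "0 < prob {\<omega> \<in> space M. \<exists>m. P m \<omega>}"
  shows "\<exists>m. 0 < prob {\<omega> \<in> space M. P m \<omega>}"
proof (rule ccontr)
  assume "\<not> ?thesis"
  then have "prob {\<omega> \<in> space M. P m \<omega>} = 0" for m
    by (simp add: zero_less_measure_iff)
  then have "AE \<omega> in M. \<not> P m \<omega>" for m
    using assms(1) by (subst AE_iff_measurable[OF _ refl]) (auto simp: emeasure_eq_measure)
  then have "AE \<omega> in M. \<not> (\<exists>m. P m \<omega>)" by (simp add: AE_all_countable)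
  then have "prob {\<omega> \<in> space M. \<exists>m. P m \<omega>} = 0"
    using assms(1) by (subst prob_eq_0) auto
  with assms(2) show False by simp
qed

lemma ex_bound_prob_gt_less:
  fixes X :: "'i \<Rightarrow> 'a \<Rightarrow> real"
  assumes "finite I" "\<And>i. i \<in> I \<Longrightarrow> X i \<in> borel_measurable M" "0 < (\<delta>::real)"
  shows "\<exists>K. prob {\<omega> \<in> space M. \<exists>i\<in>I. K < \<bar>X i \<omega>\<bar>} < \<delta>"
proof -
  define A where "A m = {\<omega> \<in> space M. \<forall>i\<in>I. \<bar>X i \<omega>\<bar> \<le> real m}" for m
  have A: "A m \<in> events" for m
    unfolding A_def using assms by measurable
  have "(\<lambda>m. prob (A m)) \<longlonglongrightarrow> prob (\<Union>m. A m)"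
    using A by (intro finite_Lim_measure_incseq) (auto simp: incseq_def A_def intro: order_trans)
  also have "(\<Union>m. A m) = space M"
  proof (intro equalityI subsetI)
    fix \<omega> assume \<omega>: "\<omega> \<in> space M"
    obtain m where "(\<Sum>i\<in>I. \<bar>X i \<omega>\<bar>) \<le> real m" using real_arch_simple by blast
    then have "\<bar>X i \<omega>\<bar> \<le> real m" if "i \<in> I" for i
      using member_le_sum[of i I "\<lambda>i. \<bar>X i \<omega>\<bar>"] that assms(1) by force
    with \<omega> show "\<omega> \<in> (\<Union>m. A m)" by (auto simp: A_def)
  qed (auto simp: A_def)
  finally have "(\<lambda>m. prob (A m)) \<longlonglongrightarrow> 1" by (simp add: prob_space)
  then have "eventually (\<lambda>m. 1 - \<delta> < prob (A m)) sequentially"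
    by (rule order_tendstoD) (use assms in simp)
  then obtain m where m: "1 - \<delta> < prob (A m)" by (auto simp: eventually_sequentially)
  have "{\<omega> \<in> space M. \<exists>i\<in>I. real m < \<bar>X i \<omega>\<bar>} = space M - A m"
    by (auto simp: A_def not_le)
  then have "prob {\<omega> \<in> space M. \<exists>i\<in>I. real m < \<bar>X i \<omega>\<bar>} = 1 - prob (A m)"
    using A by (simp add: prob_compl)
  with m show ?thesis by (intro exI[of _ "real m"]) simp
qed

text \<open>Continuity gives a median \<open>q\<close>. Some level a distance
  \<open>1 / Suc m\<close> above \<open>q\<close> is exceeded with positive probability, and among
  the cells of a quarter of that length that fill the half-line below \<open>q\<close>, one has
  positive probability. The factor 4 leaves a surplus over the factor 2 that the window estimate
  loses.\<close>

lemma ex_separated_ranges: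
  fixes X :: "'a \<Rightarrow> real"
  assumes X [measurable]: "X \<in> borel_measurable M"
    and cont: "\<And>r. prob {\<omega> \<in> space M. X \<omega> = r} = 0"
  shows "\<exists>lo a hi. lo < hi \<and> a - lo \<le> (hi - lo) / 4 \<and>
    0 < prob {\<omega> \<in> space M. X \<omega> \<in> {lo..a}} \<and> 0 < prob {\<omega> \<in> space M. X \<omega> \<in> {hi..}}"
proof -
  interpret D: real_distribution "distr M borel X" by (intro real_distribution_distr) simp
  have cdf: "cdf (distr M borel X) r = prob {\<omega> \<in> space M. X \<omega> \<le> r}" for r
    by (simp add: cdf_def measure_distr vimage_def Int_def conj_commute)
  have "isCont (cdf (distr M borel X)) r" for r
    using cont[of r] by (simp add: D.isCont_cdf measure_distr vimage_def Int_def conj_commute)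
  moreover obtain r0 where "cdf (distr M borel X) r0 < 1/2"
    using order_tendstoD(2)[OF D.cdf_lim_at_bot, of "1/2"] by (auto simp: eventually_at_bot_linorder)
  moreover obtain r1 where "1/2 < cdf (distr M borel X) r1"
    using order_tendstoD(1)[OF D.cdf_lim_at_top_prob, of "1/2"] by (auto simp: eventually_at_top_linorder)
  moreover have "r0 \<le> r1"
    using calculation(2,3) D.cdf_nondecreasing[of r1 r0] by linarith
  ultimately obtain q where q: "cdf (distr M borel X) q = 1/2"
    using IVT[of "cdf (distr M borel X)" r0 "1/2" r1] by force
  have le_q: "prob {\<omega> \<in> space M. X \<omega> \<le> q} = 1/2" using q cdf by simp
  have gt_q: "prob {\<omega> \<in> space M. q < X \<omega>} = 1/2"
  proof -
    have "{\<omega> \<in> space M. q < X \<omega>} = space M - {\<omega> \<in> space M. X \<omega> \<le> q}" by auto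
    then show ?thesis using le_q by (simp add: prob_compl)
  qed
  have "{\<omega> \<in> space M. q < X \<omega>} = {\<omega> \<in> space M. \<exists>m::nat. q + 1 / real (Suc m) \<le> X \<omega>}"
  proof (intro Collect_cong conj_cong refl iffI)
    fix \<omega> assume "q < X \<omega>"
    then obtain m where "inverse (real (Suc m)) < X \<omega> - q" using reals_Archimedean[of "X \<omega> - q"] by auto
    then show "\<exists>m::nat. q + 1 / real (Suc m) \<le> X \<omega>" by (intro exI[of _ m]) (simp add: inverse_eq_divide)
  next
    fix \<omega> assume "\<exists>m::nat. q + 1 / real (Suc m) \<le> X \<omega>"
    then obtain m :: nat where "q + 1 / real (Suc m) \<le> X \<omega>" ..
    moreover have "0 < 1 / real (Suc m)" by simp
    ultimately show "q < X \<omega>" by linarith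
  qed
  then obtain m where m: "0 < prob {\<omega> \<in> space M. q + 1 / real (Suc m) \<le> X \<omega>}"
    using ex_prob_Collect_pos[of "\<lambda>m \<omega>. q + 1 / real (Suc m) \<le> X \<omega>"] gt_q by auto
  define \<eta> where "\<eta> = 1 / real (Suc m) / 4"
  have \<eta>: "0 < \<eta>" by (simp add: \<eta>_def)
  have "{\<omega> \<in> space M. X \<omega> \<le> q} = {\<omega> \<in> space M. \<exists>j::nat. q - real (Suc j) * \<eta> \<le> X \<omega> \<and> X \<omega> \<le> q - real j * \<eta>}"
  proof (intro Collect_cong conj_cong refl iffI)
    fix \<omega> assume le: "X \<omega> \<le> q"
    define j where "j = nat \<lfloor>(q - X \<omega>) / \<eta>\<rfloor>"
    have "0 \<le> (q - X \<omega>) / \<eta>" using le \<eta> by simp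
    then have "real j \<le> (q - X \<omega>) / \<eta>" "(q - X \<omega>) / \<eta> \<le> real (Suc j)"
      unfolding j_def by (auto simp: of_nat_nat) linarith+
    then show "\<exists>j::nat. q - real (Suc j) * \<eta> \<le> X \<omega> \<and> X \<omega> \<le> q - real j * \<eta>"
      using \<eta> by (intro exI[of _ j]) (simp add: field_simps)
  next
    fix \<omega> assume "\<exists>j::nat. q - real (Suc j) * \<eta> \<le> X \<omega> \<and> X \<omega> \<le> q - real j * \<eta>"
    then obtain j :: nat where "X \<omega> \<le> q - real j * \<eta>" by blast
    moreover have "0 \<le> real j * \<eta>" using \<eta> by simp
    ultimately show "X \<omega> \<le> q" by linarith
  qed
  then obtain j where j: "0 < prob {\<omega> \<in> space M. q - real (Suc j) * \<eta> \<le> X \<omega> \<and> X \<omega> \<le> q - real j * \<eta>}"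
    using ex_prob_Collect_pos[of "\<lambda>j \<omega>. q - real (Suc j) * \<eta> \<le> X \<omega> \<and> X \<omega> \<le> q - real j * \<eta>"] le_q by auto
  have \<eta>m: "1 / real (Suc m) = 4 * \<eta>" by (simp add: \<eta>_def field_simps)
  have *: "(q - real j * \<eta>) - (q - real (Suc j) * \<eta>) = \<eta>" by (simp add: algebra_simps)
  have **: "4 * \<eta> \<le> (q + 1 / real (Suc m)) - (q - real (Suc j) * \<eta>)"
    using \<eta> unfolding \<eta>m by simp
  show ?thesis
    by (rule exI[of _ "q - real (Suc j) * \<eta>"], rule exI[of _ "q - real j * \<eta>"],
        rule exI[of _ "q + 1 / real (Suc m)"])
       (use m j \<eta> * ** in \<open>auto simp del: of_nat_Suc\<close>)
qed

end

context busemann_process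
begin

lemma B_borel: "\<xi> \<in> ri_dirs \<Longrightarrow> B \<xi> \<sigma> x y \<in> borel_measurable M"
  using B_integrable by blast

lemma AE_B_shift:
  "AE \<omega> in M. \<forall>\<xi>\<in>ri_dirs. \<forall>\<sigma> x y z. B \<xi> \<sigma> (x + z) (y + z) \<omega> = B \<xi> \<sigma> x y (T z \<omega>)"
  using B_event
proof (elim bexE conjE, goal_cases)
  case (1 \<Omega>0)
  then have "AE \<omega> in M. \<omega> \<in> \<Omega>0" by (simp add: AE_in_set_eq_1)
  then show ?case by eventually_elim (use 1(4) in blast)
qed

lemma AE_B_cocycle:
  "AE \<omega> in M. \<forall>\<xi>\<in>ri_dirs. \<forall>\<sigma> x y z. B \<xi> \<sigma> x y \<omega> + B \<xi> \<sigma> y z \<omega> = B \<xi> \<sigma> x z \<omega>"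
  using B_event
proof (elim bexE conjE, goal_cases)
  case (1 \<Omega>0)
  then have "AE \<omega> in M. \<omega> \<in> \<Omega>0" by (simp add: AE_in_set_eq_1)
  then show ?case by eventually_elim (use 1(4) in blast)
qed

lemma AE_B_min:
  "AE \<omega> in M. \<forall>\<xi>\<in>ri_dirs. \<forall>\<sigma> x. min (B \<xi> \<sigma> x (x + e1) \<omega>) (B \<xi> \<sigma> x (x + e2) \<omega>) = W x \<omega>"
  using B_event
proof (elim bexE conjE, goal_cases)
  case (1 \<Omega>0)
  then have "AE \<omega> in M. \<omega> \<in> \<Omega>0" by (simp add: AE_in_set_eq_1)
  then show ?case by eventually_elim (use 1(4) in blast)
qed

lemma stationary_field:
  assumes "\<xi> \<in> ri_dirs"
  shows "stationary_field M T (\<lambda>x \<omega>. B \<xi> Splus x (x + e1) \<omega> \<le> B \<xi> Splus x (x + e2) \<omega>)"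
proof
  have [measurable]: "B \<xi> Splus x y \<in> borel_measurable M" for x y
    using assms by (rule B_borel)
  show "Measurable.pred M (\<lambda>\<omega>. B \<xi> Splus x (x + e1) \<omega> \<le> B \<xi> Splus x (x + e2) \<omega>)" for x
    by measurable
  show "AE \<omega> in M. \<forall>x. (B \<xi> Splus (x + z) (x + z + e1) \<omega> \<le> B \<xi> Splus (x + z) (x + z + e2) \<omega>) =
      (B \<xi> Splus x (x + e1) (T z \<omega>) \<le> B \<xi> Splus x (x + e2) (T z \<omega>))" for z
    using AE_B_shift
  proof eventually_elim
    case (elim \<omega>)
    have "B \<xi> Splus (x + z) (x + z + e) \<omega> = B \<xi> Splus x (x + e) (T z \<omega>)" for x e
    proof -
      have "B \<xi> Splus (x + z) (x + e + z) \<omega> = B \<xi> Splus x (x + e) (T z \<omega>)"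
        using elim assms by blast
      then show ?thesis by (simp add: ac_simps)
    qed
    then show ?case by simp
  qed
qed (auto simp: T_measurable T_preserving)

lemma prob_weights_box:
  assumes "finite R" "\<And>z. A z \<in> sets borel"
  shows "prob {\<omega> \<in> space M. \<forall>z\<in>R. W (v + z) \<omega> \<in> A z} = (\<Prod>z\<in>R. prob {\<omega> \<in> space M. W 0 \<omega> \<in> A z})"
proof (cases "R = {}")
  case False
  have *: "prob (W x -` A' \<inter> space M) = prob {\<omega> \<in> space M. W 0 \<omega> \<in> A'}" if "A' \<in> sets borel" for x A'
  proof -
    have "prob (W x -` A' \<inter> space M) = measure (distr M borel (W x)) A'"
      using that by (simp add: measure_distr W_measurable)
    also have "\<dots> = prob (W 0 -` A' \<inter> space M)"
      unfolding W_ident[of x] using that by (simp add: measure_distr W_measurable)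
    finally show ?thesis by (simp add: vimage_def Int_def conj_commute)
  qed
  have inj: "inj_on ((+) v) R" by (simp add: inj_on_def)
  have "{\<omega> \<in> space M. \<forall>z\<in>R. W (v + z) \<omega> \<in> A z} =
      (\<Inter>x\<in>(+) v ` R. W x -` A (x - v) \<inter> space M)"
    using False by auto
  also have "prob \<dots> = (\<Prod>x\<in>(+) v ` R. prob (W x -` A (x - v) \<inter> space M))"
    using W_indep assms False by (intro indep_varsD) auto
  also have "\<dots> = (\<Prod>z\<in>R. prob {\<omega> \<in> space M. W 0 \<omega> \<in> A z})"
    by (simp only: prod.reindex[OF inj] o_def *[OF assms(2)] add_diff_cancel_left')
  finally show ?thesis .
qed (simp add: prob_space)

text \<open>The event \<open>alive n\<close> says that the origin has an ancestor \<open>n\<close> levels below. On \<open>G n i\<close> these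
  ancestors lie in a window of size \<open>k\<close> to the right of \<open>pt n i\<close> on which the Busemann increments are
  bounded by \<open>K\<close>; on \<open>Fr n i\<close> the weights below the window are such that it has no backward path of
  length \<open>m\<close>.\<close>

lemma AE_no_backward_infinite:
  assumes \<xi>: "\<xi> \<in> ri_dirs"
  shows "AE \<omega> in M. \<forall>v. \<not> backward_infinite (\<lambda>x. B \<xi> Splus x (x + e1) \<omega> \<le> B \<xi> Splus x (x + e2) \<omega>) v"
proof -
  define b where "b = B \<xi> Splus"
  define s where "s x \<omega> \<longleftrightarrow> b x (x + e1) \<omega> \<le> b x (x + e2) \<omega>" for x \<omega>
  interpret S: stationary_field M T s
    using stationary_field[OF \<xi>] by (simp add: s_def[abs_def] b_def)
  have b_meas [measurable]: "b x y \<in> borel_measurable M" for x y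
    unfolding b_def using \<xi> by (rule B_borel)

  \<comment> \<open>Ancestors of the origin at a given depth\<close>
  define pt where "pt n i = (i, - int n - i)" for n and i :: int
  have level_pt [simp]: "level (pt n i) = - int n" for n i by (simp add: pt_def level_def)
  define L where "L n i \<omega> \<longleftrightarrow> (up (S.field \<omega>) ^^ n) (pt n i) = 0" for n i \<omega>
  have L_meas [measurable]: "Measurable.pred M (L n i)" for n i
    unfolding L_def[abs_def] by measurable
  have L_range: "i \<in> {- int n..0}" if "L n i \<omega>" for n i \<omega>
    using that up_pow_ge[of "pt n i" n "S.field \<omega>"] by (simp add: L_def pt_def less_eq_prod_def)
  define alive where "alive n \<omega> \<longleftrightarrow> (\<exists>i\<in>{- int n..0}. L n i \<omega>)" for n \<omega>
  have alive_meas [measurable]: "Measurable.pred M (alive n)" for n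
    unfolding alive_def[abs_def] by measurable
  have alive_iff: "alive n \<omega> \<longleftrightarrow> (\<exists>u. (up (S.field \<omega>) ^^ n) u = 0)" for n \<omega>
  proof
    assume "\<exists>u. (up (S.field \<omega>) ^^ n) u = 0"
    then obtain u where u: "(up (S.field \<omega>) ^^ n) u = 0" by blast
    then have "level u = - int n"
      using level_up_pow[where s = "S.field \<omega>" and n = n and x = u] by (simp add: level_def)
    then have "u = pt n (fst u)" by (intro level_fst_eqI) (auto simp: pt_def level_def)
    with u have "L n (fst u) \<omega>" by (simp add: L_def)
    with L_range show "alive n \<omega>" unfolding alive_def by blast
  qed (auto simp: alive_def L_def)

  \<comment> \<open>Mass transport along the paths\<close>
  have transport: "(\<Sum>i\<in>{- int n..0}. prob {\<omega> \<in> space M. L n i \<omega> \<and> Q (pt n i) \<omega>}) \<le> prob {\<omega> \<in> space M. Q 0 \<omega>}"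
    if [measurable]: "\<And>u. Measurable.pred M (Q u)"
      and shift: "\<And>z. AE \<omega> in M. Q z \<omega> = Q 0 (T z \<omega>)" for n Q
  proof -
    \<comment> \<open>Shifting \<open>pt n i\<close> to the origin turns "this point leads to the
      origin" into "the origin leads to \<open>- pt n i\<close>". These events are disjoint in
      \<open>i\<close>, as the origin has a single successor after \<open>n\<close> steps.\<close>
    let ?E = "\<lambda>i. {\<omega> \<in> space M. (up (S.field \<omega>) ^^ n) 0 = - pt n i \<and> Q 0 \<omega>}"
    have "prob {\<omega> \<in> space M. L n i \<omega> \<and> Q (pt n i) \<omega>} = prob (?E i)" for i
    proof (rule S.prob_shift[where z = "pt n i"])
      show "AE \<omega> in M. (L n i \<omega> \<and> Q (pt n i) \<omega>) =
          ((up (S.field (T (pt n i) \<omega>)) ^^ n) 0 = - pt n i \<and> Q 0 (T (pt n i) \<omega>))"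
        using S.AE_up_pow_shift[of "pt n i"] shift[of "pt n i"]
      proof eventually_elim
        case (elim \<omega>)
        have "(up (S.field \<omega>) ^^ n) (0 + pt n i) = (up (S.field (T (pt n i) \<omega>)) ^^ n) 0 + pt n i"
          using elim by blast
        then show ?case using elim(2) by (simp add: L_def eq_neg_iff_add_eq_0)
      qed
    qed auto
    then have "(\<Sum>i\<in>{- int n..0}. prob {\<omega> \<in> space M. L n i \<omega> \<and> Q (pt n i) \<omega>}) = (\<Sum>i\<in>{- int n..0}. prob (?E i))"
      by simp
    also have "\<dots> = prob (\<Union>i\<in>{- int n..0}. ?E i)"
      by (intro finite_measure_finite_Union[symmetric]) (auto simp: disjoint_family_on_def pt_def)
    also have "\<dots> \<le> prob {\<omega> \<in> space M. Q 0 \<omega>}"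
      by (intro finite_measure_mono) auto
    finally show ?thesis .
  qed

  \<comment> \<open>By the cocycle property this is the increment from \<open>u\<close> to
    \<open>u + (1, -1)\<close>. It is written with upward steps because \<open>B_indep\<close>
    covers only pairs with \<open>x \<le> y\<close>.\<close>
  define D where "D u \<omega> = b u (u + e1) \<omega> - b (u + (1, -1)) (u + (1, -1) + e2) \<omega>" for u \<omega>
  define bad where "bad k K u \<omega> \<longleftrightarrow> (\<exists>j\<in>{0..int k}. K < \<bar>D (u + (j - 1, 1 - j)) \<omega>\<bar>)" for k K u \<omega>
  have D_meas [measurable]: "D u \<in> borel_measurable M" for u
    unfolding D_def[abs_def] by measurable
  have bad_meas [measurable]: "Measurable.pred M (bad k K u)" for k K u
    unfolding bad_def[abs_def] by measurable
  have bad_shift: "AE \<omega> in M. bad k K z \<omega> = bad k K 0 (T z \<omega>)" for k K z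
    using AE_B_shift
  proof eventually_elim
    case (elim \<omega>)
    have "b (x + z) (y + z) \<omega> = b x y (T z \<omega>)" for x y
      using elim \<xi> by (simp only: b_def)
    from this[of "(j - 1, 1 - j)" "(j - 1, 1 - j) + e1" for j]
      this[of "(j - 1, 1 - j) + (1, -1)" "(j - 1, 1 - j) + (1, -1) + e2" for j]
    have "D (z + (j - 1, 1 - j)) \<omega> = D (0 + (j - 1, 1 - j)) (T z \<omega>)" for j
      unfolding D_def by (simp only: ac_simps add_0_left)
    then show ?case by (simp only: bad_def)
  qed

  \<comment> \<open>Windows that contain all ancestors\<close>
  define p where "p = prob {\<omega> \<in> space M. backward_infinite (S.field \<omega>) 0}"
  have p_le: "p \<le> prob {\<omega> \<in> space M. alive n \<omega>}" for n
    unfolding p_def by (intro finite_measure_mono) (auto simp: backward_infinite_def alive_iff)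
  have "p = 0"
  proof (rule ccontr)
    assume "p \<noteq> 0"
    then have p: "p > 0" by (simp add: p_def zero_less_measure_iff)
    \<comment> \<open>By transport the mean number of ancestors at a level is at most 1, so by
      Markov's inequality more than \<open>k\<close> of them occur with probability at most
      \<open>p / 4\<close>. The choice of \<open>K\<close> gives away another \<open>p / 4\<close>,
      which leaves \<open>p / 2\<close> for the union of the events \<open>G n i\<close>.\<close>
    obtain k :: nat where k: "4 / p \<le> real k" using real_arch_simple by blast
    obtain K where K: "prob {\<omega> \<in> space M. bad k K 0 \<omega>} < p / 4"
      using ex_bound_prob_gt_less[of "{0..int k}" "\<lambda>j. D (0 + (j - 1, 1 - j))" "p / 4"] p
      unfolding bad_def by auto
    \<comment> \<open>The position \<open>i + 1\<close> is that of the leftmost ancestor, which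
      makes these events disjoint in \<open>i\<close>.\<close>
    define G where "G n i \<omega> \<longleftrightarrow> L n (i + 1) \<omega> \<and> (\<forall>j. L n j \<omega> \<longrightarrow> i < j \<and> j \<le> i + int k) \<and>
      \<not> bad k K (pt n (i + 1)) \<omega>" for n i \<omega>
    have G_meas [measurable]: "Measurable.pred M (G n i)" for n i
      unfolding G_def[abs_def] by measurable
    \<comment> \<open>Paths do not cross, so the ancestors at one level form an interval; a bound on
      their number then bounds the width of the window.\<close>
    have L_contiguous: "L n l \<omega>" if "L n i \<omega>" "L n j \<omega>" "i \<le> l" "l \<le> j" for n i j l \<omega>
    proof -
      have "fst ((up (S.field \<omega>) ^^ n) (pt n i)) \<le> fst ((up (S.field \<omega>) ^^ n) (pt n l))"
        "fst ((up (S.field \<omega>) ^^ n) (pt n l)) \<le> fst ((up (S.field \<omega>) ^^ n) (pt n j))"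
        using that by (intro up_pow_mono; simp add: pt_def level_def)+
      then have "fst ((up (S.field \<omega>) ^^ n) (pt n l)) = 0" using that by (simp add: L_def)
      then show ?thesis unfolding L_def by (intro level_fst_eqI) (auto simp: level_def[of 0])
    qed
    have prob_G: "p / 2 \<le> (\<Sum>i\<in>{- int n - 1..-1}. prob {\<omega> \<in> space M. G n i \<omega>})" for n
    proof -
      let ?I = "{- int n..0}" and ?J = "{- int n - 1..-1}"
      have "alive n \<omega> \<Longrightarrow> (\<exists>i\<in>?J. G n i \<omega>) \<or> Suc k \<le> card {i \<in> ?I. L n i \<omega>} \<or>
          (\<exists>i\<in>?I. L n i \<omega> \<and> bad k K (pt n i) \<omega>)" for \<omega>
      proof (rule ccontr)
        assume alive: "alive n \<omega>" and
          neg: "\<not> ((\<exists>i\<in>?J. G n i \<omega>) \<or> Suc k \<le> card {i \<in> ?I. L n i \<omega>} \<or>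
            (\<exists>i\<in>?I. L n i \<omega> \<and> bad k K (pt n i) \<omega>))"
        define X where "X = {i \<in> ?I. L n i \<omega>}"
        have X: "finite X" "X \<noteq> {}"
          using alive by (auto simp: X_def alive_def intro: finite_subset[of _ ?I])
        define m where "m = Min X"
        have m: "m \<in> X" "\<And>j. j \<in> X \<Longrightarrow> m \<le> j" using X by (auto simp: m_def)
        have "j \<le> m - 1 + int k" if "L n j \<omega>" for j
        proof -
          have "j \<in> X" using that L_range unfolding X_def by blast
          then have "{m..j} \<subseteq> X" using m L_contiguous[of n m \<omega> j] that by (auto simp: X_def)
          then have "card {m..j} \<le> card X" using X by (intro card_mono)
          also have "card X \<le> k" using neg by (auto simp: X_def)
          finally show ?thesis by simp
        qed
        moreover have "m \<le> j" if "L n j \<omega>" for j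
          using m(2) that L_range unfolding X_def by blast
        ultimately have "G n (m - 1) \<omega>"
          unfolding G_def using m(1) neg by (force simp: X_def)
        moreover have "m - 1 \<in> ?J" using m(1) by (auto simp: X_def)
        ultimately show False using neg by blast
      qed
      then have "{\<omega> \<in> space M. alive n \<omega>} \<subseteq> (\<Union>i\<in>?J. {\<omega> \<in> space M. G n i \<omega>}) \<union>
          ({\<omega> \<in> space M. Suc k \<le> card {i \<in> ?I. L n i \<omega>}} \<union>
           (\<Union>i\<in>?I. {\<omega> \<in> space M. L n i \<omega> \<and> bad k K (pt n i) \<omega>}))"
        by blast
      moreover have card_meas: "{\<omega> \<in> space M. Suc k \<le> card {i \<in> ?I. L n i \<omega>}} \<in> events"
        by (rule card_ge_events) auto
      ultimately have "prob {\<omega> \<in> space M. alive n \<omega>} \<le> prob ((\<Union>i\<in>?J. {\<omega> \<in> space M. G n i \<omega>}) \<union>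
          ({\<omega> \<in> space M. Suc k \<le> card {i \<in> ?I. L n i \<omega>}} \<union>
           (\<Union>i\<in>?I. {\<omega> \<in> space M. L n i \<omega> \<and> bad k K (pt n i) \<omega>})))"
        by (intro finite_measure_mono) auto
      also have "\<dots> \<le> prob (\<Union>i\<in>?J. {\<omega> \<in> space M. G n i \<omega>}) +
          (prob {\<omega> \<in> space M. Suc k \<le> card {i \<in> ?I. L n i \<omega>}} +
           prob (\<Union>i\<in>?I. {\<omega> \<in> space M. L n i \<omega> \<and> bad k K (pt n i) \<omega>}))"
        using card_meas
        by (intro order_trans[OF measure_Un_le] add_left_mono) auto
      also have "\<dots> \<le> (\<Sum>i\<in>?J. prob {\<omega> \<in> space M. G n i \<omega>}) +
          (p / 4 + (\<Sum>i\<in>?I. prob {\<omega> \<in> space M. L n i \<omega> \<and> bad k K (pt n i) \<omega>}))"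
      proof (intro add_mono)
        have "real (Suc k) * prob {\<omega> \<in> space M. Suc k \<le> card {i \<in> ?I. L n i \<omega>}} \<le>
            (\<Sum>i\<in>?I. prob {\<omega> \<in> space M. L n i \<omega>})"
          by (intro prob_card_ge_le) auto
        also have "\<dots> \<le> 1"
          using transport[of "\<lambda>_ _. True" n] by (simp add: prob_space)
        finally have "prob {\<omega> \<in> space M. Suc k \<le> card {i \<in> ?I. L n i \<omega>}} \<le> 1 / real (Suc k)"
          by (simp add: field_simps)
        also have "\<dots> \<le> p / 4"
          using k p by (simp add: field_simps)
        finally show "prob {\<omega> \<in> space M. Suc k \<le> card {i \<in> ?I. L n i \<omega>}} \<le> p / 4" .
      qed (auto intro!: measure_UNION_le)
      also have "(\<Sum>i\<in>?I. prob {\<omega> \<in> space M. L n i \<omega> \<and> bad k K (pt n i) \<omega>}) \<le> p / 4"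
        using transport[of "bad k K" n] bad_shift K by force
      finally show ?thesis using p_le[of n] by simp
    qed

    \<comment> \<open>Weights that cut off a window\<close>
    obtain lo a hi where ranges: "lo < hi" "a - lo \<le> (hi - lo) / 4"
      "0 < prob {\<omega> \<in> space M. W 0 \<omega> \<in> {lo..a}}" "0 < prob {\<omega> \<in> space M. W 0 \<omega> \<in> {hi..}}"
      using ex_separated_ranges[OF W_measurable W_continuous] by blast
    define c where "c = int k + 1"
    have c0: "0 \<le> real_of_int c" by (simp add: c_def)
    \<comment> \<open>With \<open>\<Delta> = hi - lo\<close> and
      \<open>a - lo \<le> \<Delta> / 4\<close>, the hypothesis of the window lemma reduces to
      \<open>c * \<bar>K\<bar> + c * \<Delta> / 2 < m * \<Delta> / 4\<close>. The final summand
      \<open>c\<close> ensures \<open>c < m\<close>.\<close>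
    obtain m :: nat where "(real_of_int c * \<bar>K\<bar> + real_of_int c * (hi - lo) / 2 + 1) * 4 / (hi - lo) + real_of_int c \<le> real m"
      using real_arch_simple by blast
    moreover have "0 < (real_of_int c * \<bar>K\<bar> + real_of_int c * (hi - lo) / 2 + 1) * 4 / (hi - lo)"
      using ranges by (intro divide_pos_pos mult_pos_pos add_nonneg_pos add_nonneg_nonneg) (auto simp: c_def)
    ultimately have m_c: "c < int m" and
      m_large: "(real_of_int c * \<bar>K\<bar> + real_of_int c * (hi - lo) / 2 + 1) * 4 / (hi - lo) \<le> real m"
      using c0 by linarith+
    define R where "R = {z. fst z \<le> c \<and> snd z \<le> c \<and> c - int m \<le> fst z + snd z \<and> fst z + snd z < c}"
    have "R \<subseteq> {- int m..c} \<times> {- int m..c}" by (auto simp: R_def)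
    then have "finite R" by (rule finite_subset) auto
    define A where "A z = (if snd z = c \<and> fst z < 0 \<or> fst z = c \<and> snd z < 0 then {hi..} else {lo..a})"
      for z :: "int \<times> int"
    \<comment> \<open>Chosen so that \<open>v n i + (r, c - r)\<close> is
      \<open>pt n (i + r)\<close>: the possible ancestors have \<open>r\<close> between 1 and
      \<open>k = c - 1\<close>, strictly inside the window.\<close>
    define v where "v n i = (i, - int n - i - c)" for n i
    define Fr where "Fr n i \<omega> \<longleftrightarrow> (\<forall>z\<in>R. W (v n i + z) \<omega> \<in> A z)" for n i \<omega>
    have W_meas [measurable]: "W x \<in> borel_measurable M" for x by (rule W_measurable)
    have A_sets [measurable]: "A z \<in> sets borel" for z by (simp add: A_def)
    have Fr_meas [measurable]: "Measurable.pred M (Fr n i)" for n i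
      unfolding Fr_def[abs_def] using \<open>finite R\<close> by measurable
    define \<epsilon> where "\<epsilon> = (\<Prod>z\<in>R. prob {\<omega> \<in> space M. W 0 \<omega> \<in> A z})"
    have "\<epsilon> > 0" unfolding \<epsilon>_def using ranges by (intro prod_pos) (auto simp: A_def)
    have prob_Fr: "prob {\<omega> \<in> space M. Fr n i \<omega>} = \<epsilon>" for n i
      unfolding Fr_def \<epsilon>_def using \<open>finite R\<close> by (intro prob_weights_box) auto

    \<comment> \<open>Independence of the window and the weights below it\<close>
    have indep: "prob {\<omega> \<in> space M. G n i \<omega> \<and> Fr n i \<omega>} = prob {\<omega> \<in> space M. G n i \<omega>} * \<epsilon>" for n i
    proof -
      \<comment> \<open>The upper half plane from level \<open>- n\<close> on. No point below it
        dominates one of its points, so all weights that enter \<open>Fr n i\<close> belong to the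
        second family of \<open>B_indep\<close>.\<close>
      define I where "I = {x. - int n \<le> level x}"
      define F where "F = {W x | x. x \<in> I} \<union> {B \<xi> \<sigma> x y | \<xi> \<sigma> x y. \<xi> \<in> ri_dirs \<and> x \<in> I \<and> x \<le> y}"
      define F' where "F' = {W x | x. \<forall>z\<in>I. \<not> z \<le> x}"
      define N where "N F = sigma (space M) {f -` A \<inter> space M | f A. f \<in> F \<and> A \<in> sets (borel :: real measure)}" for F
      have sets_N: "sets (N F) = generated_events M F" for F
        unfolding N_def generated_events_def by (intro sets_measure_of) auto
      have space_N: "space (N F) = space M" for F
        unfolding N_def by (intro space_measure_of) auto
      have f_N: "f \<in> borel_measurable (N F)" if "f \<in> F" for f F
      proof (rule measurableI)
        fix A :: "real set" assume "A \<in> sets borel"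
        with that show "f -` A \<inter> space (N F) \<in> sets (N F)"
          unfolding sets_N space_N generated_events_def by (intro sigma_sets.Basic) blast
      qed simp
      have b_N: "b x y \<in> borel_measurable (N F)" if "- int n \<le> level x" "x \<le> y" for x y
        using that \<xi> by (intro f_N) (auto simp: F_def I_def b_def)
      have le_e: "x \<le> x + e1" "x \<le> x + e2" for x :: "int \<times> int"
        by (auto simp: e1_def e2_def less_eq_prod_def)
      have s_N: "Measurable.pred (N F) (s x)" if "- int n \<le> level x" for x
        unfolding s_def[abs_def] using b_N[OF that] le_e[of x] by measurable
      have [measurable]: "Measurable.pred (N F) (L n j)" for j
        unfolding L_def[abs_def] using s_N by (intro up_pow_measurable) simp
      have D_N [measurable]: "D u \<in> borel_measurable (N F)" if "level u = - int n" for u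
      proof -
        have "- int n \<le> level u" "- int n \<le> level (u + (1, -1))"
          using that by (auto simp: level_def)
        then have "b u (u + e1) \<in> borel_measurable (N F)"
          "b (u + (1, -1)) (u + (1, -1) + e2) \<in> borel_measurable (N F)"
          by (auto intro!: b_N le_e)
        then show ?thesis unfolding D_def[abs_def] by measurable
      qed
      have "level (pt n (i + 1) + (j - 1, 1 - j)) = - int n" for j
        by (simp add: level_def pt_def)
      then have [measurable]: "Measurable.pred (N F) (bad k K (pt n (i + 1)))"
        unfolding bad_def[abs_def] by (intro pred_intros_finite) (auto intro!: borel_measurable_pred_less borel_measurable_abs D_N)
      have "{\<omega> \<in> space (N F). G n i \<omega>} \<in> sets (N F)"
        unfolding G_def by measurable
      moreover have "{\<omega> \<in> space (N F'). Fr n i \<omega>} \<in> sets (N F')"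
      proof -
        have "W (v n i + z) \<in> borel_measurable (N F')" if "z \<in> R" for z
        proof (intro f_N)
          have "level (v n i + z) < - int n" using that by (auto simp: level_def v_def R_def)
          moreover have "level x \<le> level y" if "x \<le> y" for x y :: "int \<times> int"
            using that by (auto simp: level_def less_eq_prod_def)
          ultimately show "W (v n i + z) \<in> F'" unfolding F'_def I_def by fastforce
        qed
        then show ?thesis unfolding Fr_def using \<open>finite R\<close> by measurable
      qed
      ultimately have "prob ({\<omega> \<in> space M. G n i \<omega>} \<inter> {\<omega> \<in> space M. Fr n i \<omega>}) =
          prob {\<omega> \<in> space M. G n i \<omega>} * prob {\<omega> \<in> space M. Fr n i \<omega>}"
        unfolding sets_N space_N F_def F'_def by (rule indep_setD[OF B_indep])
      moreover have "{\<omega> \<in> space M. G n i \<omega>} \<inter> {\<omega> \<in> space M. Fr n i \<omega>} =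
          {\<omega> \<in> space M. G n i \<omega> \<and> Fr n i \<omega>}" by blast
      ultimately show ?thesis by (simp add: prob_Fr)
    qed

    \<comment> \<open>Extinction below a cut-off window\<close>
    have dies: "AE \<omega> in M. \<forall>n i. G n i \<omega> \<and> Fr n i \<omega> \<longrightarrow> alive n \<omega> \<and> \<not> alive (n + m) \<omega>"
      using AE_B_cocycle AE_B_min
    proof eventually_elim
      case (elim \<omega>)
      have cocycle: "b x y \<omega> + b y z \<omega> = b x z \<omega>" for x y z
        using elim(1) \<xi> unfolding b_def by blast
      have min: "min (b x (x + e1) \<omega>) (b x (x + e2) \<omega>) = W x \<omega>" for x
        using elim(2) \<xi> unfolding b_def by blast
      show ?case
      proof (intro allI impI, elim conjE)
        fix n i assume G: "G n i \<omega>" and Fr: "Fr n i \<omega>"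
        have "\<not> alive (n + m) \<omega>"
        proof
          assume "alive (n + m) \<omega>"
          then obtain u where u: "(up (S.field \<omega>) ^^ (n + m)) u = 0" unfolding alive_iff by blast
          define y where "y = (up (S.field \<omega>) ^^ m) u"
          have y: "(up (S.field \<omega>) ^^ n) y = 0" using u by (simp add: y_def funpow_add)
          then have "level y = - int n"
            using level_up_pow[where s = "S.field \<omega>" and n = n and x = y] by (simp add: level_def)
          then have y_pt: "y = pt n (fst y)" by (intro level_fst_eqI) (auto simp: pt_def level_def)
          with y have "L n (fst y) \<omega>" by (simp add: L_def)
          with G have r: "0 < fst y - i" "fst y - i < c" by (auto simp: G_def c_def)
          show False
          proof (rule window_has_no_long_backward_path[where \<beta> = "\<lambda>x y. b x y \<omega>" and c = c and M = m
                and v = "v n i" and r = "fst y - i" and lo = lo and hi = hi and a = a and K = "\<bar>K\<bar>"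
                and w = "\<lambda>x. W x \<omega>" and s = "S.field \<omega>" and x = u])
            fix j assume j: "0 \<le> j" "j < c"
            define x where "x = v n i + (j, c - j)"
            have x: "x = pt n (i + 1) + (j - 1, 1 - j)" "v n i + (j + 1, c - j - 1) = x + (1, -1)"
              by (auto simp: x_def v_def pt_def)
            have e: "x + (1, -1) + e2 = x + e1" by (simp add: e1_def e2_def add.assoc)
            have "b x (x + (1, -1)) \<omega> = D x \<omega>"
              using cocycle[of x "x + (1, -1)" "x + e1"] unfolding D_def e by linarith
            moreover have "\<bar>D x \<omega>\<bar> \<le> K"
              using G j unfolding G_def bad_def c_def x(1) by (auto simp: not_less)
            ultimately show "\<bar>b (v n i + (j, c - j)) (v n i + (j + 1, c - j - 1)) \<omega>\<bar> \<le> \<bar>K\<bar>"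
              unfolding x x_def[symmetric] by simp
          next
            fix i' j' assume "i' \<le> c" "j' \<le> c" "c - int m \<le> i' + j'" "i' + j' < c"
            then have "(i', j') \<in> R" by (simp add: R_def)
            with Fr have "W (v n i + (i', j')) \<omega> \<in> A (i', j')" by (simp add: Fr_def)
            then show "W (v n i + (i', j')) \<omega> \<in>
                (if j' = c \<and> i' < 0 \<or> i' = c \<and> j' < 0 then {hi..} else {lo..a})"
              by (simp add: A_def)
          next
            define \<Delta> where "\<Delta> = hi - lo"
            have "\<Delta> > 0" using ranges by (simp add: \<Delta>_def)
            then have "(real_of_int c * \<bar>K\<bar> + real_of_int c * \<Delta> / 2 + 1) * 4 \<le> real m * \<Delta>"
              using m_large by (simp add: \<Delta>_def field_simps)
            moreover have "real m * (a - lo) \<le> real m * (\<Delta> / 4)"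
              using ranges by (intro mult_left_mono) (auto simp: \<Delta>_def)
            moreover have "(real m - real_of_int c) / 2 * \<Delta> = real m * \<Delta> / 2 - real_of_int c * \<Delta> / 2"
              by (simp add: field_simps)
            ultimately have "real_of_int c * \<bar>K\<bar> < (real m - real_of_int c) / 2 * \<Delta> - real m * (a - lo)"
              unfolding times_divide_eq_right distrib_right by linarith
            then show "real_of_int c * \<bar>K\<bar> < (real m - real_of_int c) / 2 * (hi - lo) - real m * (a - lo)"
              by (simp add: \<Delta>_def)
          next
            show "(up (S.field \<omega>) ^^ m) u = v n i + (fst y - i, c - (fst y - i))"
              unfolding y_def[symmetric] by (subst y_pt) (simp add: v_def pt_def)
          qed (use cocycle min r m_c ranges in \<open>auto simp: s_def\<close>)
        qed
        moreover have "alive n \<omega>"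
          using G L_range unfolding G_def alive_def by blast
        ultimately show "alive n \<omega> \<and> \<not> alive (n + m) \<omega>" by blast
      qed
    qed

    \<comment> \<open>Decay of the survival probability\<close>
    have drop: "prob {\<omega> \<in> space M. alive (n + m) \<omega>} + \<epsilon> * (p / 2) \<le> prob {\<omega> \<in> space M. alive n \<omega>}" for n
    proof -
      let ?J = "{- int n - 1..-1}"
      have G_unique: "i = j" if "G n i \<omega>" "G n j \<omega>" for i j \<omega>
      proof -
        have "j < i + 1" "i < j + 1" using that unfolding G_def by blast+
        then show ?thesis by simp
      qed
      have sub: "{\<omega> \<in> space M. alive (n + m) \<omega>} \<subseteq> {\<omega> \<in> space M. alive n \<omega>}"
        by (auto simp: alive_iff funpow_add)
      have "\<epsilon> * (p / 2) \<le> \<epsilon> * (\<Sum>i\<in>?J. prob {\<omega> \<in> space M. G n i \<omega>})"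
        using prob_G[of n] \<open>\<epsilon> > 0\<close> by (intro mult_left_mono) auto
      also have "\<dots> = (\<Sum>i\<in>?J. prob {\<omega> \<in> space M. G n i \<omega> \<and> Fr n i \<omega>})"
        by (simp add: indep sum_distrib_left mult.commute)
      also have "\<dots> = prob (\<Union>i\<in>?J. {\<omega> \<in> space M. G n i \<omega> \<and> Fr n i \<omega>})"
        by (intro finite_measure_finite_Union[symmetric]) (auto simp: disjoint_family_on_def dest: G_unique)
      also have "\<dots> \<le> prob ({\<omega> \<in> space M. alive n \<omega>} - {\<omega> \<in> space M. alive (n + m) \<omega>})"
      proof (rule finite_measure_mono_AE)
        show "AE \<omega> in M. \<omega> \<in> (\<Union>i\<in>?J. {\<omega> \<in> space M. G n i \<omega> \<and> Fr n i \<omega>}) \<longrightarrow>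
            \<omega> \<in> {\<omega> \<in> space M. alive n \<omega>} - {\<omega> \<in> space M. alive (n + m) \<omega>}"
          using dies by eventually_elim blast
      qed auto
      also have "\<dots> = prob {\<omega> \<in> space M. alive n \<omega>} - prob {\<omega> \<in> space M. alive (n + m) \<omega>}"
        using sub by (intro finite_measure_Diff) auto
      finally show ?thesis by simp
    qed
    \<comment> \<open>The loss per block of \<open>m\<close> levels does not shrink with depth,
      because \<open>p\<close> bounds the probability of \<open>alive n\<close> from below for every
      \<open>n\<close>; enough blocks would exhaust the total probability.\<close>
    have "prob {\<omega> \<in> space M. alive (j * m) \<omega>} + real j * (\<epsilon> * (p / 2)) \<le> 1" for j
    proof (induction j)
      case (Suc j)
      have eq: "Suc j * m = j * m + m" "real (Suc j) * (\<epsilon> * (p / 2)) = real j * (\<epsilon> * (p / 2)) + \<epsilon> * (p / 2)"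
        by (simp_all add: distrib_right)
      show ?case using Suc drop[of "j * m"] unfolding eq by linarith
    qed simp
    then have "real j * (\<epsilon> * (p / 2)) \<le> 1" for j
      by (meson add_increasing measure_nonneg order_refl order_trans)
    moreover have "0 < \<epsilon> * (p / 2)" using p \<open>\<epsilon> > 0\<close> by simp
    ultimately show False
      using reals_Archimedean3[of "\<epsilon> * (p / 2)"] by (metis not_le)
  qed
  have "AE \<omega> in M. \<not> backward_infinite (S.field \<omega>) v" for v
  proof -
    have "prob {\<omega> \<in> space M. backward_infinite (S.field \<omega>) v} = 0"
      unfolding \<open>p = 0\<close>[unfolded p_def, symmetric]
    proof (rule S.prob_shift[where z = v])
      show "AE \<omega> in M. backward_infinite (S.field \<omega>) v = backward_infinite (S.field (T v \<omega>)) 0"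
        using S.AE_backward_infinite_shift[of v] by eventually_elim (metis add_0)
    qed auto
    then have "AE \<omega> in M. \<omega> \<notin> {\<omega> \<in> space M. backward_infinite (S.field \<omega>) v}"
      by (subst prob_eq_0[symmetric]) auto
    then show ?thesis using AE_space by eventually_elim blast
  qed
  then show ?thesis by (simp add: AE_all_countable s_def b_def)
qed

end

text \<open>By Fubini: for each value \<open>y\<close> of \<open>Y\<close>, the variable
  \<open>X\<close> would have to hit the single point \<open>- y\<close>.\<close>

lemma (in prob_space) AE_indep_add_ne_0:
  fixes X Y :: "'a \<Rightarrow> real"
  assumes indep: "indep_var borel X borel Y" and cont: "\<And>r. prob {\<omega> \<in> space M. X \<omega> = r} = 0"
  shows "AE \<omega> in M. X \<omega> + Y \<omega> \<noteq> 0"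
proof -
  have [measurable]: "X \<in> borel_measurable M" "Y \<in> borel_measurable M"
    using indep by (blast dest: indep_var_rv1 indep_var_rv2)+
  interpret X: prob_space "distr M borel X" by (rule prob_space_distr) simp
  interpret Y: prob_space "distr M borel Y" by (rule prob_space_distr) simp
  interpret XY: pair_sigma_finite "distr M borel X" "distr M borel Y" ..
  let ?S = "{p :: real \<times> real. fst p + snd p = 0}"
  have S [measurable]: "?S \<in> sets (borel \<Otimes>\<^sub>M borel)"
  proof -
    have "{p \<in> space (borel \<Otimes>\<^sub>M borel). fst p + snd p = (0::real)} \<in> sets (borel \<Otimes>\<^sub>M borel)"
      by measurable
    then show ?thesis by (simp add: space_pair_measure)
  qed
  have "emeasure M {\<omega> \<in> space M. X \<omega> + Y \<omega> = 0} =
      emeasure (distr M (borel \<Otimes>\<^sub>M borel) (\<lambda>\<omega>. (X \<omega>, Y \<omega>))) ?S"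
    by (subst emeasure_distr) (auto intro!: arg_cong[where f = "emeasure M"])
  also have "distr M (borel \<Otimes>\<^sub>M borel) (\<lambda>\<omega>. (X \<omega>, Y \<omega>)) = distr M borel X \<Otimes>\<^sub>M distr M borel Y"
    using indep by (simp add: indep_var_distribution_eq)
  also have "emeasure (distr M borel X \<Otimes>\<^sub>M distr M borel Y) ?S =
      (\<integral>\<^sup>+ y. emeasure (distr M borel X) ((\<lambda>x. (x, y)) -` ?S) \<partial>distr M borel Y)"
    by (rule XY.emeasure_pair_measure_alt2) (simp cong: sets_pair_measure_cong)
  also have "\<dots> = (\<integral>\<^sup>+ y. 0 \<partial>distr M borel Y)"
  proof (intro nn_integral_cong)
    fix y
    have "(\<lambda>x. (x, y)) -` ?S = {- y}" by auto
    then have "emeasure (distr M borel X) ((\<lambda>x. (x, y)) -` ?S) = emeasure M {\<omega> \<in> space M. X \<omega> = - y}"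
      by (subst emeasure_distr) (auto intro!: arg_cong[where f = "emeasure M"])
    also have "\<dots> = 0" using cont[of "- y"] by (simp add: emeasure_eq_measure)
    finally show "emeasure (distr M borel X) ((\<lambda>x. (x, y)) -` ?S) = 0" .
  qed
  finally have "emeasure M {\<omega> \<in> space M. X \<omega> + Y \<omega> = 0} = 0" by simp
  then show ?thesis by (subst AE_iff_measurable[OF _ refl]) auto
qed

context busemann_process
begin

lemma prob_W_eq: "prob {\<omega> \<in> space M. W x \<omega> = r} = 0"
  using prob_weights_box[of "{0}" "\<lambda>_. {r}" x] W_continuous[of r] by simp

lemma AE_weight_combination_ne_0:
  fixes c :: "int \<times> int \<Rightarrow> real"
  assumes "finite F" "z \<in> F" "c z \<noteq> 0"
  shows "AE \<omega> in M. (\<Sum>y\<in>F. c y * W y \<omega>) \<noteq> 0"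
proof -
  have "indep_vars (\<lambda>_. borel) (\<lambda>y \<omega>. c y * W y \<omega>) UNIV"
    using W_indep by (rule indep_vars_compose2) simp
  then have "indep_vars (\<lambda>_. borel) (\<lambda>y \<omega>. c y * W y \<omega>) (insert z (F - {z}))"
    by (rule indep_vars_subset) simp
  then have "indep_var borel (\<lambda>\<omega>. c z * W z \<omega>) borel (\<lambda>\<omega>. \<Sum>y\<in>F - {z}. c y * W y \<omega>)"
    using assms by (intro indep_vars_sum) auto
  moreover have "prob {\<omega> \<in> space M. c z * W z \<omega> = r} = 0" for r
  proof -
    have "{\<omega> \<in> space M. c z * W z \<omega> = r} = {\<omega> \<in> space M. W z \<omega> = r / c z}"
      using assms by (auto simp: field_simps)
    then show ?thesis using prob_W_eq by simp
  qed
  ultimately have "AE \<omega> in M. c z * W z \<omega> + (\<Sum>y\<in>F - {z}. c y * W y \<omega>) \<noteq> 0"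
    by (rule AE_indep_add_ne_0)
  then show ?thesis using assms by (simp add: sum.remove)
qed

text \<open>Only countably many quadruples of finite sets occur. For a fixed one, disjointness lets
  the coefficients 1, 0 and -1 determine the two sets, so different pairs leave some weight with a
  nonzero coefficient, and a nontrivial combination of independent continuous weights almost surely
  does not vanish.\<close>

lemma AE_weights_independent:
  "AE \<omega> in M. \<forall>P Q P' Q'. finite P \<and> finite Q \<and> finite P' \<and> finite Q' \<and> P \<inter> Q = {} \<and> P' \<inter> Q' = {} \<and>
    (\<Sum>z\<in>P. W z \<omega>) - (\<Sum>z\<in>Q. W z \<omega>) = (\<Sum>z\<in>P'. W z \<omega>) - (\<Sum>z\<in>Q'. W z \<omega>) \<longrightarrow> P = P' \<and> Q = Q'"
proof -
  have one: "AE \<omega> in M. (\<Sum>z\<in>P. W z \<omega>) - (\<Sum>z\<in>Q. W z \<omega>) = (\<Sum>z\<in>P'. W z \<omega>) - (\<Sum>z\<in>Q'. W z \<omega>) \<longrightarrow>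
      P = P' \<and> Q = Q'"
    if fin: "finite P" "finite Q" "finite P'" "finite Q'" and disj: "P \<inter> Q = {}" "P' \<inter> Q' = {}"
    for P Q P' Q'
  proof (cases "P = P' \<and> Q = Q'")
    case False
    define F where "F = P \<union> Q \<union> P' \<union> Q'"
    define ind :: "(int \<times> int) set \<Rightarrow> int \<times> int \<Rightarrow> real" where "ind A z = (if z \<in> A then 1 else 0)" for A z
    define c where "c z = ind P z - ind Q z - ind P' z + ind Q' z" for z
    have "\<exists>z\<in>F. c z \<noteq> 0"
    proof (rule ccontr)
      assume "\<not> ?thesis"
      then have c0: "c z = 0" if "z \<in> F" for z using that by blast
      have "(z \<in> P \<longleftrightarrow> z \<in> P') \<and> (z \<in> Q \<longleftrightarrow> z \<in> Q')" for z
      proof (cases "z \<in> F")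
        case True
        moreover have "z \<notin> P \<or> z \<notin> Q" "z \<notin> P' \<or> z \<notin> Q'" using disj by blast+
        ultimately show ?thesis using c0[of z] unfolding c_def ind_def by (simp split: if_splits)
      qed (auto simp: F_def)
      then have "P = P' \<and> Q = Q'" by auto
      with False show False by simp
    qed
    then obtain z where "z \<in> F" "c z \<noteq> 0" by blast
    then have "AE \<omega> in M. (\<Sum>y\<in>F. c y * W y \<omega>) \<noteq> 0"
      using fin by (intro AE_weight_combination_ne_0) (auto simp: F_def)
    moreover have "(\<Sum>y\<in>F. c y * W y \<omega>) =
        (\<Sum>z\<in>P. W z \<omega>) - (\<Sum>z\<in>Q. W z \<omega>) - (\<Sum>z\<in>P'. W z \<omega>) + (\<Sum>z\<in>Q'. W z \<omega>)" for \<omega>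
    proof -
      have *: "(\<Sum>z\<in>F. ind A z * W z \<omega>) = (\<Sum>z\<in>A. W z \<omega>)" if "A \<subseteq> F" for A
      proof -
        have "(\<Sum>z\<in>F. ind A z * W z \<omega>) = (\<Sum>z\<in>F. if z \<in> A then W z \<omega> else 0)"
          by (intro sum.cong) (auto simp: ind_def)
        also have "\<dots> = (\<Sum>z\<in>F \<inter> A. W z \<omega>)"
          using fin by (subst sum.inter_restrict) (auto simp: F_def)
        finally show ?thesis using that by (simp add: Int_absorb1)
      qed
      have "(\<Sum>y\<in>F. c y * W y \<omega>) = (\<Sum>z\<in>F. ind P z * W z \<omega>) - (\<Sum>z\<in>F. ind Q z * W z \<omega>) -
          (\<Sum>z\<in>F. ind P' z * W z \<omega>) + (\<Sum>z\<in>F. ind Q' z * W z \<omega>)"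
        by (simp add: c_def left_diff_distrib distrib_right sum.distrib sum_subtractf)
      then show ?thesis using *[of P] *[of Q] *[of P'] *[of Q'] by (simp add: F_def Un_assoc sup.coboundedI1 sup.coboundedI2)
    qed
    ultimately have "AE \<omega> in M. (\<Sum>z\<in>P. W z \<omega>) - (\<Sum>z\<in>Q. W z \<omega>) - (\<Sum>z\<in>P'. W z \<omega>) + (\<Sum>z\<in>Q'. W z \<omega>) \<noteq> 0"
      by simp
    then show ?thesis by eventually_elim linarith
  qed simp
  have "AE \<omega> in M. \<forall>P\<in>{P. finite P}. \<forall>Q\<in>{P. finite P}. \<forall>P'\<in>{P. finite P}. \<forall>Q'\<in>{P. finite P}.
      P \<inter> Q = {} \<and> P' \<inter> Q' = {} \<longrightarrow>
      (\<Sum>z\<in>P. W z \<omega>) - (\<Sum>z\<in>Q. W z \<omega>) = (\<Sum>z\<in>P'. W z \<omega>) - (\<Sum>z\<in>Q'. W z \<omega>) \<longrightarrow> P = P' \<and> Q = Q'"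
  proof (intro AE_ball_countable[THEN iffD2] ballI countable_Collect_finite)
    fix P Q P' Q' :: "(int \<times> int) set"
    assume "P \<in> {P. finite P}" "Q \<in> {P. finite P}" "P' \<in> {P. finite P}" "Q' \<in> {P. finite P}"
    then show "AE \<omega> in M. P \<inter> Q = {} \<and> P' \<inter> Q' = {} \<longrightarrow>
      (\<Sum>z\<in>P. W z \<omega>) - (\<Sum>z\<in>Q. W z \<omega>) = (\<Sum>z\<in>P'. W z \<omega>) - (\<Sum>z\<in>Q'. W z \<omega>) \<longrightarrow> P = P' \<and> Q = Q'"
      using one[of P Q P' Q'] by (cases "P \<inter> Q = {} \<and> P' \<inter> Q' = {}") auto
  qed
  then show ?thesis by eventually_elim blast
qed

lemma AE_coalescing:
  assumes "\<xi> \<in> ri_dirs"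
  shows "AE \<omega> in M. coalescing (\<lambda>x. B \<xi> Splus x (x + e1) \<omega> \<le> B \<xi> Splus x (x + e2) \<omega>)"
  using stationary_field.AE_coalescing_if_no_backward_infinite[OF stationary_field[OF assms]
      AE_no_backward_infinite[OF assms]] .

end

section \<open>Supports of the Busemann measures\<close>

text \<open>Unit steps join any two points. This reduces statements about arbitrary pairs, where
  Busemann functions need not be monotone in the direction, to the monotone nearest-neighbour
  increments.\<close>

lemma lattice_pair_induct:
  fixes P :: "int \<times> int \<Rightarrow> int \<times> int \<Rightarrow> bool"
  assumes e1: "\<And>x. P x (x + e1)" and e2: "\<And>x. P x (x + e2)"
    and sym: "\<And>x y. P x y \<Longrightarrow> P y x" and trans: "\<And>x y z. P x y \<Longrightarrow> P y z \<Longrightarrow> P x z"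
  shows "P x y"
proof -
  have refl: "P x x" for x using e1[of x] sym trans by blast
  have 1: "P x (x + (i, 0))" for x i
  proof (induction i rule: int_induct[of _ 0])
    case base
    show ?case using refl by (simp add: zero_prod_def[symmetric])
  next
    case (step1 i)
    have eq: "x + (i, 0) + e1 = x + (i + 1, 0)" by (simp add: e1_def add.assoc)
    show ?case using trans[OF step1(2) e1[of "x + (i, 0)"]] unfolding eq .
  next
    case (step2 i)
    have eq: "x + (i - 1, 0) + e1 = x + (i, 0)" by (simp add: e1_def add.assoc)
    show ?case using trans[OF step2(2) sym[OF e1[of "x + (i - 1, 0)", unfolded eq]]] .
  qed
  have 2: "P x (x + (0, i))" for x i
  proof (induction i rule: int_induct[of _ 0])
    case base
    show ?case using refl by (simp add: zero_prod_def[symmetric])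
  next
    case (step1 i)
    have eq: "x + (0, i) + e2 = x + (0, i + 1)" by (simp add: e2_def add.assoc)
    show ?case using trans[OF step1(2) e2[of "x + (0, i)"]] unfolding eq .
  next
    case (step2 i)
    have eq: "x + (0, i - 1) + e2 = x + (0, i)" by (simp add: e2_def add.assoc)
    show ?case using trans[OF step2(2) sym[OF e2[of "x + (0, i - 1)", unfolded eq]]] .
  qed
  have "y = x + (fst y - fst x, 0) + (0, snd y - snd x)" by (cases x; cases y) simp
  then show ?thesis using trans[OF 1 2] by metis
qed

text \<open>The pair \<open>(s, \<sigma>)\<close> stands for the one-sided direction \<open>(dir s)\<sigma>\<close>.\<close>

definition sided_le :: "real \<Rightarrow> sign \<Rightarrow> real \<Rightarrow> sign \<Rightarrow> bool" where
  "sided_le s \<sigma> t \<tau> \<longleftrightarrow> s < t \<or> s = t \<and> (\<sigma> = \<tau> \<or> \<sigma> = Sminus)"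

text \<open>The deterministic content of a typical realization. Absence of ties is almost sure only
  for a fixed direction and is therefore recorded for rational parameters; of the divergence at the
  end points of the direction segment, only two strict inequalities are kept.\<close>

locale busemann_realization =
  fixes b :: busemann and w :: "int \<times> int \<Rightarrow> real"
  assumes cocycle: "0 < t \<Longrightarrow> t < 1 \<Longrightarrow> b (dir t) \<sigma> x y + b (dir t) \<sigma> y z = b (dir t) \<sigma> x z"
    and min_eq: "0 < t \<Longrightarrow> t < 1 \<Longrightarrow> min (b (dir t) \<sigma> x (x + e1)) (b (dir t) \<sigma> x (x + e2)) = w x"
    and mono_e1: "0 < s \<Longrightarrow> s < t \<Longrightarrow> t < 1 \<Longrightarrow> b (dir s) Splus x (x + e1) \<le> b (dir s) Sminus x (x + e1) \<and>
      b (dir t) Sminus x (x + e1) \<le> b (dir s) Splus x (x + e1)"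
    and mono_e2: "0 < s \<Longrightarrow> s < t \<Longrightarrow> t < 1 \<Longrightarrow> b (dir s) Sminus x (x + e2) \<le> b (dir s) Splus x (x + e2) \<and>
      b (dir s) Splus x (x + e2) \<le> b (dir t) Sminus x (x + e2)"
    and left: "0 < t \<Longrightarrow> t < 1 \<Longrightarrow> ((\<lambda>s. b (dir s) \<sigma> x y) \<longlongrightarrow> b (dir t) Sminus x y) (at_left t)"
    and right: "0 < t \<Longrightarrow> t < 1 \<Longrightarrow> ((\<lambda>s. b (dir s) \<sigma> x y) \<longlongrightarrow> b (dir t) Splus x y) (at_right t)"
    and ex_e1: "\<exists>t. 0 < t \<and> t < 1 \<and> w x < b (dir t) Splus x (x + e1)"
    and ex_e2: "\<exists>t. 0 < t \<and> t < 1 \<and> w x < b (dir t) Splus x (x + e2)"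
    and no_tie: "t \<in> \<rat> \<Longrightarrow> 0 < t \<Longrightarrow> t < 1 \<Longrightarrow> b (dir t) Splus x (x + e1) \<noteq> b (dir t) Splus x (x + e2)"
begin

abbreviation E1 :: "real \<Rightarrow> sign \<Rightarrow> int \<times> int \<Rightarrow> real" where
  "E1 t \<sigma> x \<equiv> b (dir t) \<sigma> x (x + e1)"

abbreviation E2 :: "real \<Rightarrow> sign \<Rightarrow> int \<times> int \<Rightarrow> real" where
  "E2 t \<sigma> x \<equiv> b (dir t) \<sigma> x (x + e2)"

text \<open>The increment across the dual point of \<open>x\<close>. Its sign selects the outgoing
  edge at \<open>x\<close>, and as a nondecreasing function of \<open>t\<close> it is the
  distribution function of the measure that defines instability.\<close>

definition h :: "real \<Rightarrow> sign \<Rightarrow> int \<times> int \<Rightarrow> real" where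
  "h t \<sigma> x = b (dir t) \<sigma> (x + e1) (x + e2)"

text \<open>The Busemann graph as a predicate for \<open>up\<close> and \<open>dn\<close>; the value
  zero is a tie, broken by the sign.\<close>

definition st :: "real \<Rightarrow> sign \<Rightarrow> int \<times> int \<Rightarrow> bool" where
  "st t \<sigma> x \<longleftrightarrow> 0 < h t \<sigma> x \<or> h t \<sigma> x = 0 \<and> \<sigma> = Splus"

text \<open>A point of increase of \<open>h\<close>, that is, a point of the support of its
  Stieltjes measure; see \<open>busemann_supp_iff\<close>.\<close>

definition unst :: "int \<times> int \<Rightarrow> real \<Rightarrow> bool" where
  "unst x t \<longleftrightarrow> 0 < t \<and> t < 1 \<and> (\<forall>s r. 0 < s \<longrightarrow> s < t \<longrightarrow> t < r \<longrightarrow> r < 1 \<longrightarrow> h s Splus x < h r Splus x)"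

context
  fixes t :: real assumes t: "0 < t" "t < 1"
begin

lemma h_eq: "h t \<sigma> x = E2 t \<sigma> x - E1 t \<sigma> x"
  using cocycle[OF t, of \<sigma> x "x + e1" "x + e2"] by (simp add: h_def)

lemma h_eq': "h t \<sigma> x = E2 t \<sigma> (x + e1) - E1 t \<sigma> (x + e2)"
  using cocycle[OF t, of \<sigma> "x + e1" "x + e2" "x + e1 + e2"] by (simp add: h_def ac_simps)

lemma b_refl: "b (dir t) \<sigma> x x = 0"
  using cocycle[OF t, of \<sigma> x x x] by simp

lemma b_sym: "b (dir t) \<sigma> y x = - b (dir t) \<sigma> x y"
  using cocycle[OF t, of \<sigma> x y x] b_refl[of \<sigma> x] by simp

lemma w_le: "w x \<le> E1 t \<sigma> x" "w x \<le> E2 t \<sigma> x"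
  using min_eq[OF t, of \<sigma> x] by linarith+

lemma b_up: "b (dir t) \<sigma> x (up (st t \<sigma>) x) = w x"
  using min_eq[OF t, of \<sigma> x] by (auto simp: up_def stp_def st_def h_eq)

lemma E2_eq_if_h_nonpos: "h t \<sigma> x \<le> 0 \<Longrightarrow> E2 t \<sigma> x = w x"
  and E1_eq_if_h_nonneg: "0 \<le> h t \<sigma> x \<Longrightarrow> E1 t \<sigma> x = w x"
  using min_eq[OF t, of \<sigma> x] by (auto simp: h_eq)

end

lemma E1_antimono: "sided_le s \<sigma> t \<tau> \<Longrightarrow> 0 < s \<Longrightarrow> t < 1 \<Longrightarrow> E1 t \<tau> x \<le> E1 s \<sigma> x"
  using mono_e1[of s t x] mono_e1[of t "(t + 1) / 2" x]
  by (cases \<sigma>; cases \<tau>) (auto simp: sided_le_def)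

lemma E2_mono: "sided_le s \<sigma> t \<tau> \<Longrightarrow> 0 < s \<Longrightarrow> t < 1 \<Longrightarrow> E2 s \<sigma> x \<le> E2 t \<tau> x"
  using mono_e2[of s t x] mono_e2[of t "(t + 1) / 2" x]
  by (cases \<sigma>; cases \<tau>) (auto simp: sided_le_def)

lemma h_mono: "sided_le s \<sigma> t \<tau> \<Longrightarrow> 0 < s \<Longrightarrow> t < 1 \<Longrightarrow> h s \<sigma> x \<le> h t \<tau> x"
  using E1_antimono[of s \<sigma> t \<tau> x] E2_mono[of s \<sigma> t \<tau> x] by (auto simp: h_eq sided_le_def)

text \<open>Monotonicity of \<open>h\<close> could fail to carry over only if \<open>h\<close>
  vanished at \<open>s\<close> with sign plus and at a later \<open>t\<close> with sign minus. Then
  it would vanish at a rational in between, where ties are excluded.\<close>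

lemma st_mono: "sided_le s \<sigma> t \<tau> \<Longrightarrow> 0 < s \<Longrightarrow> t < 1 \<Longrightarrow> st s \<sigma> x \<Longrightarrow> st t \<tau> x"
proof -
  assume le: "sided_le s \<sigma> t \<tau>" and "0 < s" "t < 1" and st: "st s \<sigma> x"
  have h: "h s \<sigma> x \<le> h t \<tau> x" by (rule h_mono) fact+
  show "st t \<tau> x"
  proof (cases "0 < h s \<sigma> x")
    case True
    with h show ?thesis by (simp add: st_def)
  next
    case False
    then have 0: "h s \<sigma> x = 0" "\<sigma> = Splus" using st by (auto simp: st_def)
    show ?thesis
    proof (cases "s = t")
      case True
      with le 0 h show ?thesis by (auto simp: st_def sided_le_def)
    next
      case False
      with le have "s < t" by (auto simp: sided_le_def)
      then obtain q where q: "q \<in> \<rat>" "s < q" "q < t" using Rats_dense_in_real by blast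
      have "h s \<sigma> x \<le> h q Splus x" "h q Splus x \<le> h t \<tau> x"
        using q \<open>0 < s\<close> \<open>t < 1\<close> by (auto intro!: h_mono simp: sided_le_def)
      moreover have "h q Splus x \<noteq> 0"
        using no_tie[of q x] q \<open>0 < s\<close> \<open>t < 1\<close> by (simp add: h_eq)
      ultimately show ?thesis using 0 by (simp add: st_def)
    qed
  qed
qed

text \<open>Since \<open>h\<close> is the difference of the nondecreasing \<open>E2\<close> and the
  nonincreasing \<open>E1\<close>, it can be constant on an interval only if both are.\<close>

lemma locally_constant_if_stable:
  assumes "\<not> unst x t" "0 < t" "t < 1"
  shows "\<exists>s r c1 c2. 0 < s \<and> s < t \<and> t < r \<and> r < 1 \<and>
    (\<forall>u \<sigma>. s < u \<and> u < r \<longrightarrow> E1 u \<sigma> x = c1 \<and> E2 u \<sigma> x = c2)"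
proof -
  obtain s r where sr: "0 < s" "s < t" "t < r" "r < 1" "h r Splus x \<le> h s Splus x"
    using assms by (auto simp: unst_def not_less)
  have "E1 u \<sigma> x = E1 s Splus x \<and> E2 u \<sigma> x = E2 s Splus x" if u: "s < u" "u < r" for u \<sigma>
  proof -
    have "E1 r Splus x \<le> E1 u \<sigma> x" "E1 u \<sigma> x \<le> E1 s Splus x"
      "E2 s Splus x \<le> E2 u \<sigma> x" "E2 u \<sigma> x \<le> E2 r Splus x"
      using sr u by (auto intro!: E1_antimono E2_mono simp: sided_le_def)
    then show ?thesis using sr u by (simp add: h_eq)
  qed
  then show ?thesis using sr by blast
qed

text \<open>Unit increments are monotone up to sign, and sums and negatives of signed measures reach
  all pairs. Existence matters because \<open>busemann_measure\<close> is defined by choice.\<close>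

lemma ex_stieltjes:
  assumes "0 < s0" "s0 < r0" "r0 < 1"
  shows "\<exists>\<nu>. stieltjes_on s0 r0 (\<lambda>t. b (dir t) Sminus x y) (\<lambda>t. b (dir t) Splus x y) \<nu>"
proof (induction x y rule: lattice_pair_induct)
  case (1 x)
  have "\<exists>\<nu>. stieltjes_on s0 r0 (\<lambda>t. - E1 t Sminus x) (\<lambda>t. - E1 t Splus x) \<nu>"
    using assms mono_e1 by (intro ex_stieltjes_on_if_mono tendsto_minus left right) auto
  then obtain \<nu> where "stieltjes_on s0 r0 (\<lambda>t. - E1 t Sminus x) (\<lambda>t. - E1 t Splus x) \<nu>" ..
  from stieltjes_on_uminus[OF this] show ?case by auto
next
  case (2 x)
  show ?case
    using assms mono_e2 by (intro ex_stieltjes_on_if_mono left right) auto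
next
  case (3 x y)
  then obtain \<nu> where "stieltjes_on s0 r0 (\<lambda>t. b (dir t) Sminus x y) (\<lambda>t. b (dir t) Splus x y) \<nu>" ..
  from stieltjes_on_uminus[OF this] have
    "stieltjes_on s0 r0 (\<lambda>t. b (dir t) Sminus y x) (\<lambda>t. b (dir t) Splus y x) (\<lambda>A. - \<nu> A)"
    by (rule stieltjes_on_cong) (use assms b_sym[where x = x and y = y] in auto)
  then show ?case by blast
next
  case (4 x y z)
  then obtain \<nu> \<nu>' where "stieltjes_on s0 r0 (\<lambda>t. b (dir t) Sminus x y) (\<lambda>t. b (dir t) Splus x y) \<nu>"
    "stieltjes_on s0 r0 (\<lambda>t. b (dir t) Sminus y z) (\<lambda>t. b (dir t) Splus y z) \<nu>'" by blast
  from stieltjes_on_add[OF this] have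
    "stieltjes_on s0 r0 (\<lambda>t. b (dir t) Sminus x z) (\<lambda>t. b (dir t) Splus x z) (\<lambda>A. \<nu> A + \<nu>' A)"
    by (rule stieltjes_on_cong) (use assms cocycle in auto)
  then show ?case by blast
qed

lemma stieltjes_busemann_measure:
  assumes "0 < s0" "s0 < r0" "r0 < 1"
  shows "stieltjes_on s0 r0 (\<lambda>t. b (dir t) Sminus x y) (\<lambda>t. b (dir t) Splus x y)
    (busemann_measure b x y (dir_cc (dir s0) (dir r0)))"
proof -
  define K where "K = dir_cc (dir s0) (dir r0)"
  have K: "K = dir ` {s0..r0}" using assms by (simp add: K_def dir_intervals)
  have sub: "dir ` {s..r} \<subseteq> K \<longleftrightarrow> s0 \<le> s \<and> r \<le> r0" if "s < r" for s r
    unfolding K inj_image_subset_iff[OF inj_dir] using that by auto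
  define spec where "spec \<nu> \<longleftrightarrow> signed_measure_on K \<nu> \<and>
     (\<forall>\<zeta> \<eta>. \<zeta> \<prec>\<^sub>1 \<eta> \<and> \<zeta> \<in> ri_dirs \<and> \<eta> \<in> ri_dirs \<and> dir_cc \<zeta> \<eta> \<subseteq> K \<longrightarrow>
        \<nu> (dir_oc \<zeta> \<eta>) = b \<eta> Splus x y - b \<zeta> Splus x y \<and>
        \<nu> (dir_co \<zeta> \<eta>) = b \<eta> Sminus x y - b \<zeta> Sminus x y)" for \<nu>
  have spec_iff: "spec \<nu> \<longleftrightarrow>
      stieltjes_on s0 r0 (\<lambda>t. b (dir t) Sminus x y) (\<lambda>t. b (dir t) Splus x y) \<nu>" for \<nu>
  proof -
    have "spec \<nu> \<longleftrightarrow> signed_measure_on K \<nu> \<and> (\<forall>s r. s < r \<and> 0 < s \<and> r < 1 \<and> s0 \<le> s \<and> r \<le> r0 \<longrightarrow>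
        \<nu> (dir ` {s<..r}) = b (dir r) Splus x y - b (dir s) Splus x y \<and>
        \<nu> (dir ` {s..<r}) = b (dir r) Sminus x y - b (dir s) Sminus x y)"
      (is "_ \<longleftrightarrow> _ \<and> ?R")
    proof -
      define Q where "Q \<zeta> \<eta> \<longleftrightarrow> (\<zeta> \<prec>\<^sub>1 \<eta> \<and> dir_cc \<zeta> \<eta> \<subseteq> K \<longrightarrow>
          \<nu> (dir_oc \<zeta> \<eta>) = b \<eta> Splus x y - b \<zeta> Splus x y \<and>
          \<nu> (dir_co \<zeta> \<eta>) = b \<eta> Sminus x y - b \<zeta> Sminus x y)" for \<zeta> \<eta>
      have "spec \<nu> \<longleftrightarrow> signed_measure_on K \<nu> \<and> (\<forall>\<zeta>\<in>ri_dirs. \<forall>\<eta>\<in>ri_dirs. Q \<zeta> \<eta>)"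
        unfolding spec_def Q_def by blast
      moreover have "(\<forall>\<zeta>\<in>ri_dirs. \<forall>\<eta>\<in>ri_dirs. Q \<zeta> \<eta>) \<longleftrightarrow> (\<forall>s\<in>{0<..<1}. \<forall>r\<in>{0<..<1}. Q (dir s) (dir r))"
        unfolding ri_dirs_eq by blast
      moreover have "\<dots> \<longleftrightarrow> ?R"
        using sub unfolding Q_def by (auto simp: dir_intervals)
      ultimately show ?thesis by simp
    qed
    then show ?thesis using assms by (auto simp: stieltjes_on_def K)
  qed
  have "spec (SOME \<nu>. spec \<nu>)"
    using ex_stieltjes[OF assms] spec_iff by (metis someI_ex)
  moreover have "busemann_measure b x y K = (SOME \<nu>. spec \<nu>)"
    by (simp add: busemann_measure_def spec_def)
  ultimately show ?thesis using spec_iff by (simp add: K_def)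
qed

lemma busemann_supp_eq:
  "busemann_supp b x y = (\<Union>s0\<in>{0<..<1}. \<Union>r0\<in>{s0<..<1}.
     signed_support (dir ` {s0..r0}) (busemann_measure b x y (dir_cc (dir s0) (dir r0))))"
proof -
  have "busemann_supp b x y = (\<Union>s0\<in>{0<..<1}. \<Union>r0\<in>{s0<..<1}.
     signed_support (dir_cc (dir s0) (dir r0)) (busemann_measure b x y (dir_cc (dir s0) (dir r0))))"
    (is "_ = (\<Union>s0\<in>_. \<Union>r0\<in>_. ?F (dir s0) (dir r0))")
  proof (intro equalityI subsetI)
    fix \<xi> assume "\<xi> \<in> busemann_supp b x y"
    then obtain \<zeta> \<eta> where "\<zeta> \<in> ri_dirs" "\<eta> \<in> ri_dirs" "\<zeta> \<prec>\<^sub>1 \<eta>" and \<xi>: "\<xi> \<in> ?F \<zeta> \<eta>"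
      unfolding busemann_supp_def by blast
    then obtain s0 r0 where "\<zeta> = dir s0" "\<eta> = dir r0" "0 < s0" "s0 < r0" "r0 < 1"
      unfolding ri_dirs_eq by auto
    with \<xi> show "\<xi> \<in> (\<Union>s0\<in>{0<..<1}. \<Union>r0\<in>{s0<..<1}. ?F (dir s0) (dir r0))"
      by (intro UN_I[of s0] UN_I[of r0]) simp_all
  next
    fix \<xi> assume "\<xi> \<in> (\<Union>s0\<in>{0<..<1}. \<Union>r0\<in>{s0<..<1}. ?F (dir s0) (dir r0))"
    then obtain s0 r0 where "0 < s0" "s0 < r0" "r0 < 1" "\<xi> \<in> ?F (dir s0) (dir r0)" by auto
    then show "\<xi> \<in> busemann_supp b x y"
      unfolding busemann_supp_def by (intro UnionI[of "?F (dir s0) (dir r0)"] CollectI exI conjI) (rule refl, simp_all)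
  qed
  also have "\<dots> = (\<Union>s0\<in>{0<..<1}. \<Union>r0\<in>{s0<..<1}.
     signed_support (dir ` {s0..r0}) (busemann_measure b x y (dir_cc (dir s0) (dir r0))))"
    by (intro SUP_cong refl) (simp add: dir_intervals)
  finally show ?thesis .
qed

lemma busemann_supp_subset: "busemann_supp b x y \<subseteq> dir ` {0<..<1}"
proof
  fix \<xi> assume "\<xi> \<in> busemann_supp b x y"
  then obtain s0 r0 where sr: "0 < s0" "s0 < r0" "r0 < 1"
    "\<xi> \<in> signed_support (dir ` {s0..r0}) (busemann_measure b x y (dir_cc (dir s0) (dir r0)))"
    unfolding busemann_supp_eq by auto
  then have "\<xi> \<in> dir ` {s0..r0}"
    using signed_support_subset[OF stieltjes_busemann_measure[OF sr(1-3)]] by blast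
  then show "\<xi> \<in> dir ` {0<..<1}" using sr by auto
qed

lemma notin_busemann_supp:
  assumes "0 < s" "s < t" "t < r" "r < 1"
    "\<And>u \<sigma>. s < u \<Longrightarrow> u < r \<Longrightarrow> b (dir u) \<sigma> x y = c"
  shows "dir t \<notin> busemann_supp b x y"
proof
  assume "dir t \<in> busemann_supp b x y"
  then obtain s0 r0 where sr: "0 < s0" "s0 < r0" "r0 < 1"
    "dir t \<in> signed_support (dir ` {s0..r0}) (busemann_measure b x y (dir_cc (dir s0) (dir r0)))"
    unfolding busemann_supp_eq by auto
  show False
    using notin_signed_support_if_constant[OF stieltjes_busemann_measure[OF sr(1-3)] sr(2), of s r x y c t]
      assms sr(4) by auto
qed

lemma busemann_supp_iff: "dir t \<in> busemann_supp b (x + e1) (x + e2) \<longleftrightarrow> unst x t"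
proof
  assume supp: "dir t \<in> busemann_supp b (x + e1) (x + e2)"
  then have t: "0 < t" "t < 1" using busemann_supp_subset by fastforce+
  show "unst x t"
  proof (rule ccontr)
    assume "\<not> unst x t"
    from locally_constant_if_stable[OF this t] obtain s r c1 c2 where sr: "0 < s" "s < t" "t < r" "r < 1"
      and c: "\<forall>u \<sigma>. s < u \<and> u < r \<longrightarrow> E1 u \<sigma> x = c1 \<and> E2 u \<sigma> x = c2" by blast
    have "b (dir u) \<sigma> (x + e1) (x + e2) = c2 - c1" if "s < u" "u < r" for u \<sigma>
      using h_eq[of u \<sigma> x] c that sr by (simp add: h_def)
    from notin_busemann_supp[OF sr this] supp show False by blast
  qed
next
  assume unst: "unst x t"
  then have t: "0 < t" "t < 1" by (auto simp: unst_def)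
  define s0 r0 where "s0 = t / 2" and "r0 = (t + 1) / 2"
  have sr: "0 < s0" "s0 < t" "t < r0" "r0 < 1" using t by (auto simp: s0_def r0_def)
  have "dir t \<in> signed_support (dir ` {s0..r0})
      (busemann_measure b (x + e1) (x + e2) (dir_cc (dir s0) (dir r0)))"
  proof (rule in_signed_support_if_increasing)
    show "stieltjes_on s0 r0 (\<lambda>t. b (dir t) Sminus (x + e1) (x + e2)) (\<lambda>t. b (dir t) Splus (x + e1) (x + e2))
      (busemann_measure b (x + e1) (x + e2) (dir_cc (dir s0) (dir r0)))"
      using sr by (intro stieltjes_busemann_measure) auto
  next
    fix s r assume "s0 < s" "s < t" "t < r" "r < r0"
    then have "h s Splus x < h r Splus x" using unst sr by (auto simp: unst_def)
    then show "b (dir s) Splus (x + e1) (x + e2) \<noteq> b (dir r) Splus (x + e1) (x + e2)"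
      by (simp add: h_def)
  qed (use sr in auto)
  then show "dir t \<in> busemann_supp b (x + e1) (x + e2)"
    unfolding busemann_supp_eq using sr by force
qed

text \<open>If no dual point were unstable at \<open>t\<close>, all unit increments would be
  constant near \<open>t\<close>, and along a lattice path the finitely many neighbourhoods
  intersect.\<close>

lemma ex_unst_if_supp:
  assumes "dir t \<in> busemann_supp b x y"
  shows "\<exists>z. unst z t"
proof (rule ccontr)
  assume "\<not> ?thesis"
  moreover have t: "0 < t" "t < 1" using assms busemann_supp_subset by fastforce+
  ultimately have loc: "\<exists>s r c1 c2. 0 < s \<and> s < t \<and> t < r \<and> r < 1 \<and>
      (\<forall>u \<sigma>. s < u \<and> u < r \<longrightarrow> E1 u \<sigma> z = c1 \<and> E2 u \<sigma> z = c2)" for z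
    using locally_constant_if_stable by blast
  have "\<exists>s r c. 0 < s \<and> s < t \<and> t < r \<and> r < 1 \<and> (\<forall>u \<sigma>. s < u \<and> u < r \<longrightarrow> b (dir u) \<sigma> x y = c)"
  proof (induction x y rule: lattice_pair_induct)
    case (1 x)
    then show ?case using loc[of x] by blast
  next
    case (2 x)
    then show ?case using loc[of x] by blast
  next
    case (3 x y)
    then obtain s r c where sr: "0 < s" "s < t" "t < r" "r < 1"
      and c: "\<forall>u \<sigma>. s < u \<and> u < r \<longrightarrow> b (dir u) \<sigma> x y = c" by blast
    have "\<forall>u \<sigma>. s < u \<and> u < r \<longrightarrow> b (dir u) \<sigma> y x = - c"
      using c sr by (auto simp: b_sym[where x = x and y = y])
    then show ?case using sr by blast
  next
    case (4 x y z)
    then obtain s r c s' r' c' where sr: "0 < s" "s < t" "t < r" "r < 1" "0 < s'" "s' < t" "t < r'" "r' < 1"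
      and c: "\<forall>u \<sigma>. s < u \<and> u < r \<longrightarrow> b (dir u) \<sigma> x y = c"
        "\<forall>u \<sigma>. s' < u \<and> u < r' \<longrightarrow> b (dir u) \<sigma> y z = c'" by blast
    have "\<forall>u \<sigma>. max s s' < u \<and> u < min r r' \<longrightarrow> b (dir u) \<sigma> x z = c + c'"
      using c sr by (auto simp: cocycle[where x = x and y = y and z = z, symmetric])
    moreover have "0 < max s s'" "max s s' < t" "t < min r r'" "min r r' < 1" using sr by auto
    ultimately show ?case by blast
  qed
  then show False using notin_busemann_supp assms by blast
qed

lemma exceptional_dirs_eq: "exceptional_dirs b = {dir t | t z. unst z t}"
proof (intro equalityI subsetI)
  fix \<xi> assume "\<xi> \<in> exceptional_dirs b"
  then obtain x y where "\<xi> \<in> busemann_supp b x y" by (auto simp: exceptional_dirs_def)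
  moreover from this obtain t where "\<xi> = dir t" using busemann_supp_subset by blast
  ultimately show "\<xi> \<in> {dir t | t z. unst z t}" using ex_unst_if_supp by blast
next
  fix \<xi> assume "\<xi> \<in> {dir t | t z. unst z t}"
  then show "\<xi> \<in> exceptional_dirs b" unfolding exceptional_dirs_def using busemann_supp_iff by blast
qed

end

section \<open>The instability graph\<close>

context busemann_realization
begin

definition is_crossing :: "int \<times> int \<Rightarrow> real \<Rightarrow> bool" where
  "is_crossing x c \<longleftrightarrow> 0 < c \<and> c < 1 \<and>
     (\<forall>s \<sigma>. 0 < s \<and> s < 1 \<longrightarrow> (s < c \<longrightarrow> h s \<sigma> x < 0) \<and> (c < s \<longrightarrow> 0 < h s \<sigma> x))"

lemma is_crossing_unique: "is_crossing x c \<Longrightarrow> is_crossing x c' \<Longrightarrow> c = c'"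
proof (rule ccontr)
  assume *: "is_crossing x c" "is_crossing x c'" "c \<noteq> c'"
  define s where "s = (c + c') / 2"
  have "0 < s" "s < 1" using * by (auto simp: is_crossing_def s_def)
  moreover have "s < c \<and> c' < s \<or> s < c' \<and> c < s" using *(3) by (auto simp: s_def)
  ultimately show False using * unfolding is_crossing_def by (metis order_less_asym)
qed

text \<open>The supremum of the directions where \<open>h\<close> is negative; the behaviour at the
  end points of the direction segment makes it lie strictly inside.\<close>

lemma ex_is_crossing: "\<exists>c. is_crossing x c"
proof -
  define A where "A = {t. 0 < t \<and> t < 1 \<and> h t Splus x < 0}"
  obtain t1 where t1: "0 < t1" "t1 < 1" "w x < E1 t1 Splus x" using ex_e1 by blast
  then have "h t1 Splus x < 0" using min_eq[of t1 Splus x] by (auto simp: h_eq min_def split: if_splits)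
  then have "t1 \<in> A" using t1 by (simp add: A_def)
  obtain t2 where t2: "0 < t2" "t2 < 1" "w x < E2 t2 Splus x" using ex_e2 by blast
  then have h2: "0 < h t2 Splus x" using min_eq[of t2 Splus x] by (auto simp: h_eq min_def split: if_splits)
  have below: "t \<le> t2" if "t \<in> A" for t
  proof (rule ccontr)
    assume "\<not> t \<le> t2"
    then have "h t2 Splus x \<le> h t Splus x"
      using that t2 by (intro h_mono) (auto simp: A_def sided_le_def)
    with h2 that show False by (simp add: A_def)
  qed
  then have bdd: "bdd_above A" by (auto simp: bdd_above_def)
  define c where "c = Sup A"
  have "t1 \<le> c" unfolding c_def using \<open>t1 \<in> A\<close> bdd by (rule cSup_upper)
  moreover have "c \<le> t2" unfolding c_def using \<open>t1 \<in> A\<close> below by (intro cSup_least) auto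
  moreover have "h s \<sigma> x < 0" if s: "0 < s" "s < c" for s \<sigma>
  proof -
    obtain u where "u \<in> A" "s < u" using s less_cSup_iff[of A s] \<open>t1 \<in> A\<close> bdd unfolding c_def by auto
    then have "h s \<sigma> x \<le> h u Splus x" using s by (intro h_mono) (auto simp: A_def sided_le_def)
    with \<open>u \<in> A\<close> show ?thesis by (simp add: A_def)
  qed
  moreover have "0 < h s \<sigma> x" if s: "c < s" "s < 1" for s \<sigma>
  proof -
    \<comment> \<open>Above the supremum \<open>h\<close> is only known to be nonnegative; a
      rational parameter, where there is no tie, makes it strictly positive from there on.\<close>
    obtain q where q: "q \<in> \<rat>" "c < q" "q < s" using s(1) Rats_dense_in_real by blast
    have q01: "0 < q" "q < 1" using q s \<open>t1 \<le> c\<close> t1 by auto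
    have "q \<notin> A" using q(2) cSup_upper[OF _ bdd, of q] by (auto simp: c_def)
    then have "0 \<le> h q Splus x" using q01 by (auto simp: A_def)
    moreover have "h q Splus x \<noteq> 0" using no_tie[OF q(1) q01, of x] by (simp add: h_eq q01)
    moreover have "h q Splus x \<le> h s \<sigma> x" using q q01 s by (intro h_mono) (auto simp: sided_le_def)
    ultimately show ?thesis by simp
  qed
  ultimately have "is_crossing x c" using t1 t2 by (auto simp: is_crossing_def)
  then show ?thesis ..
qed

text \<open>The competition interface direction seen from \<open>x\<close>, see
  \<open>competition_direction_eq\<close>.\<close>

definition cd :: "int \<times> int \<Rightarrow> real" where
  "cd x = (THE c. is_crossing x c)"

lemma is_crossing_cd: "is_crossing x (cd x)"
  unfolding cd_def using ex_is_crossing is_crossing_unique by (metis the_equality)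

lemma cd_bounds: "0 < cd x" "cd x < 1"
  using is_crossing_cd[of x] by (auto simp: is_crossing_def)

lemma h_neg: "0 < s \<Longrightarrow> s < cd x \<Longrightarrow> h s \<sigma> x < 0"
  and h_pos: "cd x < s \<Longrightarrow> s < 1 \<Longrightarrow> 0 < h s \<sigma> x"
  using is_crossing_cd[of x] cd_bounds[of x] by (auto simp: is_crossing_def)

lemma competition_direction_eq:
  assumes "\<And>t \<sigma>. 0 < t \<Longrightarrow> t < 1 \<Longrightarrow> b' (dir t) \<sigma> e1 e2 = h t \<sigma> x"
  shows "competition_direction b' = dir (cd x)"
proof -
  have "(\<forall>\<zeta>\<in>ri_dirs. \<forall>\<sigma>. (\<zeta> \<prec>\<^sub>1 dir c \<longrightarrow> b' \<zeta> \<sigma> e1 e2 < 0) \<and> (dir c \<prec>\<^sub>1 \<zeta> \<longrightarrow> b' \<zeta> \<sigma> e1 e2 > 0)) \<longleftrightarrow>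
      (\<forall>s \<sigma>. 0 < s \<and> s < 1 \<longrightarrow> (s < c \<longrightarrow> h s \<sigma> x < 0) \<and> (c < s \<longrightarrow> 0 < h s \<sigma> x))" for c
    unfolding ri_dirs_eq using assms by auto
  then have *: "dir c \<in> ri_dirs \<and>
     (\<forall>\<zeta>\<in>ri_dirs. \<forall>\<sigma>. (\<zeta> \<prec>\<^sub>1 dir c \<longrightarrow> b' \<zeta> \<sigma> e1 e2 < 0) \<and> (dir c \<prec>\<^sub>1 \<zeta> \<longrightarrow> b' \<zeta> \<sigma> e1 e2 > 0)) \<longleftrightarrow>
     is_crossing x c" for c
    by (simp add: is_crossing_def)
  show ?thesis
    unfolding competition_direction_def
  proof (rule the_equality)
    fix \<xi> assume \<xi>: "\<xi> \<in> ri_dirs \<and> (\<forall>\<zeta>\<in>ri_dirs. \<forall>\<sigma>. (\<zeta> \<prec>\<^sub>1 \<xi> \<longrightarrow> b' \<zeta> \<sigma> e1 e2 < 0) \<and> (\<xi> \<prec>\<^sub>1 \<zeta> \<longrightarrow> b' \<zeta> \<sigma> e1 e2 > 0))"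
    then obtain c where "\<xi> = dir c" by (auto simp: ri_dirs_eq)
    with \<xi> *[of c] is_crossing_unique[OF is_crossing_cd] show "\<xi> = dir (cd x)" by auto
  qed (use * is_crossing_cd in blast)
qed

lemma h_left: "0 < t \<Longrightarrow> t < 1 \<Longrightarrow> ((\<lambda>s. h s \<sigma> x) \<longlongrightarrow> h t Sminus x) (at_left t)"
  and h_right: "0 < t \<Longrightarrow> t < 1 \<Longrightarrow> ((\<lambda>s. h s \<sigma> x) \<longlongrightarrow> h t Splus x) (at_right t)"
  unfolding h_def by (rule left right; assumption)+

lemma h_cd_plus: "0 \<le> h (cd x) Splus x"
proof (rule tendsto_lowerbound[OF h_right[OF cd_bounds, of Splus]])
  show "\<forall>\<^sub>F s in at_right (cd x). 0 \<le> h s Splus x"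
    using eventually_at_right_real[OF cd_bounds(2)[of x]] by eventually_elim (auto intro: less_imp_le h_pos)
qed simp

lemma h_cd_minus: "h (cd x) Sminus x \<le> 0"
proof (rule tendsto_upperbound[OF h_left[OF cd_bounds, of Splus]])
  show "\<forall>\<^sub>F s in at_left (cd x). h s Splus x \<le> 0"
    using eventually_at_left_real[OF cd_bounds(1)[of x]] by eventually_elim (auto intro: less_imp_le h_neg)
qed simp

lemma cd_le_if_st: "0 < t \<Longrightarrow> st t \<sigma> x \<Longrightarrow> cd x \<le> t"
  using h_neg[of t x \<sigma>] by (fastforce simp: st_def)

lemma le_cd_if_not_st: "t < 1 \<Longrightarrow> \<not> st t \<sigma> x \<Longrightarrow> t \<le> cd x"
  using h_pos[of x t \<sigma>] by (fastforce simp: st_def)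

text \<open>The only delicate case is \<open>t = cd x\<close>: the right limit is nonnegative there,
  and a tie with sign plus still goes to \<open>e1\<close>. For sign minus the same direction gives
  \<open>e2\<close>.\<close>

lemma st_plus_iff:
  assumes "0 < t" "t < 1"
  shows "st t Splus x \<longleftrightarrow> cd x \<le> t"
proof
  assume "cd x \<le> t"
  then have "0 \<le> h t Splus x"
    using h_pos[of x t Splus] h_cd_plus[of x] assms by (cases "cd x < t") (simp_all add: order_le_less)
  then show "st t Splus x" by (auto simp: st_def)
qed (use cd_le_if_st assms in blast)

lemma st_minus_iff:
  assumes "0 < t" "t < 1"
  shows "\<not> st t Sminus x \<longleftrightarrow> t \<le> cd x"
proof
  assume "t \<le> cd x"
  then have "h t Sminus x \<le> 0"
    using h_neg[of t x Sminus] h_cd_minus[of x] assms by (cases "t < cd x") (simp_all add: order_le_less)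
  then show "\<not> st t Sminus x" by (simp add: st_def)
qed (use le_cd_if_not_st assms in blast)

lemma unst_bounds: "unst x t \<Longrightarrow> 0 < t \<and> t < 1"
  by (simp add: unst_def)

lemma unst_cd: "unst x (cd x)"
  unfolding unst_def
proof (intro conjI allI impI)
  fix s r assume "0 < s" "s < cd x" "cd x < r" "r < 1"
  then show "h s Splus x < h r Splus x" using h_neg[of s x Splus] h_pos[of x r Splus] by linarith
qed (rule cd_bounds)+

text \<open>By \<open>h_eq'\<close>, \<open>h\<close> at \<open>z\<close> is \<open>E2\<close> at
  \<open>z + e1\<close> minus \<open>E1\<close> at \<open>z + e2\<close>; the second part is
  nonincreasing and cannot cancel an increase of the first.\<close>

lemma unst_from_E2:
  assumes "0 < t" "t < 1" "\<And>s r. 0 < s \<Longrightarrow> s < t \<Longrightarrow> t < r \<Longrightarrow> r < 1 \<Longrightarrow> E2 s Splus (z + e1) < E2 r Splus (z + e1)"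
  shows "unst z t"
  unfolding unst_def
proof (intro conjI allI impI)
  fix s r assume sr: "0 < s" "s < t" "t < r" "r < 1"
  then have "E2 s Splus (z + e1) < E2 r Splus (z + e1)" by (rule assms(3))
  moreover have "E1 r Splus (z + e2) \<le> E1 s Splus (z + e2)"
    using sr by (intro E1_antimono) (auto simp: sided_le_def)
  ultimately show "h s Splus z < h r Splus z" using sr by (simp add: h_eq')
qed (use assms in auto)

lemma unst_from_E1:
  assumes "0 < t" "t < 1" "\<And>s r. 0 < s \<Longrightarrow> s < t \<Longrightarrow> t < r \<Longrightarrow> r < 1 \<Longrightarrow> E1 r Splus (z + e2) < E1 s Splus (z + e2)"
  shows "unst z t"
  unfolding unst_def
proof (intro conjI allI impI)
  fix s r assume sr: "0 < s" "s < t" "t < r" "r < 1"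
  then have "E1 r Splus (z + e2) < E1 s Splus (z + e2)" by (rule assms(3))
  moreover have "E2 s Splus (z + e1) \<le> E2 r Splus (z + e1)"
    using sr by (intro E2_mono) (auto simp: sided_le_def)
  ultimately show "h s Splus z < h r Splus z" using sr by (simp add: h_eq')
qed (use assms in auto)

text \<open>Above \<open>cd x\<close> the increment \<open>E1\<close> at \<open>x\<close> is stuck
  at the weight, so an increase of \<open>h\<close> at \<open>t\<close> is one of \<open>E2\<close>,
  which enters the increment of the dual point below. If \<open>cd x = t\<close>, then
  \<open>E2\<close> leaves the weight exactly at \<open>t\<close>.\<close>

lemma unst_forward1:
  assumes "unst x t" "cd x \<le> t"
  shows "unst (x - e1) t"
proof (rule unst_from_E2)
  fix s r assume sr: "0 < s" "s < t" "t < r" "r < 1"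
  show "E2 s Splus (x - e1 + e1) < E2 r Splus (x - e1 + e1)"
  proof (cases "cd x = t")
    case True
    have "h s Splus x < 0" "0 < h r Splus x" using sr True h_neg h_pos by auto
    then show ?thesis
      using E2_eq_if_h_nonpos[of s Splus x] E1_eq_if_h_nonneg[of r Splus x] sr by (simp add: h_eq)
  next
    case False
    define s' where "s' = max s ((cd x + t) / 2)"
    have s': "0 < s'" "s' < t" "cd x < s'" "s \<le> s'" using False assms(2) sr by (auto simp: s'_def less_max_iff_disj)
    have "h s' Splus x < h r Splus x" using assms(1) s' sr by (simp add: unst_def)
    moreover have "E1 s' Splus x = w x" "E1 r Splus x = w x"
      using E1_eq_if_h_nonneg[of s' Splus x] E1_eq_if_h_nonneg[of r Splus x] h_pos[of x s' Splus] h_pos[of x r Splus] s' sr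
      by auto
    moreover have "E2 s Splus x \<le> E2 s' Splus x"
      using s' sr by (intro E2_mono) (auto simp: sided_le_def)
    ultimately show ?thesis using s' sr by (simp add: h_eq)
  qed
qed (use assms unst_bounds in auto)

lemma unst_forward2:
  assumes "unst x t" "t \<le> cd x"
  shows "unst (x - e2) t"
proof (rule unst_from_E1)
  fix s r assume sr: "0 < s" "s < t" "t < r" "r < 1"
  show "E1 r Splus (x - e2 + e2) < E1 s Splus (x - e2 + e2)"
  proof (cases "cd x = t")
    case True
    have "h s Splus x < 0" "0 < h r Splus x" using sr True h_neg h_pos by auto
    then show ?thesis
      using E2_eq_if_h_nonpos[of s Splus x] E1_eq_if_h_nonneg[of r Splus x] sr by (simp add: h_eq)
  next
    case False
    define r' where "r' = min r ((cd x + t) / 2)"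
    have r': "t < r'" "r' < cd x" "r' \<le> r" "r' < 1" using False assms(2) sr by (auto simp: r'_def min_less_iff_disj)
    have "h s Splus x < h r' Splus x" using assms(1) r' sr by (simp add: unst_def)
    moreover have "E2 s Splus x = w x" "E2 r' Splus x = w x"
      using E2_eq_if_h_nonpos[of s Splus x] E2_eq_if_h_nonpos[of r' Splus x] h_neg[of s x Splus] h_neg[of r' x Splus] r' sr
      by auto
    moreover have "E1 r Splus x \<le> E1 r' Splus x"
      using r' sr by (intro E1_antimono) (auto simp: sided_le_def)
    ultimately show ?thesis using r' sr by (simp add: h_eq)
  qed
qed (use assms unst_bounds in auto)

text \<open>By \<open>h_eq'\<close>, an increase of \<open>h\<close> at \<open>x\<close> comes from
  \<open>E2\<close> at \<open>x + e1\<close> or from \<open>E1\<close> at \<open>x + e2\<close>. In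
  the first case that predecessor is unstable, and its \<open>cd\<close> is at most \<open>t\<close>
  because \<open>E2\<close> equals its minimal value, the weight, below \<open>cd\<close>; the
  second case is symmetric.\<close>

lemma unst_backward:
  assumes "unst x t"
  shows "unst (x + e1) t \<and> cd (x + e1) \<le> t \<or> unst (x + e2) t \<and> t \<le> cd (x + e2)"
proof -
  have t: "0 < t" "t < 1" using unst_bounds[OF assms] by auto
  consider (E2) "\<And>s r. 0 < s \<Longrightarrow> s < t \<Longrightarrow> t < r \<Longrightarrow> r < 1 \<Longrightarrow> E2 s Splus (x + e1) < E2 r Splus (x + e1)"
    | (E1) "\<And>s r. 0 < s \<Longrightarrow> s < t \<Longrightarrow> t < r \<Longrightarrow> r < 1 \<Longrightarrow> E1 r Splus (x + e2) < E1 s Splus (x + e2)"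
  proof (rule ccontr)
    assume "\<not> thesis"
    with that obtain s r s' r' where sr: "0 < s" "s < t" "t < r" "r < 1" "E2 r Splus (x + e1) \<le> E2 s Splus (x + e1)"
      and s'r': "0 < s'" "s' < t" "t < r'" "r' < 1" "E1 s' Splus (x + e2) \<le> E1 r' Splus (x + e2)"
      by (metis not_less)
    define s0 r0 where "s0 = max s s'" and "r0 = min r r'"
    have *: "0 < s0" "s0 < t" "t < r0" "r0 < 1" "s \<le> s0" "s' \<le> s0" "r0 \<le> r" "r0 \<le> r'"
      using sr s'r' by (auto simp: s0_def r0_def)
    have "E2 s Splus (x + e1) \<le> E2 s0 Splus (x + e1)" "E2 r0 Splus (x + e1) \<le> E2 r Splus (x + e1)"
      "E1 s0 Splus (x + e2) \<le> E1 s' Splus (x + e2)" "E1 r' Splus (x + e2) \<le> E1 r0 Splus (x + e2)"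
      using * sr s'r' by (auto intro!: E1_antimono E2_mono simp: sided_le_def)
    moreover have "h s0 Splus x < h r0 Splus x" using assms * by (simp add: unst_def)
    ultimately show False using sr s'r' * by (simp add: h_eq')
  qed
  then show ?thesis
  proof cases
    case E2
    have "unst (x + e1) t"
      unfolding unst_def
    proof (intro conjI allI impI)
      fix s r assume sr: "0 < s" "s < t" "t < r" "r < 1"
      then have "E2 s Splus (x + e1) < E2 r Splus (x + e1)" by (rule E2)
      moreover have "E1 r Splus (x + e1) \<le> E1 s Splus (x + e1)"
        using sr by (intro E1_antimono) (auto simp: sided_le_def)
      ultimately show "h s Splus (x + e1) < h r Splus (x + e1)" using sr by (simp add: h_eq)
    qed (use t in auto)
    moreover have "cd (x + e1) \<le> r" if r: "t < r" "r < 1" for r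
    proof (rule ccontr)
      assume "\<not> cd (x + e1) \<le> r"
      then have "E2 r Splus (x + e1) = w (x + e1)"
        using h_neg[of r "x + e1" Splus] r t by (intro E2_eq_if_h_nonpos) auto
      moreover have "w (x + e1) \<le> E2 (t / 2) Splus (x + e1)" using t by (intro w_le) auto
      moreover have "E2 (t / 2) Splus (x + e1) < E2 r Splus (x + e1)" using r t by (intro E2) auto
      ultimately show False by simp
    qed
    then have "cd (x + e1) \<le> t" using t by (meson dense_ge_bounded)
    ultimately show ?thesis by simp
  next
    case E1
    have "unst (x + e2) t"
      unfolding unst_def
    proof (intro conjI allI impI)
      fix s r assume sr: "0 < s" "s < t" "t < r" "r < 1"
      then have "E1 r Splus (x + e2) < E1 s Splus (x + e2)" by (rule E1)
      moreover have "E2 s Splus (x + e2) \<le> E2 r Splus (x + e2)"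
        using sr by (intro E2_mono) (auto simp: sided_le_def)
      ultimately show "h s Splus (x + e2) < h r Splus (x + e2)" using sr by (simp add: h_eq)
    qed (use t in auto)
    moreover have "s \<le> cd (x + e2)" if s: "0 < s" "s < t" for s
    proof (rule ccontr)
      assume "\<not> s \<le> cd (x + e2)"
      then have "E1 s Splus (x + e2) = w (x + e2)"
        using h_pos[of "x + e2" s Splus] s t by (intro E1_eq_if_h_nonneg) auto
      moreover have "w (x + e2) \<le> E1 ((t + 1) / 2) Splus (x + e2)" using t by (intro w_le) auto
      moreover have "E1 ((t + 1) / 2) Splus (x + e2) < E1 s Splus (x + e2)" using s t by (intro E1) auto
      ultimately show False by simp
    qed
    then have "t \<le> cd (x + e2)" using t by (meson dense_le_bounded)
    ultimately show ?thesis by simp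
  qed
qed

definition inst :: "real \<Rightarrow> real \<Rightarrow> int \<times> int \<Rightarrow> bool" where
  "inst p q x \<longleftrightarrow> (\<exists>t. p \<le> t \<and> t \<le> q \<and> unst x t)"

text \<open>The instability graph in lattice coordinates, see \<open>instability_edges_iff\<close>.
  Stability is tested only at the source, since the target is then unstable by
  \<open>dedge_inst\<close>.\<close>

definition dedge :: "real \<Rightarrow> real \<Rightarrow> int \<times> int \<Rightarrow> int \<times> int \<Rightarrow> bool" where
  "dedge p q x y \<longleftrightarrow> inst p q x \<and> (y = x - e1 \<and> cd x \<le> q \<or> y = x - e2 \<and> p \<le> cd x)"

text \<open>A support point \<open>t\<close> that would be sent along the other edge satisfies
  \<open>t < cd x\<close>; then \<open>cd x\<close> is itself a support point in the interval, and
  it is passed on along both edges.\<close>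

lemma inst_forward1: "inst p q x \<Longrightarrow> cd x \<le> q \<Longrightarrow> inst p q (x - e1)"
proof -
  assume "inst p q x" "cd x \<le> q"
  then obtain t where t: "p \<le> t" "t \<le> q" "unst x t" by (auto simp: inst_def)
  show ?thesis
  proof (cases "cd x \<le> t")
    case True
    then show ?thesis using t unst_forward1 unfolding inst_def by blast
  next
    case False
    then have "p \<le> cd x" using t by simp
    then show ?thesis using unst_forward1[OF unst_cd order_refl] \<open>cd x \<le> q\<close> unfolding inst_def by blast
  qed
qed

lemma inst_forward2: "inst p q x \<Longrightarrow> p \<le> cd x \<Longrightarrow> inst p q (x - e2)"
proof -
  assume "inst p q x" "p \<le> cd x"
  then obtain t where t: "p \<le> t" "t \<le> q" "unst x t" by (auto simp: inst_def)
  show ?thesis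
  proof (cases "t \<le> cd x")
    case True
    then show ?thesis using t unst_forward2 unfolding inst_def by blast
  next
    case False
    then have "cd x \<le> q" using t by simp
    then show ?thesis using unst_forward2[OF unst_cd order_refl] \<open>p \<le> cd x\<close> unfolding inst_def by blast
  qed
qed

lemma dedge_inst: "dedge p q x y \<Longrightarrow> inst p q x \<and> inst p q y"
  using inst_forward1[of p q x] inst_forward2[of p q x] by (auto simp: dedge_def)

lemma ex_dedge_pred:
  assumes "inst p q x"
  shows "\<exists>y. dedge p q y x"
proof -
  obtain t where t: "p \<le> t" "t \<le> q" "unst x t" using assms by (auto simp: inst_def)
  from unst_backward[OF t(3)] show ?thesis
  proof
    assume "unst (x + e1) t \<and> cd (x + e1) \<le> t"
    then have "dedge p q (x + e1) x" using t by (auto simp: dedge_def inst_def)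
    then show ?thesis ..
  next
    assume "unst (x + e2) t \<and> t \<le> cd (x + e2)"
    then have "dedge p q (x + e2) x" using t by (auto simp: dedge_def inst_def)
    then show ?thesis ..
  qed
qed

lemma dedge_level: "dedge p q x y \<Longrightarrow> level y = level x - 1"
  by (auto simp: dedge_def lattice_defs)

lemma dedge_le: "dedge p q x y \<Longrightarrow> y \<le> x"
  by (auto simp: dedge_def lattice_defs less_eq_prod_def)

lemma dedge_fst: "dedge p q x y \<Longrightarrow> fst y \<le> fst x \<and> fst x \<le> fst y + 1"
  by (auto simp: dedge_def lattice_defs)

lemma dedge_rtranclp_level: "(dedge p q)\<^sup>*\<^sup>* x y \<Longrightarrow> level y \<le> level x \<and> (level x = level y \<longrightarrow> x = y)"
proof (induction rule: rtranclp_induct)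
  case (step y z)
  then show ?case using dedge_level[OF step(2)] by linarith
qed simp

lemma dedge_rtranclp_le: "(dedge p q)\<^sup>*\<^sup>* x y \<Longrightarrow> y \<le> x"
proof (induction rule: rtranclp_induct)
  case (step y z)
  then show ?case using dedge_le[OF step(2)] by (blast intro: order_trans)
qed simp

lemma dedge_one_step: "(dedge p q)\<^sup>+\<^sup>+ x y \<Longrightarrow> level y = level x - 1 \<Longrightarrow> dedge p q x y"
proof -
  assume *: "(dedge p q)\<^sup>+\<^sup>+ x y" "level y = level x - 1"
  then obtain z where z: "dedge p q x z" "(dedge p q)\<^sup>*\<^sup>* z y" by (meson tranclpD)
  then have "z = y" using dedge_rtranclp_level[OF z(2)] dedge_level[OF z(1)] *(2) by auto
  with z show ?thesis by simp
qed

text \<open>An edge lowers the level by one, so ancestry across one level is a single edge.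
  Conversely, \<open>unst_cd\<close> makes the point unstable as soon as \<open>cd x\<close> lies in
  the interval.\<close>

lemma branch_iff:
  "inst p q x \<and> (dedge p q)\<^sup>+\<^sup>+ x (x - e1) \<and> (dedge p q)\<^sup>+\<^sup>+ x (x - e2) \<longleftrightarrow> p \<le> cd x \<and> cd x \<le> q"
proof
  assume *: "inst p q x \<and> (dedge p q)\<^sup>+\<^sup>+ x (x - e1) \<and> (dedge p q)\<^sup>+\<^sup>+ x (x - e2)"
  have "dedge p q x (x - e1)" "dedge p q x (x - e2)"
    using * by (auto intro!: dedge_one_step simp: lattice_defs)
  moreover have "x - e1 \<noteq> x - e2" by (simp add: e1_def e2_def)
  ultimately show "p \<le> cd x \<and> cd x \<le> q" unfolding dedge_def by metis
next
  assume *: "p \<le> cd x \<and> cd x \<le> q"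
  then have "inst p q x" using unst_cd[of x] by (auto simp: inst_def)
  with * show "inst p q x \<and> (dedge p q)\<^sup>+\<^sup>+ x (x - e1) \<and> (dedge p q)\<^sup>+\<^sup>+ x (x - e2)"
    by (auto intro!: tranclp.r_into_trancl simp: dedge_def)
qed

end

lemma dual_eq_iff [simp]: "dual x = dual y \<longleftrightarrow> x = y"
  by (cases x; cases y) (simp add: dual_def rvec_def)

lemma dual_add: "dual (x + y) = dual x + rvec y" and dual_diff: "dual (x - y) = dual x - rvec y"
  by (simp_all add: dual_def rvec_def)

lemma rvec_e [simp]: "rvec e1 = e1" "rvec e2 = e2"
  by (simp_all add: rvec_def e1_def e2_def)

context busemann_realization
begin

lemma busemann_graph_iff:
  assumes "0 < t" "t < 1"
  shows "(x, x + e1) \<in> busemann_graph b (dir t) \<sigma> \<longleftrightarrow> st t \<sigma> x"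
    and "(x, x + e2) \<in> busemann_graph b (dir t) \<sigma> \<longleftrightarrow> \<not> st t \<sigma> x"
proof -
  have "e1 \<noteq> (e2 :: int \<times> int)" by (simp add: e1_def e2_def)
  then show "(x, x + e1) \<in> busemann_graph b (dir t) \<sigma> \<longleftrightarrow> st t \<sigma> x"
    "(x, x + e2) \<in> busemann_graph b (dir t) \<sigma> \<longleftrightarrow> \<not> st t \<sigma> x"
    using assms by (cases \<sigma>; auto simp: busemann_graph_def st_def h_eq)+
qed

lemma instability_points_eq:
  assumes "0 < p" "q < 1"
  shows "instability_points b (dir p) (dir q) = dual ` {x. inst p q x}"
proof -
  have "dir_cc (dir p) (dir q) \<inter> busemann_supp b (x + e1) (x + e2) \<noteq> {} \<longleftrightarrow> inst p q x" for x
  proof -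
    have "dir_cc (dir p) (dir q) = dir ` {p..q}" using assms by (simp add: dir_intervals)
    then have "dir_cc (dir p) (dir q) \<inter> busemann_supp b (x + e1) (x + e2) \<noteq> {} \<longleftrightarrow>
        (\<exists>t\<in>{p..q}. dir t \<in> busemann_supp b (x + e1) (x + e2))" by auto
    then show ?thesis by (auto simp: busemann_supp_iff inst_def)
  qed
  then show ?thesis by (auto simp: instability_points_def)
qed

text \<open>By monotonicity in the direction, an \<open>e1\<close> edge occurs in the union if and
  only if it occurs for \<open>q\<close> with sign plus, and an \<open>e2\<close> edge if and only
  if it occurs for \<open>p\<close> with sign minus.\<close>

lemma instability_edges_iff:
  assumes "0 < p" "p \<le> q" "q < 1"
  shows "(dual x, dual y) \<in> instability_edges b (dir p) (dir q) \<longleftrightarrow> dedge p q x y"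
proof -
  have st1: "(\<exists>t\<in>{p..q}. \<exists>\<sigma>. st t \<sigma> x) \<longleftrightarrow> cd x \<le> q"
  proof
    assume "\<exists>t\<in>{p..q}. \<exists>\<sigma>. st t \<sigma> x"
    then obtain t \<sigma> where "p \<le> t" "t \<le> q" "st t \<sigma> x" by auto
    then show "cd x \<le> q" using cd_le_if_st[of t \<sigma> x] assms by simp
  next
    assume "cd x \<le> q"
    then have "st q Splus x" using assms by (simp add: st_plus_iff)
    then show "\<exists>t\<in>{p..q}. \<exists>\<sigma>. st t \<sigma> x" using assms by auto
  qed
  have st2: "(\<exists>t\<in>{p..q}. \<exists>\<sigma>. \<not> st t \<sigma> x) \<longleftrightarrow> p \<le> cd x"
  proof
    assume "\<exists>t\<in>{p..q}. \<exists>\<sigma>. \<not> st t \<sigma> x"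
    then obtain t \<sigma> where "p \<le> t" "t \<le> q" "\<not> st t \<sigma> x" by auto
    then show "p \<le> cd x" using le_cd_if_not_st[of t \<sigma> x] assms by simp
  next
    assume "p \<le> cd x"
    then have "\<not> st p Sminus x" using assms st_minus_iff[of p x] by simp
    then show "\<exists>t\<in>{p..q}. \<exists>\<sigma>. \<not> st t \<sigma> x" using assms by auto
  qed
  have dg: "(dual x, dual y) \<in> dual_graph b (dir t) \<sigma> \<longleftrightarrow> y = x - e1 \<and> st t \<sigma> x \<or> y = x - e2 \<and> \<not> st t \<sigma> x"
    if "t \<in> {p..q}" for t \<sigma>
  proof -
    have "(dual x, dual y) \<in> dual_graph b (dir t) \<sigma> \<longleftrightarrow>
        (\<exists>x' e. dual x = dual x' \<and> dual y = dual (x' - e) \<and> e \<in> {e1, e2} \<and> (x', x' + e) \<in> busemann_graph b (dir t) \<sigma>)"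
      unfolding dual_graph_def dual_diff by auto
    also have "\<dots> \<longleftrightarrow> (\<exists>e\<in>{e1, e2}. y = x - e \<and> (x, x + e) \<in> busemann_graph b (dir t) \<sigma>)"
      by auto
    also have "\<dots> \<longleftrightarrow> y = x - e1 \<and> st t \<sigma> x \<or> y = x - e2 \<and> \<not> st t \<sigma> x"
      using that assms busemann_graph_iff[of t x \<sigma>] by simp
    finally show ?thesis .
  qed
  have "(dual x, dual y) \<in> dual_graph_union b (dir p) (dir q) \<longleftrightarrow> y = x - e1 \<and> cd x \<le> q \<or> y = x - e2 \<and> p \<le> cd x"
  proof -
    have "(dual x, dual y) \<in> dual_graph_union b (dir p) (dir q) \<longleftrightarrow>
        (\<exists>t\<in>{p..q}. \<exists>\<sigma>. (dual x, dual y) \<in> dual_graph b (dir t) \<sigma>)"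
      using assms by (auto simp: dual_graph_union_def dir_intervals)
    also have "\<dots> \<longleftrightarrow> (\<exists>t\<in>{p..q}. \<exists>\<sigma>. y = x - e1 \<and> st t \<sigma> x \<or> y = x - e2 \<and> \<not> st t \<sigma> x)"
      using dg by blast
    also have "\<dots> \<longleftrightarrow> y = x - e1 \<and> cd x \<le> q \<or> y = x - e2 \<and> p \<le> cd x"
      unfolding st1[symmetric] st2[symmetric] by blast
    finally show ?thesis .
  qed
  moreover have "dual z \<in> instability_points b (dir p) (dir q) \<longleftrightarrow> inst p q z" for z
    using instability_points_eq[of p q] assms by auto
  ultimately show ?thesis
    unfolding instability_edges_def using dedge_inst[of p q x y] by (auto simp: dedge_def)
qed

lemma ancestor_iff:
  assumes "0 < p" "p \<le> q" "q < 1"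
  shows "ancestor b (dir p) (dir q) (dual x) (dual y) \<longleftrightarrow> (dedge p q)\<^sup>+\<^sup>+ x y"
proof -
  have edges: "instability_edges b (dir p) (dir q) = {(dual x, dual y) | x y. dedge p q x y}"
  proof (intro equalityI subsetI)
    fix e assume e: "e \<in> instability_edges b (dir p) (dir q)"
    then obtain x y where "e = (dual x, dual y)"
      using instability_points_eq[of p q] assms unfolding instability_edges_def by auto
    with e show "e \<in> {(dual x, dual y) | x y. dedge p q x y}"
      using instability_edges_iff[OF assms] by auto
  qed (use instability_edges_iff[OF assms] in auto)
  show ?thesis
  proof
    assume "ancestor b (dir p) (dir q) (dual x) (dual y)"
    then have "(dual x, dual y) \<in> (instability_edges b (dir p) (dir q))\<^sup>+" by (simp add: ancestor_def)
    then have "\<And>y'. dual y = dual y' \<Longrightarrow> (dedge p q)\<^sup>+\<^sup>+ x y'"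
    proof (induction rule: trancl_induct)
      case (base v)
      then show ?case using instability_edges_iff[OF assms, of x y'] by blast
    next
      case (step v v')
      then obtain z where z: "v = dual z" unfolding edges by blast
      then have "dedge p q z y'" using step instability_edges_iff[OF assms, of z y'] by blast
      moreover have "(dedge p q)\<^sup>+\<^sup>+ x z" using z by (rule step.IH)
      ultimately show ?case by (rule tranclp.trancl_into_trancl[rotated])
    qed
    then show "(dedge p q)\<^sup>+\<^sup>+ x y" by blast
  next
    assume "(dedge p q)\<^sup>+\<^sup>+ x y"
    then show "ancestor b (dir p) (dir q) (dual x) (dual y)"
      unfolding ancestor_def
    proof (induction rule: tranclp_induct)
      case (base y)
      then show ?case using instability_edges_iff[OF assms, of x y] by blast
    next
      case (step y z)
      then show ?case using instability_edges_iff[OF assms, of y z] by (blast intro: trancl_into_trancl)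
    qed
  qed
qed

end

section \<open>Common descendants and ancestors\<close>

lemma tranclp_if_rtranclp_neq: "R\<^sup>*\<^sup>* x y \<Longrightarrow> x \<noteq> y \<Longrightarrow> R\<^sup>+\<^sup>+ x y"
  by (meson rtranclpD)

context busemann_realization
begin

text \<open>This step chooses \<open>- e1\<close> whenever the instability graph allows it, so
  iterating it follows the leftmost descending path; \<open>st p Sminus\<close> gives the rightmost
  one in the same way.\<close>

lemma dedge_dn_plus:
  assumes "0 < q" "q < 1" "p \<le> q" "inst p q x"
  shows "dedge p q x (dn (st q Splus) x)"
proof (cases "st q Splus x")
  case True
  then show ?thesis using assms st_plus_iff[of q x] by (simp add: dedge_def dn_def stp_def)
next
  case False
  then have "q \<le> cd x" using assms st_plus_iff[of q x] by simp
  then show ?thesis using False assms by (simp add: dedge_def dn_def stp_def)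
qed

lemma dedge_dn_minus:
  assumes "0 < p" "p < 1" "p \<le> q" "inst p q x"
  shows "dedge p q x (dn (st p Sminus) x)"
proof (cases "st p Sminus x")
  case True
  then have "cd x \<le> p" using assms st_minus_iff[of p x] by auto
  then show ?thesis using True assms by (simp add: dedge_def dn_def stp_def)
next
  case False
  then show ?thesis using assms st_minus_iff[of p x] by (simp add: dedge_def dn_def stp_def)
qed

lemma dedge_dn_pow:
  assumes step: "\<And>x. inst p q x \<Longrightarrow> dedge p q x (dn s x)" and "inst p q x"
  shows "inst p q ((dn s ^^ n) x) \<and> (dedge p q)\<^sup>*\<^sup>* x ((dn s ^^ n) x)"
proof (induction n)
  case (Suc n)
  then have "dedge p q ((dn s ^^ n) x) ((dn s ^^ Suc n) x)" using step by simp
  then show ?case using Suc dedge_inst by (meson rtranclp.rtrancl_into_rtrancl)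
qed (use assms in simp)

lemma ex_descendant_at_level:
  assumes "0 < p" "p \<le> q" "q < 1" "inst p q x" "l < level x"
  shows "\<exists>x'. level x' = l \<and> inst p q x' \<and> (dedge p q)\<^sup>+\<^sup>+ x x'"
proof -
  define x' where "x' = (dn (st q Splus) ^^ nat (level x - l)) x"
  have l: "level x' = l" using assms by (simp add: x'_def)
  have "inst p q x' \<and> (dedge p q)\<^sup>*\<^sup>* x x'"
    unfolding x'_def using assms by (intro dedge_dn_pow dedge_dn_plus) auto
  moreover have "x' \<noteq> x" using l assms by auto
  ultimately show ?thesis using l tranclp_if_rtranclp_neq[of "dedge p q" x x'] by blast
qed

lemma ex_ancestor_at_level:
  assumes "inst p q x" "level x \<le> l"
  shows "\<exists>x'. level x' = l \<and> inst p q x' \<and> (dedge p q)\<^sup>*\<^sup>* x' x"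
proof -
  have "\<exists>x'. level x' = level x + int n \<and> inst p q x' \<and> (dedge p q)\<^sup>*\<^sup>* x' x" for n
  proof (induction n)
    case 0
    then show ?case using assms by auto
  next
    case (Suc n)
    then obtain x' where x': "level x' = level x + int n" "inst p q x'" "(dedge p q)\<^sup>*\<^sup>* x' x" by blast
    obtain y where "dedge p q y x'" using ex_dedge_pred x'(2) by blast
    then show ?case
      using x' dedge_level[of p q y x'] dedge_inst[of p q y x']
      by (intro exI[of _ y]) (auto intro: converse_rtranclp_into_rtranclp)
  qed
  from this[of "nat (l - level x)"] show ?thesis using assms by simp
qed

lemma common_descendant:
  assumes pq: "0 < p" "p \<le> q" "q < 1"
    and s: "\<And>x. st p Sminus x \<Longrightarrow> s x" "\<And>x. s x \<Longrightarrow> st q Splus x"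
    and nb: "\<And>v. \<not> backward_infinite s v"
    and inst: "inst p q x" "inst p q y"
  shows "\<exists>z. inst p q z \<and> (dedge p q)\<^sup>+\<^sup>+ x z \<and> (dedge p q)\<^sup>+\<^sup>+ y z"
proof -
  have meet: "\<exists>z. inst p q z \<and> (dedge p q)\<^sup>*\<^sup>* x z \<and> (dedge p q)\<^sup>*\<^sup>* y z"
    if xy: "inst p q x" "inst p q y" "level x = level y" "fst x \<le> fst y" for x y
  proof (cases "fst x = fst y")
    case True
    then show ?thesis using xy level_fst_eqI[of x y] by blast
  next
    case False
    have "\<exists>n. (dn (st p Sminus) ^^ n) x = (dn (st q Splus) ^^ n) y"
    proof (rule ccontr)
      assume "\<not> ?thesis"
      then have nomeet: "(dn (st p Sminus) ^^ n) x \<noteq> (dn (st q Splus) ^^ n) y" for n by blast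
      have "fst x < fst y" using False xy(4) by simp
      from dual_paths_meet_or_backward_infinite[where sA = "st p Sminus" and s = s and sC = "st q Splus",
          OF s xy(3) this nomeet] nb
      show False by blast
    qed
    then obtain n where n: "(dn (st p Sminus) ^^ n) x = (dn (st q Splus) ^^ n) y" ..
    have "inst p q ((dn (st p Sminus) ^^ n) x) \<and> (dedge p q)\<^sup>*\<^sup>* x ((dn (st p Sminus) ^^ n) x)"
      using pq xy by (intro dedge_dn_pow dedge_dn_minus) auto
    moreover have "(dedge p q)\<^sup>*\<^sup>* y ((dn (st q Splus) ^^ n) y)"
      using pq xy dedge_dn_pow[of p q "st q Splus" y n] dedge_dn_plus by simp
    ultimately show ?thesis using n by metis
  qed
  \<comment> \<open>One level below both points, so that the descents are nonempty even if the two
    points coincide.\<close>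
  define l where "l = min (level x) (level y) - 1"
  have l: "l < level x" "l < level y" by (auto simp: l_def)
  obtain x' where x': "level x' = l" "inst p q x'" "(dedge p q)\<^sup>+\<^sup>+ x x'"
    using ex_descendant_at_level[OF pq inst(1) l(1)] by blast
  obtain y' where y': "level y' = l" "inst p q y'" "(dedge p q)\<^sup>+\<^sup>+ y y'"
    using ex_descendant_at_level[OF pq inst(2) l(2)] by blast
  have "\<exists>z. inst p q z \<and> (dedge p q)\<^sup>*\<^sup>* x' z \<and> (dedge p q)\<^sup>*\<^sup>* y' z"
    using meet[of x' y'] meet[of y' x'] x' y' by (cases "fst x' \<le> fst y'") auto
  then show ?thesis using x'(3) y'(3) by (meson tranclp_rtranclp_tranclp)
qed

text \<open>The paths of the two graphs from the two sides of a jump never meet, since the jump of the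
  Busemann function between them does not decrease.\<close>

lemma jump_persists:
  assumes t: "0 < t1" "t1 < 1" "0 < t2" "t2 < 1" and h: "h t1 \<sigma>1 x < h t2 \<sigma>2 x"
  defines "P \<equiv> \<lambda>n. (up (st t1 \<sigma>1) ^^ n) (x + e2)" and "Q \<equiv> \<lambda>n. (up (st t2 \<sigma>2) ^^ n) (x + e1)"
  shows "b (dir t1) \<sigma>1 (Q n) (P n) < b (dir t2) \<sigma>2 (Q n) (P n)" and "fst (P n) < fst (Q n)"
proof -
  show less: "b (dir t1) \<sigma>1 (Q n) (P n) < b (dir t2) \<sigma>2 (Q n) (P n)" for n
  proof (induction n)
    case 0
    then show ?case using h by (simp add: P_def Q_def h_def)
  next
    case (Suc n)
    have PQ: "P (Suc n) = up (st t1 \<sigma>1) (P n)" "Q (Suc n) = up (st t2 \<sigma>2) (Q n)"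
      by (simp_all add: P_def Q_def)
    have up_ge: "w u \<le> b (dir t) \<sigma> u (up s u)" if "0 < t" "t < 1" for t \<sigma> s u
      using w_le[OF that, where x = u and \<sigma> = \<sigma>] by (simp add: up_def stp_def)
    \<comment> \<open>Each path pays exactly the weight under its own Busemann function and at least
      the weight under the other one. Hence the first value from \<open>Q\<close> to
      \<open>P\<close> changes by at most \<open>w (P n) - w (Q n)\<close>, and the second by at
      least this amount.\<close>
    have "b (dir t1) \<sigma>1 (P n) (P (Suc n)) = w (P n)" "b (dir t2) \<sigma>2 (Q n) (Q (Suc n)) = w (Q n)"
      "w (Q n) \<le> b (dir t1) \<sigma>1 (Q n) (Q (Suc n))" "w (P n) \<le> b (dir t2) \<sigma>2 (P n) (P (Suc n))"
      unfolding PQ using t by (auto simp: b_up up_ge)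
    moreover have "b (dir t) \<sigma> (Q n) (P n) =
        b (dir t) \<sigma> (Q n) (Q (Suc n)) + b (dir t) \<sigma> (Q (Suc n)) (P (Suc n)) - b (dir t) \<sigma> (P n) (P (Suc n))"
      if "0 < t" "t < 1" for t \<sigma>
      using cocycle[OF that, of \<sigma> "Q n" "Q (Suc n)" "P (Suc n)"] cocycle[OF that, of \<sigma> "Q n" "P n" "P (Suc n)"]
      by linarith
    ultimately show ?case using Suc t by (smt (verit))
  qed
  have ne: "P n \<noteq> Q n" for n using less[of n] b_refl[OF t(1,2), where x = "Q n"] b_refl[OF t(3,4), where x = "Q n"] by auto
  have "level (x + e2) = level (x + e1)" by (simp add: lattice_defs)
  then have lev: "level (P n) = level (Q n)" for n by (simp add: P_def Q_def)
  show "fst (P n) < fst (Q n)"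
  proof (induction n)
    case 0
    then show ?case by (simp add: P_def Q_def lattice_defs)
  next
    case (Suc n)
    then have "fst (P (Suc n)) \<le> fst (Q (Suc n))" by (simp add: P_def Q_def fst_up)
    moreover have "fst (P (Suc n)) \<noteq> fst (Q (Suc n))" using ne[of "Suc n"] lev level_fst_eqI by blast
    ultimately show ?case by linarith
  qed
qed

text \<open>The value from \<open>v\<close> to \<open>u\<close> telescopes into the increments
  \<open>h\<close> of the dual points between them, so one of these increments must be strictly
  larger as well.\<close>

lemma ex_jump_between:
  assumes t: "0 < t1" "t1 < 1" "0 < t2" "t2 < 1"
    and "level u = level v" "fst u \<le> fst v" "b (dir t1) \<sigma>1 v u < b (dir t2) \<sigma>2 v u"
  shows "\<exists>z. level z = level u - 1 \<and> fst u \<le> fst z \<and> fst z < fst v \<and> h t1 \<sigma>1 z < h t2 \<sigma>2 z"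
  using assms(5-7)
proof (induction "nat (fst v - fst u)" arbitrary: v)
  case 0
  then have "u = v" by (intro level_fst_eqI) auto
  with 0 show ?case using b_refl[OF t(1,2), where x = v] b_refl[OF t(3,4), where x = v] by simp
next
  case (Suc n)
  define z where "z = v - e1"
  have z: "z + e1 = v" "level (z + e2) = level u" "fst (z + e2) = fst v - 1" "level z = level u - 1" "fst z = fst v - 1"
    using Suc.prems by (auto simp: z_def lattice_defs)
  have dec: "b (dir t) \<sigma> v u = h t \<sigma> z + b (dir t) \<sigma> (z + e2) u" if "0 < t" "t < 1" for t \<sigma>
    using cocycle[OF that, of \<sigma> v "z + e2" u] by (simp add: h_def z(1))
  show ?case
  proof (cases "h t1 \<sigma>1 z < h t2 \<sigma>2 z")
    case True
    then show ?thesis using z Suc.hyps(2) by (intro exI[of _ z]) auto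
  next
    case False
    then have "b (dir t1) \<sigma>1 (z + e2) u < b (dir t2) \<sigma>2 (z + e2) u"
      using dec t Suc.prems(3) by (smt (verit))
    moreover have "n = nat (fst (z + e2) - fst u)" "level u = level (z + e2)" "fst u \<le> fst (z + e2)"
      using z Suc.hyps(2) Suc.prems by auto
    ultimately obtain z' where "level z' = level u - 1" "fst u \<le> fst z'" "fst z' < fst (z + e2)" "h t1 \<sigma>1 z' < h t2 \<sigma>2 z'"
      using Suc.hyps(1) by blast
    then show ?thesis using z(3) by (intro exI[of _ z']) auto
  qed
qed

text \<open>Stability gives local constancy, and the interval is connected; inside it the two signs
  agree.\<close>

lemma const_on_stable_interval:
  assumes "\<And>u. s < u \<Longrightarrow> u < r \<Longrightarrow> \<not> unst x u" "0 \<le> s" "r \<le> 1" "s < u" "u < r" "s < v" "v < r"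
  shows "h u \<sigma> x = h v \<tau> x"
proof -
  have ev: "eventually (\<lambda>y. h a Splus x = h y Splus x) (at a within {s<..<r})" and sg: "h a \<sigma> x = h a Splus x"
    if a: "a \<in> {s<..<r}" for a \<sigma>
  proof -
    obtain s' r' c1 c2 where sr: "0 < s'" "s' < a" "a < r'" "r' < 1"
      and c: "\<forall>u \<sigma>. s' < u \<and> u < r' \<longrightarrow> E1 u \<sigma> x = c1 \<and> E2 u \<sigma> x = c2"
      using locally_constant_if_stable[of x a] assms a by auto
    have hc: "h u \<sigma> x = c2 - c1" if "s' < u" "u < r'" for u \<sigma>
      using c that sr by (simp add: h_eq)
    then show "h a \<sigma> x = h a Splus x" using sr by simp
    have "eventually (\<lambda>y. y \<in> {s'<..<r'}) (at a within {s<..<r})"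
      using sr by (intro eventually_at_topological[THEN iffD2] exI[of _ "{s'<..<r'}"]) auto
    then show "eventually (\<lambda>y. h a Splus x = h y Splus x) (at a within {s<..<r})"
      by eventually_elim (use hc sr in auto)
  qed
  have "h u Splus x = h v Splus x"
  proof (rule connected_local_const[of "{s<..<r}" u v "\<lambda>t. h t Splus x"])
    show "\<forall>a\<in>{s<..<r}. eventually (\<lambda>y. h a Splus x = h y Splus x) (at a within {s<..<r})"
      using ev by blast
  qed (use assms in auto)
  then show ?thesis using sg[of u \<sigma>] sg[of v \<tau>] assms(4-7) by simp
qed

text \<open>Stability at \<open>p\<close> and at \<open>q\<close> yields constancy on full
  neighbourhoods, so the one-sided values at the ends agree with those just inside, where
  \<open>const_on_stable_interval\<close> takes over.\<close>

lemma inst_if_jump: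
  assumes pq: "0 < p" "p \<le> q" "q < 1" and h: "h p Sminus x < h q Splus x"
  shows "inst p q x"
proof (rule ccontr)
  assume "\<not> inst p q x"
  then have ns: "\<not> unst x t" if "p \<le> t" "t \<le> q" for t using that by (auto simp: inst_def)
  obtain s r c1 c2 where p: "0 < s" "s < p" "p < r" "r < 1"
    "\<forall>u \<sigma>. s < u \<and> u < r \<longrightarrow> E1 u \<sigma> x = c1 \<and> E2 u \<sigma> x = c2"
    using locally_constant_if_stable[OF ns[of p]] pq by auto
  obtain s' r' c1' c2' where q: "0 < s'" "s' < q" "q < r'" "r' < 1"
    "\<forall>u \<sigma>. s' < u \<and> u < r' \<longrightarrow> E1 u \<sigma> x = c1' \<and> E2 u \<sigma> x = c2'"
    using locally_constant_if_stable[OF ns[of q]] pq by auto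
  have hp: "h u \<sigma> x = c2 - c1" if "s < u" "u < r" for u \<sigma> using p that by (simp add: h_eq)
  have hq: "h u \<sigma> x = c2' - c1'" if "s' < u" "u < r'" for u \<sigma> using q that by (simp add: h_eq)
  show False
  proof (cases "p = q")
    case True
    then show ?thesis using hp[of p Sminus] hp[of p Splus] p h by simp
  next
    case False
    \<comment> \<open>Points of the open interval that lie in the neighbourhoods of \<open>p\<close>
      and of \<open>q\<close>, respectively.\<close>
    define u v where "u = (p + min r q) / 2" and "v = (q + max s' p) / 2"
    have uv: "p < u" "u < r" "u < q" "s' < v" "v < q" "p < v"
      using False pq p q by (auto simp: u_def v_def min_def max_def)
    have "h p Sminus x = h u Splus x" using hp uv p by simp
    also have "\<dots> = h v Splus x" using uv pq ns by (intro const_on_stable_interval[of p q]) auto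
    also have "\<dots> = h q Splus x" using hq uv q by simp
    finally show False using h by simp
  qed
qed

text \<open>A discrete intermediate value argument: at each step either path lowers its first
  coordinate by 0 or 1, so paths whose order is reversed between top and bottom share a vertex, from
  which \<open>x\<close> is reached.\<close>

lemma path_between_meets:
  assumes pq: "0 < p" "p \<le> q" "q < 1"
    and step: "\<And>x. inst p q x \<Longrightarrow> dedge p q x (dn s x)"
    and z: "inst p q z" "level z = level x + int n"
    and x': "level x' = level z" "(dedge p q)\<^sup>*\<^sup>* x' x"
    and sides: "fst ((dn s ^^ n) z) < fst x \<and> fst x' \<le> fst z \<or> fst x < fst ((dn s ^^ n) z) \<and> fst z \<le> fst x'"
  shows "(dedge p q)\<^sup>+\<^sup>+ z x"
  using x' z sides
proof (induction n arbitrary: x' z)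
  case 0
  then have "x' = x" using dedge_rtranclp_level[of p q x' x] by auto
  with 0 show ?case by auto
next
  case (Suc n)
  show ?case
  proof (cases "x' = z")
    case True
    moreover have "level x' \<noteq> level x" using Suc.prems by simp
    ultimately show ?thesis using Suc.prems(2) tranclp_if_rtranclp_neq[of "dedge p q" z x] by auto
  next
    case False
    then have ne: "fst x' \<noteq> fst z" using Suc.prems(1) level_fst_eqI by blast
    have "x' \<noteq> x" using Suc.prems by auto
    obtain x'' where x'': "dedge p q x' x''" "(dedge p q)\<^sup>*\<^sup>* x'' x"
      using Suc.prems(2)
    proof (cases rule: converse_rtranclpE)
      case base
      with \<open>x' \<noteq> x\<close> show ?thesis by simp
    qed (rule that)
    have dz: "dedge p q z (dn s z)" using step Suc.prems(3) .
    have "(dedge p q)\<^sup>+\<^sup>+ (dn s z) x"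
    proof (rule Suc.IH[of x''])
      show "level x'' = level (dn s z)" using dedge_level[OF x''(1)] Suc.prems by simp
      show "inst p q (dn s z)" using dedge_inst[OF dz] by blast
      show "level (dn s z) = level x + int n" using Suc.prems by simp
      show "fst ((dn s ^^ n) (dn s z)) < fst x \<and> fst x'' \<le> fst (dn s z) \<or>
          fst x < fst ((dn s ^^ n) (dn s z)) \<and> fst (dn s z) \<le> fst x''"
        using Suc.prems(5) ne dedge_fst[OF x''(1)] dedge_fst[OF dz]
        by (auto simp: funpow_swap1)
    qed (use x'' in auto)
    with dz show ?thesis by (meson tranclp_into_tranclp2)
  qed
qed

text \<open>The common ancestor is a point with a jump between \<open>P\<close> and \<open>Q\<close>: its leftmost and rightmost
  descending paths do not cross the paths that lead to \<open>Q\<close> and \<open>P\<close>, so that they pass on either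
  side of \<open>x\<close> and \<open>y\<close>, and every backward path from these points has to hit them.\<close>

lemma common_ancestor:
  assumes pq: "0 < p" "p \<le> q" "q < 1"
    and coal: "coalescing (st p Sminus)" "coalescing (st q Splus)"
    and x0: "h p Sminus x0 < h q Splus x0"
    and inst: "inst p q x" "inst p q y"
  shows "\<exists>z. inst p q z \<and> (dedge p q)\<^sup>+\<^sup>+ z x \<and> (dedge p q)\<^sup>+\<^sup>+ z y"
proof -
  have main: "\<exists>z. inst p q z \<and> (dedge p q)\<^sup>+\<^sup>+ z x \<and> (dedge p q)\<^sup>+\<^sup>+ z y"
    if inst: "inst p q x" "inst p q y" and lev: "level x = level y" and le: "fst x \<le> fst y" for x y
  proof -
    \<comment> \<open>The lattice point just left of the dual point of \<open>x\<close> and the one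
      just right of the dual point of \<open>y\<close>.\<close>
    define c d where "c = x + e2" and "d = y + e1"
    have cd_lev: "level c = level x + 1" "level d = level x + 1" "fst c = fst x" "fst d = fst y + 1"
      using lev by (auto simp: c_def d_def lattice_defs)
    define L R where "L = st p Sminus" and "R = st q Splus"
    obtain m1 n1 where m1: "(up L ^^ m1) d = (up L ^^ n1) (x0 + e2)"
      using coalescing_upto[OF coal(1)] unfolding L_def by blast
    obtain m2 n2 where m2: "(up R ^^ m2) c = (up R ^^ n2) (x0 + e1)"
      using coalescing_upto[OF coal(2)] unfolding R_def by blast
    define k where "k = Suc (max m1 m2)"
    have shift: "(up s ^^ (k - m + n)) v = (up s ^^ k) u" if "(up s ^^ m) u = (up s ^^ n) v" "m \<le> k" for s m n u v
    proof -
      have "(up s ^^ (k - m + n)) v = (up s ^^ (k - m)) ((up s ^^ m) u)" by (simp only: funpow_add o_apply that(1))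
      also have "\<dots> = (up s ^^ (k - m + m)) u" by (simp only: funpow_add o_apply)
      finally show ?thesis using that by simp
    qed
    have 1: "(up L ^^ (k - m1 + n1)) (x0 + e2) = (up L ^^ k) d" using shift[OF m1] by (simp add: k_def)
    have 2: "(up R ^^ (k - m2 + n2)) (x0 + e1) = (up R ^^ k) c" using shift[OF m2] by (simp add: k_def)
    have "level (x0 + e2) + int (k - m1 + n1) = level (x0 + e1) + int (k - m2 + n2)"
      using arg_cong[OF 1, of level] arg_cong[OF 2, of level] cd_lev by simp
    then have eq: "k - m1 + n1 = k - m2 + n2" by (simp add: lattice_defs)
    \<comment> \<open>Once they have merged with the paths from the two sides of \<open>x0\<close>,
      the \<open>L\<close> path of the right point \<open>d\<close> lies to the left of the
      \<open>R\<close> path of the left point \<open>c\<close>. The ancestor is sought between them,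
      on the level just below.\<close>
    define P Q where "P = (up L ^^ k) d" and "Q = (up R ^^ k) c"
    have PQ: "b (dir p) Sminus Q P < b (dir q) Splus Q P" "fst P < fst Q"
      using jump_persists[OF _ _ _ _ x0, of "k - m1 + n1"] pq 1 2
      unfolding P_def Q_def eq L_def R_def by auto
    have levPQ: "level P = level x + 1 + int k" "level Q = level x + 1 + int k"
      by (auto simp: P_def Q_def cd_lev)
    obtain z where z: "level z = level P - 1" "fst P \<le> fst z" "fst z < fst Q" "h p Sminus z < h q Splus z"
      using ex_jump_between[of p q P Q Sminus Splus] pq PQ levPQ by auto
    have inst_z: "inst p q z" using inst_if_jump[OF pq z(4)] .
    have lev_z: "level z = level x + int k" using z levPQ by simp
    have left: "fst ((dn R ^^ k) z) < fst c"
      using dn_pow_left_of_up_pow[of R R z c k] z levPQ cd_lev unfolding Q_def by simp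
    have right: "fst d \<le> fst ((dn L ^^ k) z)"
      using dn_pow_right_of_up_pow[of L L z d k] z levPQ cd_lev unfolding P_def by simp
    have meets: "(dedge p q)\<^sup>+\<^sup>+ z u" if u: "inst p q u" "level u = level x" "fst x \<le> fst u" "fst u \<le> fst y" for u
    proof -
      have "level u \<le> level z" using u lev_z by simp
      then obtain u' where u': "level u' = level z" "(dedge p q)\<^sup>*\<^sup>* u' u"
        using ex_ancestor_at_level[OF u(1)] by blast
      show ?thesis
      proof (cases "fst u' \<le> fst z")
        case True
        show ?thesis
        proof (rule path_between_meets[where s = R and n = k, OF pq _ inst_z _ u'])
          show "dedge p q x (dn R x)" if "inst p q x" for x
            using dedge_dn_plus[OF _ _ _ that] pq by (simp add: R_def)
        qed (use True left cd_lev u lev_z in auto)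
      next
        case False
        show ?thesis
        proof (rule path_between_meets[where s = L and n = k, OF pq _ inst_z _ u'])
          show "dedge p q x (dn L x)" if "inst p q x" for x
            using dedge_dn_minus[OF _ _ _ that] pq by (simp add: L_def)
        qed (use False right cd_lev u lev_z in auto)
      qed
    qed
    show ?thesis using inst_z meets[of x] meets[of y] inst lev le by auto
  qed
  define l where "l = max (level x) (level y)"
  have l: "level x \<le> l" "level y \<le> l" by (auto simp: l_def)
  obtain x' where x': "level x' = l" "inst p q x'" "(dedge p q)\<^sup>*\<^sup>* x' x"
    using ex_ancestor_at_level[OF inst(1) l(1)] by blast
  obtain y' where y': "level y' = l" "inst p q y'" "(dedge p q)\<^sup>*\<^sup>* y' y"
    using ex_ancestor_at_level[OF inst(2) l(2)] by blast
  have "\<exists>z. inst p q z \<and> (dedge p q)\<^sup>+\<^sup>+ z x' \<and> (dedge p q)\<^sup>+\<^sup>+ z y'"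
    using main[of x' y'] main[of y' x'] x' y' by (cases "fst x' \<le> fst y'") auto
  then show ?thesis using x'(3) y'(3) by (meson tranclp_rtranclp_tranclp)
qed

text \<open>If the graphs agreed at all points above \<open>v\<close>, their paths from
  \<open>v\<close> would coincide. By coalescence these paths join those from the two sides of
  \<open>x0\<close>, which never meet.\<close>

lemma ex_branch_above:
  assumes t: "0 < t1" "t1 < 1" "0 < t2" "t2 < 1"
    and le: "\<And>x. st t1 \<sigma>1 x \<Longrightarrow> st t2 \<sigma>2 x"
    and coal: "coalescing (st t1 \<sigma>1)" "coalescing (st t2 \<sigma>2)"
    and x0: "h t1 \<sigma>1 x0 < h t2 \<sigma>2 x0"
  shows "\<exists>u. v \<le> u \<and> \<not> st t1 \<sigma>1 u \<and> st t2 \<sigma>2 u"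
proof (rule ccontr)
  assume *: "\<not> ?thesis"
  define L R where "L = st t1 \<sigma>1" and "R = st t2 \<sigma>2"
  have same: "(up L ^^ n) v = (up R ^^ n) v" for n
  proof (induction n)
    case (Suc n)
    have "v \<le> (up R ^^ n) v" by (rule up_pow_ge)
    then have "L ((up R ^^ n) v) = R ((up R ^^ n) v)" using * le unfolding L_def R_def by blast
    then show ?case
      using Suc by (simp add: up_def[of L "(up R ^^ n) v"] up_def[of R "(up R ^^ n) v"])
  qed simp
  obtain m1 n1 where m1: "(up L ^^ m1) v = (up L ^^ n1) (x0 + e2)"
    using coalescing_upto[OF coal(1)] unfolding L_def by blast
  obtain m2 n2 where m2: "(up R ^^ m2) v = (up R ^^ n2) (x0 + e1)"
    using coalescing_upto[OF coal(2)] unfolding R_def by blast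
  have 1: "(up L ^^ (m2 + m1)) v = (up L ^^ (m2 + n1)) (x0 + e2)" using m1 by (simp add: funpow_add)
  have 2: "(up R ^^ (m1 + m2)) v = (up R ^^ (m1 + n2)) (x0 + e1)" using m2 by (simp add: funpow_add)
  have "level (x0 + e2) + int (m2 + n1) = level (x0 + e1) + int (m1 + n2)"
    using arg_cong[OF 1, of level] arg_cong[OF 2, of level] by simp
  then have eq: "m2 + n1 = m1 + n2" by (simp add: lattice_defs)
  have "(up L ^^ (m2 + n1)) (x0 + e2) = (up R ^^ (m2 + n1)) (x0 + e1)"
    using 1 2 same[of "m1 + m2"] unfolding eq by (simp add: add.commute)
  then show False
    using jump_persists(2)[OF t x0, of "m2 + n1"] unfolding L_def R_def by simp
qed

end

section \<open>Coalescence in one-sided directions\<close>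

lemma coalescing_if_adjacent:
  assumes adj: "\<And>x. \<exists>n. (up s ^^ n) (x + e1) = (up s ^^ n) (x + e2)"
  shows "coalescing s"
proof -
  have main: "\<exists>n. (up s ^^ n) v = (up s ^^ n) v'" if "level v = level v'" "fst v \<le> fst v'" for v v'
    using that
  proof (induction "nat (fst v' - fst v)" arbitrary: v')
    case 0
    then have "v = v'" by (intro level_fst_eqI) auto
    then show ?case by simp
  next
    case (Suc k)
    define z where "z = v' - e1"
    have z: "z + e1 = v'" "level (z + e2) = level v'" "fst (z + e2) = fst v' - 1"
      by (auto simp: z_def lattice_defs)
    have "k = nat (fst (z + e2) - fst v)" "level v = level (z + e2)" "fst v \<le> fst (z + e2)"
      using z Suc.hyps(2) Suc.prems by auto
    then obtain m where m: "(up s ^^ m) v = (up s ^^ m) (z + e2)" using Suc.hyps(1) by blast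
    obtain n where n: "(up s ^^ n) (z + e1) = (up s ^^ n) (z + e2)" using adj by blast
    have "(up s ^^ (n + m)) v = (up s ^^ (n + m)) (z + e2)" using m by (simp add: funpow_add)
    moreover have "(up s ^^ (m + n)) (z + e1) = (up s ^^ (m + n)) (z + e2)" using n by (simp add: funpow_add)
    ultimately show ?case unfolding z(1) by (metis add.commute)
  qed
  show ?thesis
    unfolding coalescing_def
  proof (intro allI impI)
    fix v v' :: "int \<times> int" assume lev: "level v = level v'"
    show "\<exists>n. (up s ^^ n) v = (up s ^^ n) v'"
    proof (cases "fst v \<le> fst v'")
      case True
      with lev main show ?thesis by blast
    next
      case False
      then have "fst v' \<le> fst v" by simp
      with lev main[of v' v] show ?thesis by metis
    qed
  qed
qed

text \<open>The three additions are the almost sure facts about countably many directions or finite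
  sets of weights; everything about other directions is deduced from them.\<close>

locale generic_realization = busemann_realization +
  assumes coalescing_rat: "t \<in> \<rat> \<Longrightarrow> 0 < t \<Longrightarrow> t < 1 \<Longrightarrow> coalescing (st t Splus)"
    and not_backward_infinite_rat: "t \<in> \<rat> \<Longrightarrow> 0 < t \<Longrightarrow> t < 1 \<Longrightarrow> \<not> backward_infinite (st t Splus) v"
    and independent_weights: "finite P \<Longrightarrow> finite Q \<Longrightarrow> finite P' \<Longrightarrow> finite Q' \<Longrightarrow> P \<inter> Q = {} \<Longrightarrow> P' \<inter> Q' = {} \<Longrightarrow>
      (\<Sum>z\<in>P. w z) - (\<Sum>z\<in>Q. w z) = (\<Sum>z\<in>P'. w z) - (\<Sum>z\<in>Q'. w z) \<Longrightarrow> P = P' \<and> Q = Q'"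
begin

text \<open>The sum runs over the set of visited points, which are distinct by their levels, because
  \<open>independent_weights\<close> speaks of sets.\<close>

lemma b_up_pow:
  assumes "0 < t" "t < 1"
  shows "b (dir t) \<sigma> x ((up (st t \<sigma>) ^^ n) x) = (\<Sum>z\<in>(\<lambda>k. (up (st t \<sigma>) ^^ k) x) ` {..<n}. w z)"
proof -
  have "inj_on (\<lambda>k. (up (st t \<sigma>) ^^ k) x) {..<n}"
  proof (rule inj_onI)
    fix i j assume "(up (st t \<sigma>) ^^ i) x = (up (st t \<sigma>) ^^ j) x"
    then have "level ((up (st t \<sigma>) ^^ i) x) = level ((up (st t \<sigma>) ^^ j) x)" by (rule arg_cong)
    then show "i = j" by simp
  qed
  moreover have "b (dir t) \<sigma> x ((up (st t \<sigma>) ^^ n) x) = (\<Sum>k<n. w ((up (st t \<sigma>) ^^ k) x))"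
  proof (induction n)
    case 0
    then show ?case using b_refl[OF assms] by simp
  next
    case (Suc n)
    then show ?case
      using cocycle[OF assms, of \<sigma> x "(up (st t \<sigma>) ^^ n) x" "(up (st t \<sigma>) ^^ Suc n) x"]
        b_up[OF assms, of \<sigma> "(up (st t \<sigma>) ^^ n) x"] by simp
  qed
  ultimately show ?thesis by (simp add: sum.reindex)
qed

text \<open>By the independence of the weights, the value of \<open>h t Splus x\<close> determines the two paths
  that start next to the dual point of \<open>x\<close>, up to their first meeting point.\<close>

lemma coalescing_limit:
  assumes F: "F \<noteq> bot" and rat: "eventually (\<lambda>t. t \<in> \<rat> \<and> 0 < t \<and> t < 1) F"
    and const: "\<And>x. \<exists>c. eventually (\<lambda>t. h t Splus x = c) F"
    and lim: "\<And>x. eventually (\<lambda>t. st t Splus x = s x) F"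
  shows "coalescing s"
proof (rule coalescing_if_adjacent)
  fix x
  obtain c where "eventually (\<lambda>t. h t Splus x = c) F" using const by blast
  with rat have ev: "eventually (\<lambda>t. t \<in> \<rat> \<and> 0 < t \<and> t < 1 \<and> h t Splus x = c) F"
    by eventually_elim blast
  have loop: "\<exists>n P Q. finite P \<and> finite Q \<and> P \<inter> Q = {} \<and> card P = n \<and>
      (up (st t Splus) ^^ n) (x + e1) = (up (st t Splus) ^^ n) (x + e2) \<and>
      P = (\<lambda>k. (up (st t Splus) ^^ k) (x + e1)) ` {..<n} \<and> Q = (\<lambda>k. (up (st t Splus) ^^ k) (x + e2)) ` {..<n} \<and>
      c = (\<Sum>z\<in>P. w z) - (\<Sum>z\<in>Q. w z)"
    if t: "t \<in> \<rat>" "0 < t" "t < 1" "h t Splus x = c" for t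
  proof -
    define U where "U = up (st t Splus)"
    have lev: "level ((U ^^ k) (x + e1)) = level x + 1 + int k" "level ((U ^^ k) (x + e2)) = level x + 1 + int k" for k
    proof -
      have "level (x + e1) = level x + 1" "level (x + e2) = level x + 1" by (auto simp: lattice_defs)
      then show "level ((U ^^ k) (x + e1)) = level x + 1 + int k" "level ((U ^^ k) (x + e2)) = level x + 1 + int k"
        by (auto simp: U_def)
    qed
    have "level (x + e1) = level (x + e2)" by (simp add: lattice_defs)
    then have ex: "\<exists>n. (U ^^ n) (x + e1) = (U ^^ n) (x + e2)"
      using coalescing_rat[OF t(1-3)] unfolding coalescing_def U_def by blast
    define n where "n = (LEAST n. (U ^^ n) (x + e1) = (U ^^ n) (x + e2))"
    have n: "(U ^^ n) (x + e1) = (U ^^ n) (x + e2)" unfolding n_def by (rule LeastI_ex[OF ex])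
    have n_min: "(U ^^ k) (x + e1) \<noteq> (U ^^ k) (x + e2)" if "k < n" for k
      using not_less_Least[of k "\<lambda>n. (U ^^ n) (x + e1) = (U ^^ n) (x + e2)"] that unfolding n_def by blast
    define P Q where "P = (\<lambda>k. (U ^^ k) (x + e1)) ` {..<n}" and "Q = (\<lambda>k. (U ^^ k) (x + e2)) ` {..<n}"
    have "P \<inter> Q = {}"
    proof (rule ccontr)
      assume "P \<inter> Q \<noteq> {}"
      then obtain u where "u \<in> P" "u \<in> Q" by blast
      then obtain i j where "i < n" "u = (U ^^ i) (x + e1)" "u = (U ^^ j) (x + e2)"
        unfolding P_def Q_def by blast
      then have ij: "i < n" "(U ^^ i) (x + e1) = (U ^^ j) (x + e2)" by simp_all
      from ij(2) have "level ((U ^^ i) (x + e1)) = level ((U ^^ j) (x + e2))" by (rule arg_cong)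
      then have "i = j" unfolding lev by simp
      with ij n_min show False by blast
    qed
    moreover have "card P = n"
    proof -
      have "inj_on (\<lambda>k. (U ^^ k) (x + e1)) {..<n}"
      proof (rule inj_onI)
        fix i j assume "(U ^^ i) (x + e1) = (U ^^ j) (x + e1)"
        then have "level ((U ^^ i) (x + e1)) = level ((U ^^ j) (x + e1))" by (rule arg_cong)
        then show "i = j" unfolding lev by simp
      qed
      then show ?thesis by (simp add: P_def card_image)
    qed
    moreover have "c = (\<Sum>z\<in>P. w z) - (\<Sum>z\<in>Q. w z)"
    proof -
      have "b (dir t) Splus (x + e1) ((U ^^ n) (x + e1)) = (\<Sum>z\<in>P. w z)"
        "b (dir t) Splus (x + e2) ((U ^^ n) (x + e2)) = (\<Sum>z\<in>Q. w z)"
        unfolding P_def Q_def U_def by (rule b_up_pow[OF t(2,3)])+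
      then show ?thesis
        using cocycle[OF t(2,3), of Splus "x + e1" "x + e2" "(U ^^ n) (x + e2)"] n t(4) by (simp add: h_def)
    qed
    ultimately show ?thesis
      using n unfolding U_def[symmetric] by (intro exI[of _ n] exI[of _ P] exI[of _ Q]) (auto simp: P_def Q_def)
  qed
  obtain t0 where t0: "t0 \<in> \<rat>" "0 < t0" "t0 < 1" "h t0 Splus x = c"
    using eventually_happens'[OF F ev] by blast
  obtain n0 P0 Q0 where loop0: "finite P0" "finite Q0" "P0 \<inter> Q0 = {}" "c = (\<Sum>z\<in>P0. w z) - (\<Sum>z\<in>Q0. w z)"
    using loop[OF t0] by blast
  \<comment> \<open>The loop found for \<open>t0\<close> is finite, so eventually the graphs agree
    with \<open>s\<close> on all its points. A parameter \<open>t1\<close> that also has the value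
    \<open>c\<close> has the same loop by \<open>independent_weights\<close>, and this loop is
    therefore one of \<open>s\<close>.\<close>
  have "eventually (\<lambda>t. \<forall>u\<in>P0 \<union> Q0. st t Splus u = s u) F"
    using loop0 lim by (intro eventually_ball_finite) auto
  with ev have "eventually (\<lambda>t. (t \<in> \<rat> \<and> 0 < t \<and> t < 1 \<and> h t Splus x = c) \<and> (\<forall>u\<in>P0 \<union> Q0. st t Splus u = s u)) F"
    by (rule eventually_conj)
  from eventually_happens'[OF F this] obtain t1 where t1: "t1 \<in> \<rat>" "0 < t1" "t1 < 1" "h t1 Splus x = c"
    and agree: "\<forall>u\<in>P0 \<union> Q0. st t1 Splus u = s u" by blast
  define U where "U = up (st t1 Splus)"
  obtain n P Q where loop1: "finite P" "finite Q" "P \<inter> Q = {}" "(U ^^ n) (x + e1) = (U ^^ n) (x + e2)"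
    "P = (\<lambda>k. (U ^^ k) (x + e1)) ` {..<n}" "Q = (\<lambda>k. (U ^^ k) (x + e2)) ` {..<n}"
    "c = (\<Sum>z\<in>P. w z) - (\<Sum>z\<in>Q. w z)"
    using loop[OF t1] unfolding U_def by blast
  have PQ: "P = P0" "Q = Q0"
    using independent_weights[of P Q P0 Q0] loop0 loop1 by auto
  have same: "(up s ^^ k) y = (U ^^ k) y" if "k \<le> n" "\<And>j. j < n \<Longrightarrow> (U ^^ j) y \<in> P0 \<union> Q0" for k y
    using that(1)
  proof (induction k)
    case (Suc k)
    then have "st t1 Splus ((U ^^ k) y) = s ((U ^^ k) y)" using agree that(2)[of k] by simp
    then have "up s ((U ^^ k) y) = U ((U ^^ k) y)"
      by (simp add: U_def up_def[of s] up_def[of "st t1 Splus" "(up (st t1 Splus) ^^ k) y"])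
    then show ?case using Suc by simp
  qed simp
  have "(up s ^^ n) (x + e1) = (U ^^ n) (x + e1)" "(up s ^^ n) (x + e2) = (U ^^ n) (x + e2)"
    using PQ loop1(5,6) by (auto intro!: same)
  then show "\<exists>n. (up s ^^ n) (x + e1) = (up s ^^ n) (x + e2)" using loop1(4) by metis
qed

lemma h_rat_ne_0: "t \<in> \<rat> \<Longrightarrow> 0 < t \<Longrightarrow> t < 1 \<Longrightarrow> h t Splus x \<noteq> 0"
  using no_tie[of t x] by (simp add: h_eq)

end

section \<open>Infinitely many coalescence points\<close>

context busemann_realization
begin

lemma path_through_level:
  assumes "(dedge p q)\<^sup>*\<^sup>* x y" "level y \<le> l" "l \<le> level x"
  shows "\<exists>v. level v = l \<and> (dedge p q)\<^sup>*\<^sup>* x v \<and> (dedge p q)\<^sup>*\<^sup>* v y"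
  using assms
proof (induction rule: rtranclp_induct)
  case base
  then show ?case by (intro exI[of _ x]) auto
next
  case (step y z)
  show ?case
  proof (cases "l = level z")
    case True
    then show ?thesis using step by (intro exI[of _ z]) auto
  next
    case False
    then have "level y \<le> l" using step dedge_level[OF step.hyps(2)] by auto
    then obtain v where v: "level v = l" "(dedge p q)\<^sup>*\<^sup>* x v" "(dedge p q)\<^sup>*\<^sup>* v y"
      using step by blast
    have "(dedge p q)\<^sup>*\<^sup>* v z" using v(3) step.hyps(2) by (rule rtranclp.rtrancl_into_rtrancl)
    with v show ?thesis by blast
  qed
qed

definition merge :: "real \<Rightarrow> real \<Rightarrow> int \<times> int \<Rightarrow> bool" where
  "merge p q f \<longleftrightarrow> dedge p q (f + e1) f \<and> dedge p q (f + e2) f"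

lemma dedge_pred: "dedge p q a y \<Longrightarrow> a = y + e1 \<or> a = y + e2"
  by (auto simp: dedge_def)

lemma merge_if_two_preds: "dedge p q a f \<Longrightarrow> dedge p q a' f \<Longrightarrow> a \<noteq> a' \<Longrightarrow> merge p q f"
  using dedge_pred[of p q a f] dedge_pred[of p q a' f] by (auto simp: merge_def)

lemma ex_merge:
  assumes "(dedge p q)\<^sup>*\<^sup>* a z" "(dedge p q)\<^sup>*\<^sup>* a' z" "level a = level a'" "a \<noteq> a'"
  shows "\<exists>f. merge p q f \<and> (dedge p q)\<^sup>*\<^sup>* a f \<and> (dedge p q)\<^sup>*\<^sup>* a' f \<and> level z \<le> level f"
  using assms
proof (induction "nat (level a - level z)" arbitrary: a a')
  case 0
  then have "level a \<le> level z" "level a' \<le> level z" by auto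
  then have "a = z" "a' = z"
    using 0 dedge_rtranclp_level[of p q a z] dedge_rtranclp_level[of p q a' z] by auto
  with 0 show ?case by simp
next
  case (Suc n)
  have "a \<noteq> z" "a' \<noteq> z" using Suc.hyps(2) Suc.prems by auto
  obtain c where c: "dedge p q a c" "(dedge p q)\<^sup>*\<^sup>* c z"
    using Suc.prems(1) \<open>a \<noteq> z\<close> by (cases rule: converse_rtranclpE) auto
  obtain c' where c': "dedge p q a' c'" "(dedge p q)\<^sup>*\<^sup>* c' z"
    using Suc.prems(2) \<open>a' \<noteq> z\<close> by (cases rule: converse_rtranclpE) auto
  show ?case
  proof (cases "c = c'")
    case True
    then show ?thesis
      using c c' Suc.prems(4) merge_if_two_preds[of p q a c a'] dedge_rtranclp_level[OF c(2)]
      by (intro exI[of _ c]) auto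
  next
    case False
    have lev: "level c = level c'" "n = nat (level c - level z)"
      using dedge_level[OF c(1)] dedge_level[OF c'(1)] Suc.prems Suc.hyps(2) by auto
    obtain f where f: "merge p q f" "(dedge p q)\<^sup>*\<^sup>* c f" "(dedge p q)\<^sup>*\<^sup>* c' f" "level z \<le> level f"
      using Suc.hyps(1)[OF lev(2) c(2) c'(2) lev(1) False] by blast
    have "(dedge p q)\<^sup>*\<^sup>* a f" using c(1) f(2) by (rule converse_rtranclp_into_rtranclp)
    moreover have "(dedge p q)\<^sup>*\<^sup>* a' f" using c'(1) f(3) by (rule converse_rtranclp_into_rtranclp)
    ultimately show ?thesis using f by blast
  qed
qed

text \<open>If there were only finitely many merging points, then above some level every instability point
  would have a unique ancestor at each level. A branch point above that level is then determined by
  a pair of points of that level below its two children, and only finitely many pairs can occur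
  since the paths through them go on to merge.\<close>

lemma infinite_merge:
  assumes desc: "\<And>x y. inst p q x \<Longrightarrow> inst p q y \<Longrightarrow> \<exists>z. (dedge p q)\<^sup>+\<^sup>+ x z \<and> (dedge p q)\<^sup>+\<^sup>+ y z"
    and branch: "\<And>v. \<exists>u. v \<le> u \<and> p \<le> cd u \<and> cd u \<le> q"
  shows "infinite {f. merge p q f}"
proof
  assume fin: "finite {f. merge p q f}"
  define N where "N = Max (insert 0 (level ` {f. merge p q f})) + 1"
  have N: "level f < N" if "merge p q f" for f
  proof -
    have "level f \<le> Max (insert 0 (level ` {f. merge p q f}))"
      using fin that by (intro Max_ge) auto
    then show ?thesis by (simp add: N_def)
  qed
  have unique: "u = u'" if "(dedge p q)\<^sup>*\<^sup>* u y" "(dedge p q)\<^sup>*\<^sup>* u' y" "level u = level u'" "N \<le> level y" for u u' y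
  proof (rule ccontr)
    assume "u \<noteq> u'"
    from ex_merge[OF that(1-3) this] obtain f where "merge p q f" "level y \<le> level f" by blast
    with N[of f] that(4) show False by simp
  qed
  define Br where "Br = {u. p \<le> cd u \<and> cd u \<le> q \<and> N < level u}"
  have "infinite Br"
  proof
    assume "finite Br"
    define K where "K = Max (insert N (level ` Br))"
    have K: "N \<le> K" "\<And>u. u \<in> Br \<Longrightarrow> level u \<le> K"
      using \<open>finite Br\<close> by (auto simp: K_def)
    obtain u where u: "(K + 1, 0) \<le> u" "p \<le> cd u" "cd u \<le> q" using branch by blast
    then have "K + 1 \<le> level u" by (cases u) (auto simp: level_def less_eq_prod_def)
    then show False using K u by (fastforce simp: Br_def)
  qed
  \<comment> \<open>Points of level \<open>N\<close> through which a path can descend to a merging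
    point; each of the finitely many merging points lies below only finitely many points of that
    level.\<close>
  define C where "C = {\<alpha>. level \<alpha> = N \<and> (\<exists>f. merge p q f \<and> f \<le> \<alpha>)}"
  have "C \<subseteq> (\<Union>f\<in>{f. merge p q f}. {fst f..N - snd f} \<times> {snd f..N - fst f})"
    by (auto simp: C_def level_def less_eq_prod_def)
  then have "finite C" by (rule finite_subset) (use fin in auto)
  have edges: "dedge p q u (u - e1)" "dedge p q u (u - e2)" if "u \<in> Br" for u
  proof -
    have "inst p q u" using that unst_cd[of u] by (auto simp: Br_def inst_def)
    then show "dedge p q u (u - e1)" "dedge p q u (u - e2)" using that by (auto simp: Br_def dedge_def)
  qed
  have "\<exists>\<alpha>\<beta>. \<alpha>\<beta> \<in> C \<times> C \<and> (dedge p q)\<^sup>*\<^sup>* (u - e1) (fst \<alpha>\<beta>) \<and> (dedge p q)\<^sup>*\<^sup>* (u - e2) (snd \<alpha>\<beta>)" if u: "u \<in> Br" for u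
  proof -
    have "inst p q (u - e1)" "inst p q (u - e2)" using edges[OF u] dedge_inst by blast+
    from desc[OF this] obtain z where "(dedge p q)\<^sup>+\<^sup>+ (u - e1) z" "(dedge p q)\<^sup>+\<^sup>+ (u - e2) z" by blast
    then have z: "(dedge p q)\<^sup>*\<^sup>* (u - e1) z" "(dedge p q)\<^sup>*\<^sup>* (u - e2) z" by auto
    have lev: "level (u - e1) = level u - 1" "level (u - e2) = level u - 1" "u - e1 \<noteq> u - e2"
      by (auto simp: lattice_defs)
    then obtain f where f: "merge p q f" "(dedge p q)\<^sup>*\<^sup>* (u - e1) f" "(dedge p q)\<^sup>*\<^sup>* (u - e2) f"
      using ex_merge[OF z] by auto
    have lN: "level f \<le> N" "N \<le> level (u - e1)" "N \<le> level (u - e2)"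
      using N[OF f(1)] u lev by (auto simp: Br_def)
    obtain \<alpha> where \<alpha>: "level \<alpha> = N" "(dedge p q)\<^sup>*\<^sup>* (u - e1) \<alpha>" "(dedge p q)\<^sup>*\<^sup>* \<alpha> f"
      using path_through_level[OF f(2) lN(1,2)] by blast
    obtain \<beta> where \<beta>: "level \<beta> = N" "(dedge p q)\<^sup>*\<^sup>* (u - e2) \<beta>" "(dedge p q)\<^sup>*\<^sup>* \<beta> f"
      using path_through_level[OF f(3) lN(1,3)] by blast
    have "\<alpha> \<in> C" "\<beta> \<in> C"
      unfolding C_def using \<alpha> \<beta> f(1) dedge_rtranclp_le by blast+
    with \<alpha> \<beta> show ?thesis by (intro exI[of _ "(\<alpha>, \<beta>)"]) auto
  qed
  then obtain \<phi> where \<phi>: "\<And>u. u \<in> Br \<Longrightarrow> \<phi> u \<in> C \<times> C"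
    "\<And>u. u \<in> Br \<Longrightarrow> (dedge p q)\<^sup>*\<^sup>* (u - e1) (fst (\<phi> u))"
    "\<And>u. u \<in> Br \<Longrightarrow> (dedge p q)\<^sup>*\<^sup>* (u - e2) (snd (\<phi> u))"
    by metis
  have level_\<phi>: "level (fst (\<phi> u)) = N" "level (snd (\<phi> u)) = N" if "u \<in> Br" for u
    using \<phi>(1)[OF that] by (auto simp: C_def mem_Times_iff)
  have down: "(dedge p q)\<^sup>*\<^sup>* u (fst (\<phi> u))" "(dedge p q)\<^sup>*\<^sup>* u (snd (\<phi> u))" if "u \<in> Br" for u
    using converse_rtranclp_into_rtranclp[OF edges(1)[OF that] \<phi>(2)[OF that]]
      converse_rtranclp_into_rtranclp[OF edges(2)[OF that] \<phi>(3)[OF that]] by blast+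
  \<comment> \<open>With equal pairs, uniqueness of ancestors at a level forces the paths from both
    children of the higher branch point through the lower one. The two children would then be
    distinct ancestors on one level of a point not below \<open>N\<close>.\<close>
  have inj: "\<not> level u < level u'" if u: "u \<in> Br" "u' \<in> Br" "\<phi> u = \<phi> u'" for u u'
  proof
    assume less: "level u < level u'"
    have N_u: "N \<le> level u" using u(1) by (simp add: Br_def)
    have lev: "level (u' - e1) = level u' - 1" "level (u' - e2) = level u' - 1" "u' - e1 \<noteq> u' - e2"
      by (auto simp: lattice_defs)
    obtain v where v: "level v = level u" "(dedge p q)\<^sup>*\<^sup>* (u' - e1) v" "(dedge p q)\<^sup>*\<^sup>* v (fst (\<phi> u'))"
      using path_through_level[OF \<phi>(2)[OF u(2)], of "level u"] level_\<phi>[OF u(2)] N_u less lev by auto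
    then have "v = u" using unique[OF v(3) down(1)[OF u(1), unfolded u(3)]] level_\<phi>[OF u(2)] by simp
    obtain v' where v': "level v' = level u" "(dedge p q)\<^sup>*\<^sup>* (u' - e2) v'" "(dedge p q)\<^sup>*\<^sup>* v' (snd (\<phi> u'))"
      using path_through_level[OF \<phi>(3)[OF u(2)], of "level u"] level_\<phi>[OF u(2)] N_u less lev by auto
    then have "v' = u" using unique[OF v'(3) down(2)[OF u(1), unfolded u(3)]] level_\<phi>[OF u(2)] by simp
    from unique[of "u' - e1" u "u' - e2"] v v' \<open>v = u\<close> \<open>v' = u\<close> lev N_u show False by simp
  qed
  have "inj_on \<phi> Br"
  proof (rule inj_onI)
    fix u u' assume u: "u \<in> Br" "u' \<in> Br" "\<phi> u = \<phi> u'"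
    then have "level u = level u'" using inj[OF u] inj[OF u(2,1) u(3)[symmetric]] by linarith
    then show "u = u'"
      using unique[OF down(1)[OF u(1)] down(1)[OF u(2), folded u(3)]] level_\<phi>[OF u(1)] by simp
  qed
  moreover have "\<phi> ` Br \<subseteq> C \<times> C" using \<phi>(1) by blast
  then have "finite (\<phi> ` Br)" by (rule finite_subset) (use \<open>finite C\<close> in simp)
  ultimately show False using \<open>infinite Br\<close> finite_imageD by blast
qed

definition isolated_instabilities :: bool where
  "isolated_instabilities \<longleftrightarrow> (\<forall>x t. unst x t \<longrightarrow> (\<exists>\<epsilon>>0. \<forall>u. u \<noteq> t \<and> \<bar>u - t\<bar> < \<epsilon> \<longrightarrow> \<not> unst x u))"

lemma ex_stable_punctured:
  assumes "isolated_instabilities" "0 < t" "t < 1"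
  shows "\<exists>s r. 0 < s \<and> s < t \<and> t < r \<and> r < 1 \<and> (\<forall>u. s < u \<and> u < r \<and> u \<noteq> t \<longrightarrow> \<not> unst x u)"
proof (cases "unst x t")
  case True
  then obtain \<epsilon> where \<epsilon>: "\<epsilon> > 0" "\<And>u. u \<noteq> t \<Longrightarrow> \<bar>u - t\<bar> < \<epsilon> \<Longrightarrow> \<not> unst x u"
    using assms(1) unfolding isolated_instabilities_def by blast
  show ?thesis
    by (rule exI[of _ "max (t - \<epsilon>) (t / 2)"], rule exI[of _ "min (t + \<epsilon>) ((t + 1) / 2)"])
       (use assms \<epsilon> in \<open>auto simp: max_def min_def abs_if field_simps\<close>)
next
  case False
  obtain s r c1 c2 where sr: "0 < s" "s < t" "t < r" "r < 1"
    "\<forall>u \<sigma>. s < u \<and> u < r \<longrightarrow> E1 u \<sigma> x = c1 \<and> E2 u \<sigma> x = c2"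
    using locally_constant_if_stable[OF False assms(2,3)] by blast
  have "\<not> unst x u" if u: "s < u" "u < r" for u
  proof
    assume "unst x u"
    obtain s' r' where "s < s'" "s' < u" "u < r'" "r' < r" using u dense by meson
    moreover from this have "h s' Splus x < h r' Splus x" using \<open>unst x u\<close> sr by (simp add: unst_def)
    ultimately show False using sr by (simp add: h_eq)
  qed
  with sr show ?thesis by blast
qed

text \<open>At an isolated point of increase, \<open>h\<close> is constant on either side, so the
  increase must be a jump between the two one-sided values. This makes a single direction usable for
  \<open>jump_persists\<close>.\<close>

lemma jump_if_inst:
  assumes "isolated_instabilities" and pq: "0 < p" "p \<le> q" "q < 1" and "inst p q x"
  shows "h p Sminus x < h q Splus x"
proof -
  obtain t where t: "p \<le> t" "t \<le> q" "unst x t" using assms by (auto simp: inst_def)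
  then have t01: "0 < t" "t < 1" using unst_bounds by blast+
  obtain s r where sr: "0 < s" "s < t" "t < r" "r < 1" "\<And>u. s < u \<Longrightarrow> u < r \<Longrightarrow> u \<noteq> t \<Longrightarrow> \<not> unst x u"
    using ex_stable_punctured[OF assms(1) t01] by blast
  define s' r' where "s' = (s + t) / 2" and "r' = (t + r) / 2"
  have s'r': "s < s'" "s' < t" "t < r'" "r' < r" using sr by (auto simp: s'_def r'_def)
  have "h t Sminus x = h s' Splus x"
  proof (rule tendsto_unique[OF _ h_left[OF t01, of Splus]])
    have "eventually (\<lambda>u. u \<in> {s<..<t}) (at_left t)" using sr by (intro eventually_at_left_real)
    then have "eventually (\<lambda>u. h u Splus x = h s' Splus x) (at_left t)"
      by eventually_elim (rule const_on_stable_interval[of s t], use sr s'r' in auto)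
    then show "((\<lambda>u. h u Splus x) \<longlongrightarrow> h s' Splus x) (at_left t)" by (rule tendsto_eventually)
  qed simp
  moreover have "h t Splus x = h r' Splus x"
  proof (rule tendsto_unique[OF _ h_right[OF t01, of Splus]])
    have "eventually (\<lambda>u. u \<in> {t<..<r}) (at_right t)" using sr by (intro eventually_at_right_real)
    then have "eventually (\<lambda>u. h u Splus x = h r' Splus x) (at_right t)"
      by eventually_elim (rule const_on_stable_interval[of t r], use sr s'r' in auto)
    then show "((\<lambda>u. h u Splus x) \<longlongrightarrow> h r' Splus x) (at_right t)" by (rule tendsto_eventually)
  qed simp
  moreover have "h s' Splus x < h r' Splus x" using t(3) sr s'r' by (simp add: unst_def)
  moreover have "h p Sminus x \<le> h t Sminus x" "h t Splus x \<le> h q Splus x"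
    using t pq by (auto intro!: h_mono simp: sided_le_def)
  ultimately show ?thesis by linarith
qed

end

context generic_realization
begin

text \<open>\<open>coalescing_limit\<close> along rationals increasing to \<open>t\<close>.
  Isolation makes the increments constant just to the left. Since rationals have no ties, a
  nonpositive left value at \<open>t\<close> forces negative values before it, so the edges converge
  to those of sign minus.\<close>

lemma coalescing_minus:
  assumes iso: "isolated_instabilities" and t: "0 < t" "t < 1"
  shows "coalescing (st t Sminus)"
proof (rule coalescing_limit)
  let ?F = "inf (at_left t) (principal \<rat>)"
  show "?F \<noteq> bot"
  proof
    assume "?F = bot"
    then have "eventually (\<lambda>_. False) ?F" by simp
    then have "eventually (\<lambda>q. q \<notin> \<rat>) (at_left t)" by (simp add: eventually_inf_principal)
    then obtain a where "a < t" "\<And>q. a < q \<Longrightarrow> q < t \<Longrightarrow> q \<notin> \<rat>"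
      using eventually_at_left[of "t - 1" t] by auto
    then show False using Rats_dense_in_real[of a t] by blast
  qed
  have "eventually (\<lambda>q. q \<in> {0<..<t}) (at_left t)" using t by (intro eventually_at_left_real)
  then show "eventually (\<lambda>q. q \<in> \<rat> \<and> 0 < q \<and> q < 1) ?F"
    unfolding eventually_inf_principal by eventually_elim (use t in auto)
  show "\<exists>c. eventually (\<lambda>q. h q Splus x = c) ?F" for x
  proof -
    obtain s r where sr: "0 < s" "s < t" "\<And>u. s < u \<Longrightarrow> u < r \<Longrightarrow> u \<noteq> t \<Longrightarrow> \<not> unst x u" "t < r"
      using ex_stable_punctured[OF iso t] by blast
    have "eventually (\<lambda>q. q \<in> {s<..<t}) (at_left t)" using sr by (intro eventually_at_left_real)
    then have "eventually (\<lambda>q. h q Splus x = h ((s + t) / 2) Splus x) ?F"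
      unfolding eventually_inf_principal
      by eventually_elim (intro impI, rule const_on_stable_interval[of s t], use sr t in auto)
    then show ?thesis ..
  qed
  show "eventually (\<lambda>q. st q Splus x = st t Sminus x) ?F" for x
  proof (cases "0 < h t Sminus x")
    case True
    then have "eventually (\<lambda>q. 0 < h q Splus x) (at_left t)"
      using order_tendstoD(1)[OF h_left[OF t]] by blast
    then show ?thesis
      unfolding eventually_inf_principal by eventually_elim (use True in \<open>simp add: st_def\<close>)
  next
    case False
    have "eventually (\<lambda>q. q \<in> {0<..<t}) (at_left t)" using t by (intro eventually_at_left_real)
    then show ?thesis
      unfolding eventually_inf_principal
    proof eventually_elim
      case (elim q)
      show ?case
      proof
        assume "q \<in> \<rat>"
        then have "h q Splus x \<noteq> 0" using elim t by (intro h_rat_ne_0) auto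
        moreover have "h q Splus x \<le> h t Sminus x"
          using elim t by (intro h_mono) (auto simp: sided_le_def)
        ultimately show "st q Splus x = st t Sminus x" using False by (simp add: st_def)
      qed
    qed
  qed
qed

lemma coalescing_plus:
  assumes iso: "isolated_instabilities" and t: "0 < t" "t < 1"
  shows "coalescing (st t Splus)"
proof (rule coalescing_limit)
  let ?F = "inf (at_right t) (principal \<rat>)"
  show "?F \<noteq> bot"
  proof
    assume "?F = bot"
    then have "eventually (\<lambda>_. False) ?F" by simp
    then have "eventually (\<lambda>q. q \<notin> \<rat>) (at_right t)" by (simp add: eventually_inf_principal)
    then obtain a where "t < a" "\<And>q. t < q \<Longrightarrow> q < a \<Longrightarrow> q \<notin> \<rat>"
      using eventually_at_right[of t "t + 1"] by auto
    then show False using Rats_dense_in_real[of t a] by blast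
  qed
  have "eventually (\<lambda>q. q \<in> {t<..<1}) (at_right t)" using t by (intro eventually_at_right_real)
  then show "eventually (\<lambda>q. q \<in> \<rat> \<and> 0 < q \<and> q < 1) ?F"
    unfolding eventually_inf_principal by eventually_elim (use t in auto)
  show "\<exists>c. eventually (\<lambda>q. h q Splus x = c) ?F" for x
  proof -
    obtain s r where sr: "t < r" "r < 1" "\<And>u. s < u \<Longrightarrow> u < r \<Longrightarrow> u \<noteq> t \<Longrightarrow> \<not> unst x u" "s < t"
      using ex_stable_punctured[OF iso t] by blast
    have "eventually (\<lambda>q. q \<in> {t<..<r}) (at_right t)" using sr by (intro eventually_at_right_real)
    then have "eventually (\<lambda>q. h q Splus x = h ((t + r) / 2) Splus x) ?F"
      unfolding eventually_inf_principal
      by eventually_elim (intro impI, rule const_on_stable_interval[of t r], use sr t in auto)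
    then show ?thesis ..
  qed
  show "eventually (\<lambda>q. st q Splus x = st t Splus x) ?F" for x
  proof (cases "h t Splus x < 0")
    case True
    then have "eventually (\<lambda>q. h q Splus x < 0) (at_right t)"
      using order_tendstoD(2)[OF h_right[OF t]] by blast
    then show ?thesis
      unfolding eventually_inf_principal by eventually_elim (use True in \<open>simp add: st_def\<close>)
  next
    case False
    have "eventually (\<lambda>q. q \<in> {t<..<1}) (at_right t)" using t by (intro eventually_at_right_real)
    then show ?thesis
      unfolding eventually_inf_principal
    proof eventually_elim
      case (elim q)
      have "h t Splus x \<le> h q Splus x"
        using elim t by (intro h_mono) (auto simp: sided_le_def)
      then show ?case using False by (auto simp: st_def)
    qed
  qed
qed

lemma path_weight_le:
  assumes t: "0 < t" "t < 1" and "k \<le> m" and step: "\<And>i. k \<le> i \<Longrightarrow> i < m \<Longrightarrow> \<rho> (i + 1) - \<rho> i \<in> {e1, e2}"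
  shows "path_weight w k m \<rho> \<le> b (dir t) \<sigma> (\<rho> k) (\<rho> m)"
  using \<open>k \<le> m\<close> step
proof (induction m rule: int_ge_induct)
  case base
  then show ?case using b_refl[OF t] by (simp add: path_weight_def)
next
  case (step m)
  have "\<rho> (m + 1) = \<rho> m + e1 \<or> \<rho> (m + 1) = \<rho> m + e2"
    using step.prems[of m] step.hyps by (auto simp: diff_eq_eq add.commute)
  then have "w (\<rho> m) \<le> b (dir t) \<sigma> (\<rho> m) (\<rho> (m + 1))"
    using w_le[OF t, of "\<rho> m" \<sigma>] by auto
  moreover have "path_weight w k m \<rho> \<le> b (dir t) \<sigma> (\<rho> k) (\<rho> m)"
    using step by auto
  moreover have "{k..<m + 1} = insert m {k..<m}" using step.hyps by auto
  then have "path_weight w k (m + 1) \<rho> = path_weight w k m \<rho> + w (\<rho> m)"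
    by (simp add: path_weight_def)
  ultimately show ?case using cocycle[OF t, of \<sigma> "\<rho> k" "\<rho> m" "\<rho> (m + 1)"] by linarith
qed

lemma path_weight_eq:
  assumes t: "0 < t" "t < 1" and "k \<le> m" and step: "\<And>i. \<rho> (i + 1) = up (st t \<sigma>) (\<rho> i)"
  shows "path_weight w k m \<rho> = b (dir t) \<sigma> (\<rho> k) (\<rho> m)"
  using \<open>k \<le> m\<close>
proof (induction m rule: int_ge_induct)
  case base
  then show ?case using b_refl[OF t] by (simp add: path_weight_def)
next
  case (step m)
  have "{k..<m + 1} = insert m {k..<m}" using step.hyps by auto
  then have "path_weight w k (m + 1) \<rho> = path_weight w k m \<rho> + w (\<rho> m)"
    by (simp add: path_weight_def)
  moreover have "b (dir t) \<sigma> (\<rho> m) (\<rho> (m + 1)) = w (\<rho> m)"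
    unfolding assms(4) by (rule b_up[OF t])
  ultimately show ?case using step cocycle[OF t, of \<sigma> "\<rho> k" "\<rho> m" "\<rho> (m + 1)"] by linarith
qed

end

text \<open>Paths are functions on all integers, so the set of paths itself is infinite; the weight,
  however, depends only on the restriction to the relevant levels, which maps into a finite
  box.\<close>

lemma finite_path_weights: "finite (path_weight w k m ` up_right_paths x y)" if "k = level x" "m = level y"
proof -
  define box where "box = {fst x..m - snd x} \<times> {snd x..m - fst x}"
  have box: "\<rho> i \<in> box" if \<rho>: "\<rho> \<in> up_right_paths x y" and i: "k \<le> i" "i < m" for \<rho> i
  proof -
    have "x \<le> \<rho> i"
      using i
    proof (induction i rule: int_ge_induct)
      case base
      then show ?case using \<rho> \<open>k = level x\<close> by (simp add: up_right_paths_def)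
    next
      case (step i)
      have "\<rho> (i + 1) - \<rho> i \<in> {e1, e2}"
        using \<rho> step that \<open>k = level x\<close> \<open>m = level y\<close> unfolding up_right_paths_def by auto
      then have "\<rho> i \<le> \<rho> (i + 1)"
        by (auto simp: e1_def e2_def less_eq_prod_def prod_eq_iff)
      then show ?case using step by (auto intro: order_trans)
    qed
    moreover have "level (\<rho> i) = i"
      using \<rho> i \<open>k = level x\<close> \<open>m = level y\<close> unfolding up_right_paths_def by auto
    ultimately show ?thesis using i by (cases "\<rho> i") (auto simp: box_def level_def less_eq_prod_def)
  qed
  have "path_weight w k m ` up_right_paths x y \<subseteq> path_weight w k m ` (PiE {k..<m} (\<lambda>_. box))"
  proof
    fix r assume "r \<in> path_weight w k m ` up_right_paths x y"
    then obtain \<rho> where \<rho>: "\<rho> \<in> up_right_paths x y" "r = path_weight w k m \<rho>" by blast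
    have "restrict \<rho> {k..<m} \<in> PiE {k..<m} (\<lambda>_. box)" using box[OF \<rho>(1)] by (intro restrict_PiE_iff[THEN iffD2]) auto
    moreover have "r = path_weight w k m (restrict \<rho> {k..<m})"
      unfolding \<rho>(2) path_weight_def by (intro sum.cong) auto
    ultimately show "r \<in> path_weight w k m ` (PiE {k..<m} (\<lambda>_. box))" by blast
  qed
  moreover have "finite (PiE {k..<m} (\<lambda>_. box))" by (intro finite_PiE) (auto simp: box_def)
  ultimately show ?thesis by (meson finite_imageI finite_subset)
qed

lemma ex_biinfinite_path:
  assumes "backward_infinite s v"
  shows "\<exists>\<pi>. \<forall>i. level (\<pi> i) = i \<and> \<pi> (i + 1) = up s (\<pi> i)"
proof -
  have pred: "\<exists>u. backward_infinite s u \<and> up s u = y" if "backward_infinite s y" for y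
    using that unfolding backward_infinite_iff[of s y]
  proof
    assume "s (y - e1) \<and> backward_infinite s (y - e1)"
    then show ?thesis by (intro exI[of _ "y - e1"]) (simp add: up_def stp_def)
  next
    assume "\<not> s (y - e2) \<and> backward_infinite s (y - e2)"
    then show ?thesis by (intro exI[of _ "y - e2"]) (simp add: up_def stp_def)
  qed
  have "\<exists>f. \<forall>n. (backward_infinite s (f n) \<and> (n = 0 \<longrightarrow> f n = v)) \<and> up s (f (Suc n)) = f n"
  proof (rule dependent_nat_choice)
    show "\<exists>y. backward_infinite s y \<and> (0 = 0 \<longrightarrow> y = v)" for n :: nat using assms by blast
    show "\<exists>u. (backward_infinite s u \<and> (Suc n = 0 \<longrightarrow> u = v)) \<and> up s u = y"
      if "backward_infinite s y \<and> (n = 0 \<longrightarrow> y = v)" for y n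
      using pred that by blast
  qed
  then obtain f where "\<And>n. (backward_infinite s (f n) \<and> (n = 0 \<longrightarrow> f n = v)) \<and> up s (f (Suc n)) = f n" by blast
  then have f: "f 0 = v" "\<And>n. up s (f (Suc n)) = f n" by blast+
  define \<pi> where "\<pi> i = (if level v \<le> i then (up s ^^ nat (i - level v)) v else f (nat (level v - i)))" for i
  have level_f: "level (f n) = level v - int n" for n
  proof (induction n)
    case (Suc n)
    have "level (up s (f (Suc n))) = level (f n)" by (simp only: f(2))
    then show ?case using Suc by simp
  qed (simp add: f)
  have "level (\<pi> i) = i" for i
    by (simp add: \<pi>_def level_f)
  moreover have "\<pi> (i + 1) = up s (\<pi> i)" for i
  proof (cases "level v \<le> i")
    case True
    then have "nat (i + 1 - level v) = Suc (nat (i - level v))" by simp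
    then show ?thesis using True by (simp add: \<pi>_def)
  next
    case False
    then have *: "nat (level v - i) = Suc (nat (level v - (i + 1)))" by simp
    have "\<pi> i = f (Suc (nat (level v - (i + 1))))" using False unfolding \<pi>_def * by simp
    then have "up s (\<pi> i) = f (nat (level v - (i + 1)))" by (simp only: f(2))
    moreover have "\<pi> (i + 1) = f (nat (level v - (i + 1)))"
    proof (cases "level v = i + 1")
      case True
      then show ?thesis by (simp add: \<pi>_def f)
    next
      case False
      with \<open>\<not> level v \<le> i\<close> show ?thesis by (simp add: \<pi>_def)
    qed
    ultimately show ?thesis by simp
  qed
  ultimately show ?thesis by blast
qed

lemma backward_infinite_if_path:
  assumes "\<And>i. \<pi> (i + 1) = up s (\<pi> i)"
  shows "backward_infinite s (\<pi> (i :: int))"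
proof -
  have "(up s ^^ n) (\<pi> (i - int n)) = \<pi> i" for n i
  proof (induction n arbitrary: i)
    case (Suc n)
    have "(up s ^^ Suc n) (\<pi> (i - int (Suc n))) = up s ((up s ^^ n) (\<pi> ((i - 1) - int n)))"
      by (simp add: algebra_simps)
    also have "\<dots> = \<pi> i" using Suc[of "i - 1"] assms[of "i - 1"] by simp
    finally show ?case .
  qed simp
  then show ?thesis unfolding backward_infinite_def by blast
qed

context generic_realization
begin

text \<open>The Busemann function is a calibration: its increment bounds the weight of every
  up-right path with the same end points, and equals the weight along its own graph.\<close>

lemma biinfinite_geodesic_if_path:
  assumes t: "0 < t" "t < 1" and \<pi>: "\<And>i. level (\<pi> i) = i" "\<And>i. \<pi> (i + 1) = up (st t \<sigma>) (\<pi> i)"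
  shows "biinfinite_geodesic w \<pi>"
  unfolding biinfinite_geodesic_def
proof (intro conjI allI impI)
  show "level (\<pi> i) = i" for i by (rule \<pi>)
  show step: "\<pi> (i + 1) - \<pi> i \<in> {e1, e2}" for i
    by (simp add: \<pi>(2) up_def stp_def)
  fix k m :: int assume "k \<le> m"
  have path: "\<pi> \<in> up_right_paths (\<pi> k) (\<pi> m)"
    using step by (simp add: up_right_paths_def \<pi>(1))
  have "passage_time w (\<pi> k) (\<pi> m) = path_weight w k m \<pi>"
    unfolding passage_time_def \<pi>(1)
  proof (rule Max_eqI)
    show "finite (path_weight w k m ` up_right_paths (\<pi> k) (\<pi> m))"
      by (rule finite_path_weights) (simp_all add: \<pi>(1))
    fix r assume "r \<in> path_weight w k m ` up_right_paths (\<pi> k) (\<pi> m)"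
    then obtain \<rho> where \<rho>: "\<rho> \<in> up_right_paths (\<pi> k) (\<pi> m)" "r = path_weight w k m \<rho>" by blast
    have "r \<le> b (dir t) \<sigma> (\<rho> k) (\<rho> m)"
      unfolding \<rho>(2) using \<rho>(1) \<open>k \<le> m\<close> by (intro path_weight_le t) (auto simp: up_right_paths_def \<pi>(1))
    also have "\<dots> = b (dir t) \<sigma> (\<pi> k) (\<pi> m)"
      using \<rho>(1) by (simp add: up_right_paths_def \<pi>(1))
    also have "\<dots> = path_weight w k m \<pi>"
      by (rule path_weight_eq[symmetric]) (use t \<open>k \<le> m\<close> \<pi>(2) in auto)
    finally show "r \<le> path_weight w k m \<pi>" .
  qed (use path in blast)
  then show "geodesic w (\<pi> k) (\<pi> m) \<pi>" using path by (simp add: geodesic_def \<pi>(1))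
qed

text \<open>A backward infinite point lies on a bi-infinite geodesic, hence on a straight line. By
  monotonicity a horizontal line remains in the graphs of larger rational parameters and a vertical
  one in those of smaller, where no point is backward infinite.\<close>

lemma not_backward_infinite_minus:
  assumes triv: "\<And>\<pi>. biinfinite_geodesic w \<pi> \<Longrightarrow> trivial_path \<pi>" and t: "0 < t" "t < 1"
  shows "\<not> backward_infinite (st t Sminus) v"
proof
  assume "backward_infinite (st t Sminus) v"
  then obtain \<pi> where \<pi>: "\<And>i. level (\<pi> i) = i" "\<And>i. \<pi> (i + 1) = up (st t Sminus) (\<pi> i)"
    using ex_biinfinite_path by blast
  have "trivial_path \<pi>" by (intro triv biinfinite_geodesic_if_path[OF t]) (use \<pi> in auto)
  then obtain x and e :: "int \<times> int" where e: "e \<in> {e1, e2}" and range: "range \<pi> = range (\<lambda>j. x + (j * fst e, j * snd e))"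
    unfolding trivial_path_def by blast
  have on_line: "\<exists>j. \<pi> i = x + (j * fst e, j * snd e)" for i
  proof -
    have "\<pi> i \<in> range \<pi>" by simp
    then show ?thesis unfolding range by blast
  qed
  show False
  proof (cases "e = e1")
    case True
    have snd: "snd (\<pi> i) = snd x" for i using on_line[of i] True by (auto simp: e1_def)
    have st: "st t Sminus (\<pi> i)" for i
      using \<pi>(2)[of i] snd[of i] snd[of "i + 1"] by (auto simp: up_def stp_def e2_def split: if_splits)
    obtain q where q: "q \<in> \<rat>" "t < q" "q < 1" using Rats_dense_in_real t by blast
    have "st q Splus (\<pi> i)" for i
      using q t by (intro st_mono[OF _ _ _ st]) (auto simp: sided_le_def)
    then have "\<pi> (i + 1) = up (st q Splus) (\<pi> i)" for i
      using \<pi>(2)[of i] st[of i] by (simp add: up_def)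
    then have "backward_infinite (st q Splus) (\<pi> 0)" by (rule backward_infinite_if_path)
    then show False using not_backward_infinite_rat[of q] q t by auto
  next
    case False
    then have "e = e2" using e by simp
    then have fst: "fst (\<pi> i) = fst x" for i using on_line[of i] by (auto simp: e2_def)
    have st: "\<not> st t Sminus (\<pi> i)" for i
      using \<pi>(2)[of i] fst[of i] fst[of "i + 1"] by (auto simp: up_def stp_def e1_def split: if_splits)
    obtain q where q: "q \<in> \<rat>" "0 < q" "q < t" using Rats_dense_in_real t by blast
    have "\<not> st q Splus (\<pi> i)" for i
      using st_mono[of q Splus t Sminus "\<pi> i"] q t st by (auto simp: sided_le_def)
    then have "\<pi> (i + 1) = up (st q Splus) (\<pi> i)" for i
      using \<pi>(2)[of i] st[of i] by (simp add: up_def)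
    then have "backward_infinite (st q Splus) (\<pi> 0)" by (rule backward_infinite_if_path)
    then show False using not_backward_infinite_rat[of q] q t by auto
  qed
qed

end

section \<open>The structure theorem\<close>

context generic_realization
begin

text \<open>A rational parameter strictly between \<open>p\<close> and \<open>q\<close> provides the
  intermediate graph without backward infinite points.\<close>

lemma common_descendant_strict:
  assumes "0 < p" "p < q" "q < 1" "inst p q x" "inst p q y"
  shows "\<exists>z. inst p q z \<and> (dedge p q)\<^sup>+\<^sup>+ x z \<and> (dedge p q)\<^sup>+\<^sup>+ y z"
proof -
  obtain r where r: "r \<in> \<rat>" "p < r" "r < q" using Rats_dense_in_real[OF assms(2)] by blast
  show ?thesis
  proof (rule common_descendant[where s = "st r Splus"])
    show "st r Splus x" if "st p Sminus x" for x
      using that st_mono[of p Sminus r Splus x] r assms by (simp add: sided_le_def)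
    show "st q Splus x" if "st r Splus x" for x
      using that st_mono[of r Splus q Splus x] r assms by (simp add: sided_le_def)
    show "\<not> backward_infinite (st r Splus) v" for v
      using not_backward_infinite_rat[of r v] r assms by simp
  qed (use assms in auto)
qed

lemma common_descendant_single:
  assumes triv: "\<And>\<pi>. biinfinite_geodesic w \<pi> \<Longrightarrow> trivial_path \<pi>"
    and "0 < t" "t < 1" "inst t t x" "inst t t y"
  shows "\<exists>z. inst t t z \<and> (dedge t t)\<^sup>+\<^sup>+ x z \<and> (dedge t t)\<^sup>+\<^sup>+ y z"
proof (rule common_descendant[where s = "st t Sminus"])
  show "st t Splus x" if "st t Sminus x" for x
    using that st_mono[of t Sminus t Splus x] assms by (simp add: sided_le_def)
  show "\<not> backward_infinite (st t Sminus) v" for v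
    using not_backward_infinite_minus[OF triv] assms by blast
qed (use assms in auto)

lemma common_ancestor_isolated:
  assumes iso: "isolated_instabilities" and pq: "0 < p" "p \<le> q" "q < 1" and "inst p q x" "inst p q y"
  shows "\<exists>z. inst p q z \<and> (dedge p q)\<^sup>+\<^sup>+ z x \<and> (dedge p q)\<^sup>+\<^sup>+ z y"
  by (rule common_ancestor[OF pq coalescing_minus[OF iso] coalescing_plus[OF iso] jump_if_inst[OF iso pq]])
     (use assms in auto)

text \<open>Rational parameters on either side of \<open>t\<close>, still inside the interval, have
  coalescing graphs and different increments at \<open>x\<close>, since \<open>t\<close> is a point
  of increase.\<close>

lemma ex_branch_strict:
  assumes "0 < p" "p < t" "t < q" "q < 1" "unst x t"
  shows "\<exists>u. v \<le> u \<and> p \<le> cd u \<and> cd u \<le> q"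
proof -
  obtain p' where p': "p' \<in> \<rat>" "p < p'" "p' < t" using Rats_dense_in_real[OF assms(2)] by blast
  obtain q' where q': "q' \<in> \<rat>" "t < q'" "q' < q" using Rats_dense_in_real[OF assms(3)] by blast
  have "\<exists>u. v \<le> u \<and> \<not> st p' Splus u \<and> st q' Splus u"
  proof (rule ex_branch_above)
    show "st q' Splus x" if "st p' Splus x" for x
      using that st_mono[of p' Splus q' Splus x] p' q' assms by (simp add: sided_le_def)
    show "coalescing (st p' Splus)" "coalescing (st q' Splus)"
      using p' q' assms by (auto intro!: coalescing_rat)
    show "h p' Splus x < h q' Splus x" using p' q' assms by (simp add: unst_def)
  qed (use p' q' assms in auto)
  then obtain u where "v \<le> u" "\<not> st p' Splus u" "st q' Splus u" by blast
  moreover from this have "p' \<le> cd u" "cd u \<le> q'"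
    using le_cd_if_not_st[of p' Splus u] cd_le_if_st[of q' Splus u] p' q' assms by auto
  ultimately show ?thesis using p' q' by (intro exI[of _ u]) auto
qed

lemma ex_branch_single:
  assumes iso: "isolated_instabilities" and "unst x t"
  shows "\<exists>u. v \<le> u \<and> t \<le> cd u \<and> cd u \<le> t"
proof -
  have t: "0 < t" "t < 1" using unst_bounds[OF assms(2)] by auto
  have "\<exists>u. v \<le> u \<and> \<not> st t Sminus u \<and> st t Splus u"
  proof (rule ex_branch_above)
    show "st t Splus x" if "st t Sminus x" for x
      using that st_mono[of t Sminus t Splus x] t by (simp add: sided_le_def)
    show "coalescing (st t Sminus)" "coalescing (st t Splus)"
      using coalescing_minus[OF iso t] coalescing_plus[OF iso t] by auto
    show "h t Sminus x < h t Splus x"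
      using jump_if_inst[OF iso t(1) order_refl t(2), of x] assms(2) by (auto simp: inst_def)
  qed (use t in auto)
  then obtain u where "v \<le> u" "\<not> st t Sminus u" "st t Splus u" by blast
  then show ?thesis using st_minus_iff[OF t, of u] st_plus_iff[OF t, of u] by blast
qed

lemma branch_point_iff:
  assumes "0 < p" "p \<le> q" "q < 1"
  shows "branch_point b (dir p) (dir q) (dual x) \<longleftrightarrow> p \<le> cd x \<and> cd x \<le> q"
proof -
  have "dual x - e1 = dual (x - e1)" "dual x - e2 = dual (x - e2)" by (simp_all add: dual_diff)
  moreover have "dual x \<in> instability_points b (dir p) (dir q) \<longleftrightarrow> inst p q x"
    using instability_points_eq[of p q] assms by auto
  ultimately show ?thesis
    unfolding branch_point_def branch_iff[symmetric] by (simp add: ancestor_iff[OF assms])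
qed

lemma ex_branch_sequence:
  assumes "0 < p" "p \<le> q" "q < 1" and ex: "\<And>v. \<exists>u. v \<le> u \<and> p \<le> cd u \<and> cd u \<le> q"
  shows "\<exists>s. branch_sequence b (dir p) (dir q) z s"
proof -
  have "\<exists>f. \<forall>n. (z \<le> f n \<and> p \<le> cd (f n) \<and> cd (f n) \<le> q) \<and> f n + (1, 1) \<le> f (Suc n)"
  proof (rule dependent_nat_choice)
    show "\<exists>u. z \<le> u \<and> p \<le> cd u \<and> cd u \<le> q" by (rule ex)
    fix u :: "int \<times> int" and n :: nat assume u: "z \<le> u \<and> p \<le> cd u \<and> cd u \<le> q"
    obtain u' where u': "u + (1, 1) \<le> u'" "p \<le> cd u'" "cd u' \<le> q" using ex by blast
    then have "z \<le> u'" using u by (auto simp: less_eq_prod_def)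
    with u' show "\<exists>u'. (z \<le> u' \<and> p \<le> cd u' \<and> cd u' \<le> q) \<and> u + (1, 1) \<le> u'" by blast
  qed
  then obtain f where f: "\<And>n. z \<le> f n" "\<And>n. p \<le> cd (f n) \<and> cd (f n) \<le> q" "\<And>n. f n + (1, 1) \<le> f (Suc n)"
    by blast
  have half: "fst ehat_star = 1 / 2" "snd ehat_star = 1 / 2" by (auto simp: ehat_star_def ehat_def e1_def e2_def)
  have "cless (dual (f n)) (dual (f (Suc n)))" for n
    using f(3)[of n] by (simp add: cless_def dual_def rvec_def less_eq_prod_def)
  moreover have "cless (rvec z) (dual (f 0))"
    using f(1)[of 0] half by (simp add: cless_def dual_def rvec_def less_eq_prod_def)
  ultimately have "branch_sequence b (dir p) (dir q) z (\<lambda>n. dual (f n))"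
    using f(2) by (simp add: branch_sequence_def branch_point_iff[OF assms(1-3)])
  then show ?thesis by (rule exI[of _ "\<lambda>n. dual (f n)"])
qed

lemma infinite_coalescence_points:
  assumes pq: "0 < p" "p \<le> q" "q < 1"
    and "\<And>x y. inst p q x \<Longrightarrow> inst p q y \<Longrightarrow> \<exists>z. inst p q z \<and> (dedge p q)\<^sup>+\<^sup>+ x z \<and> (dedge p q)\<^sup>+\<^sup>+ y z"
    and "\<And>v. \<exists>u. v \<le> u \<and> p \<le> cd u \<and> cd u \<le> q"
  shows "infinite {u. coalescence_point b (dir p) (dir q) u}"
proof -
  have "infinite {f. merge p q f}"
    by (rule infinite_merge) (use assms in blast)+
  moreover have "inj dual" by (simp add: inj_def)
  ultimately have "infinite (dual ` {f. merge p q f})" by (simp add: finite_image_iff inj_on_subset)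
  moreover have "dual ` {f. merge p q f} \<subseteq> {u. coalescence_point b (dir p) (dir q) u}"
  proof (intro image_subsetI CollectI)
    fix f assume "f \<in> {f. merge p q f}"
    then have f: "merge p q f" by simp
    have "dual f + e1 = dual (f + e1)" "dual f + e2 = dual (f + e2)" by (simp_all add: dual_add)
    moreover have "inst p q f" using f dedge_inst unfolding merge_def by blast
    then have "dual f \<in> instability_points b (dir p) (dir q)"
      using instability_points_eq[of p q] pq by auto
    ultimately show "coalescence_point b (dir p) (dir q) (dual f)"
      using f unfolding coalescence_point_def merge_def by (simp add: ancestor_iff[OF pq] tranclp.r_into_trancl)
  qed
  ultimately show ?thesis using finite_subset by blast
qed

lemma instability_points_Ball_Bex:
  assumes pq: "0 < p" "p \<le> q" "q < 1"
  shows "(\<forall>u\<in>instability_points b (dir p) (dir q). \<forall>v\<in>instability_points b (dir p) (dir q).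
      \<exists>z\<in>instability_points b (dir p) (dir q). ancestor b (dir p) (dir q) u z \<and> ancestor b (dir p) (dir q) v z) \<longleftrightarrow>
    (\<forall>x y. inst p q x \<longrightarrow> inst p q y \<longrightarrow> (\<exists>z. inst p q z \<and> (dedge p q)\<^sup>+\<^sup>+ x z \<and> (dedge p q)\<^sup>+\<^sup>+ y z))"
    and "(\<forall>u\<in>instability_points b (dir p) (dir q). \<forall>v\<in>instability_points b (dir p) (dir q).
      \<exists>z\<in>instability_points b (dir p) (dir q). ancestor b (dir p) (dir q) z u \<and> ancestor b (dir p) (dir q) z v) \<longleftrightarrow>
    (\<forall>x y. inst p q x \<longrightarrow> inst p q y \<longrightarrow> (\<exists>z. inst p q z \<and> (dedge p q)\<^sup>+\<^sup>+ z x \<and> (dedge p q)\<^sup>+\<^sup>+ z y))"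
proof -
  have eq: "instability_points b (dir p) (dir q) = dual ` {x. inst p q x}"
    using pq by (intro instability_points_eq) auto
  show "(\<forall>u\<in>instability_points b (dir p) (dir q). \<forall>v\<in>instability_points b (dir p) (dir q).
      \<exists>z\<in>instability_points b (dir p) (dir q). ancestor b (dir p) (dir q) u z \<and> ancestor b (dir p) (dir q) v z) \<longleftrightarrow>
    (\<forall>x y. inst p q x \<longrightarrow> inst p q y \<longrightarrow> (\<exists>z. inst p q z \<and> (dedge p q)\<^sup>+\<^sup>+ x z \<and> (dedge p q)\<^sup>+\<^sup>+ y z))"
    by (simp add: eq ancestor_iff[OF pq])
  show "(\<forall>u\<in>instability_points b (dir p) (dir q). \<forall>v\<in>instability_points b (dir p) (dir q).
      \<exists>z\<in>instability_points b (dir p) (dir q). ancestor b (dir p) (dir q) z u \<and> ancestor b (dir p) (dir q) z v) \<longleftrightarrow>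
    (\<forall>x y. inst p q x \<longrightarrow> inst p q y \<longrightarrow> (\<exists>z. inst p q z \<and> (dedge p q)\<^sup>+\<^sup>+ z x \<and> (dedge p q)\<^sup>+\<^sup>+ z y))"
    by (simp add: eq ancestor_iff[OF pq])
qed

lemma isolated_instabilities_if_isolated_in:
  assumes "\<And>x y \<xi>. \<xi> \<in> busemann_supp b x y \<Longrightarrow> \<xi> isolated_in busemann_supp b x y"
  shows "isolated_instabilities"
  unfolding isolated_instabilities_def
proof (intro allI impI)
  fix x t assume "unst x t"
  then have "dir t isolated_in busemann_supp b (x + e1) (x + e2)"
    using assms busemann_supp_iff by blast
  then obtain S where S: "open S" "S \<inter> busemann_supp b (x + e1) (x + e2) = {dir t}"
    by (auto simp: isolated_in_def)
  have "open (dir -` S)" using S(1) continuous_dir by (intro open_vimage) auto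
  moreover have "t \<in> dir -` S" using S(2) by auto
  ultimately obtain \<epsilon> where \<epsilon>: "\<epsilon> > 0" "\<And>u. dist u t < \<epsilon> \<Longrightarrow> dir u \<in> S"
    unfolding open_dist by blast
  have "\<not> unst x u" if u: "u \<noteq> t" "\<bar>u - t\<bar> < \<epsilon>" for u
  proof
    assume "unst x u"
    then have "dir u \<in> S \<inter> busemann_supp b (x + e1) (x + e2)"
      using \<epsilon>(2)[of u] u busemann_supp_iff by (simp add: dist_real_def)
    with S(2) u show False by simp
  qed
  with \<epsilon>(1) show "\<exists>\<epsilon>>0. \<forall>u. u \<noteq> t \<and> \<bar>u - t\<bar> < \<epsilon> \<longrightarrow> \<not> unst x u" by blast
qed

end

lemma realization_apply: "realization B \<omega> \<xi> \<sigma> x y = B \<xi> \<sigma> x y \<omega>"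
  by (simp add: realization_def)

lemma filterlim_dir_left:
  assumes "0 < t" "t \<le> 1"
  shows "filterlim dir (at (dir t) within {\<zeta> \<in> ri_dirs. \<zeta> \<prec>\<^sub>1 dir t}) (at_left t)"
proof (rule filterlim_at_withinI)
  have "(dir \<longlongrightarrow> dir t) (at t)"
    using continuous_dir[of UNIV] by (simp add: continuous_on_def)
  then show "filterlim dir (nhds (dir t)) (at_left t)"
    by (rule tendsto_mono[OF at_le, rotated]) simp
  have "eventually (\<lambda>s. s \<in> {0<..<t}) (at_left t)" using assms by (intro eventually_at_left_real)
  then show "eventually (\<lambda>s. dir s \<in> {\<zeta> \<in> ri_dirs. \<zeta> \<prec>\<^sub>1 dir t} - {dir t}) (at_left t)"
    by eventually_elim (use assms in auto)
qed

lemma filterlim_dir_right: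
  assumes "0 \<le> t" "t < 1"
  shows "filterlim dir (at (dir t) within {\<zeta> \<in> ri_dirs. dir t \<prec>\<^sub>1 \<zeta>}) (at_right t)"
proof (rule filterlim_at_withinI)
  have "(dir \<longlongrightarrow> dir t) (at t)"
    using continuous_dir[of UNIV] by (simp add: continuous_on_def)
  then show "filterlim dir (nhds (dir t)) (at_right t)"
    by (rule tendsto_mono[OF at_le, rotated]) simp
  have "eventually (\<lambda>s. s \<in> {t<..<1}) (at_right t)" using assms by (intro eventually_at_right_real)
  then show "eventually (\<lambda>s. dir s \<in> {\<zeta> \<in> ri_dirs. dir t \<prec>\<^sub>1 \<zeta>} - {dir t}) (at_right t)"
    by eventually_elim (use assms in auto)
qed

context busemann_process
begin

lemma AE_rational_dirs:
  assumes "\<And>\<xi>. \<xi> \<in> ri_dirs \<Longrightarrow> AE \<omega> in M. P \<xi> \<omega>"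
  shows "AE \<omega> in M. \<forall>t\<in>\<rat> \<inter> {0<..<1}. P (dir t) \<omega>"
  using assms by (intro AE_ball_countable[THEN iffD2] ballI) (auto intro: countable_subset[OF _ countable_rat])

lemma AE_busemann_realization:
  "AE \<omega> in M. busemann_realization (realization B \<omega>) (\<lambda>z. W z \<omega>)"
  using B_event
proof (elim bexE conjE, goal_cases)
  case (1 \<Omega>0)
  note ev = 1
  have "AE \<omega> in M. \<omega> \<in> \<Omega>0" using ev by (simp add: AE_in_set_eq_1)
  moreover have "AE \<omega> in M. \<forall>t\<in>\<rat> \<inter> {0<..<1}. \<forall>x \<sigma>. B (dir t) \<sigma> x (x + e1) \<omega> \<noteq> B (dir t) \<sigma> x (x + e2) \<omega>"
    by (rule AE_rational_dirs) (rule B_no_tie)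
  ultimately show ?case
  proof eventually_elim
    case (elim \<omega>)
    note \<omega> = elim(1) and tie = elim(2)
    note basic = bspec[OF ev(4) \<omega>] and mono = bspec[OF ev(5) \<omega>] and lims = bspec[OF ev(6) \<omega>]
      and inf = bspec[OF ev(7) \<omega>]
    show ?case
      unfolding realization_def
    proof
      fix t \<sigma> and x y z :: "int \<times> int" assume t: "0 < t" "t < (1::real)"
      then have ri: "dir t \<in> ri_dirs" by simp
      show "B (dir t) \<sigma> x y \<omega> + B (dir t) \<sigma> y z \<omega> = B (dir t) \<sigma> x z \<omega>"
        "min (B (dir t) \<sigma> x (x + e1) \<omega>) (B (dir t) \<sigma> x (x + e2) \<omega>) = W x \<omega>"
        using basic ri by blast+
      show "((\<lambda>s. B (dir s) \<sigma> x y \<omega>) \<longlongrightarrow> B (dir t) Sminus x y \<omega>) (at_left t)"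
        using filterlim_compose[OF _ filterlim_dir_left[of t]] lims ri t by fastforce
      show "((\<lambda>s. B (dir s) \<sigma> x y \<omega>) \<longlongrightarrow> B (dir t) Splus x y \<omega>) (at_right t)"
        using filterlim_compose[OF _ filterlim_dir_right[of t]] lims ri t by fastforce
    next
      fix s t and x :: "int \<times> int" assume st: "0 < s" "s < t" "t < (1::real)"
      then have "dir s \<in> ri_dirs" "dir t \<in> ri_dirs" "dir s \<prec>\<^sub>1 dir t" by auto
      with mono show "B (dir s) Splus x (x + e1) \<omega> \<le> B (dir s) Sminus x (x + e1) \<omega> \<and>
          B (dir t) Sminus x (x + e1) \<omega> \<le> B (dir s) Splus x (x + e1) \<omega>"
        "B (dir s) Sminus x (x + e2) \<omega> \<le> B (dir s) Splus x (x + e2) \<omega> \<and>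
          B (dir s) Splus x (x + e2) \<omega> \<le> B (dir t) Sminus x (x + e2) \<omega>"
        by blast+
    next
      fix x :: "int \<times> int"
      have "filterlim dir (at e2 within ri_dirs) (at_right 0)"
      proof -
        have "dir 0 = e2" by (simp add: dir_def e2_def)
        moreover have "{\<zeta> \<in> ri_dirs. dir 0 \<prec>\<^sub>1 \<zeta>} \<subseteq> ri_dirs" by blast
        ultimately show ?thesis using filterlim_mono[OF filterlim_dir_right[of 0] at_le order_refl] by simp
      qed
      moreover have "filterlim (\<lambda>\<xi>. B \<xi> Splus x (x + e1) \<omega>) at_top (at e2 within ri_dirs)"
        using inf by blast
      ultimately have "filterlim (\<lambda>s. B (dir s) Splus x (x + e1) \<omega>) at_top (at_right 0)"
        by (rule filterlim_compose[rotated])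
      then have "eventually (\<lambda>s. W x \<omega> < B (dir s) Splus x (x + e1) \<omega>) (at_right 0)"
        by (simp add: filterlim_at_top_dense)
      moreover have "eventually (\<lambda>s. s \<in> {0<..<1}) (at_right (0::real))" by (intro eventually_at_right_real) simp
      ultimately have "eventually (\<lambda>s. W x \<omega> < B (dir s) Splus x (x + e1) \<omega> \<and> s \<in> {0<..<1}) (at_right 0)"
        by (rule eventually_conj)
      from eventually_happens'[OF _ this] show "\<exists>t. 0 < t \<and> t < 1 \<and> W x \<omega> < B (dir t) Splus x (x + e1) \<omega>"
        by auto
    next
      fix x :: "int \<times> int"
      have "filterlim dir (at e1 within ri_dirs) (at_left 1)"
      proof -
        have "dir 1 = e1" by (simp add: dir_def e1_def)
        moreover have "{\<zeta> \<in> ri_dirs. \<zeta> \<prec>\<^sub>1 dir 1} \<subseteq> ri_dirs" by blast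
        ultimately show ?thesis using filterlim_mono[OF filterlim_dir_left[of 1] at_le order_refl] by simp
      qed
      moreover have "filterlim (\<lambda>\<xi>. B \<xi> Splus x (x + e2) \<omega>) at_top (at e1 within ri_dirs)"
        using inf by blast
      ultimately have "filterlim (\<lambda>s. B (dir s) Splus x (x + e2) \<omega>) at_top (at_left 1)"
        by (rule filterlim_compose[rotated])
      then have "eventually (\<lambda>s. W x \<omega> < B (dir s) Splus x (x + e2) \<omega>) (at_left 1)"
        by (simp add: filterlim_at_top_dense)
      moreover have "eventually (\<lambda>s. s \<in> {0<..<1}) (at_left (1::real))" by (intro eventually_at_left_real) simp
      ultimately have "eventually (\<lambda>s. W x \<omega> < B (dir s) Splus x (x + e2) \<omega> \<and> s \<in> {0<..<1}) (at_left 1)"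
        by (rule eventually_conj)
      from eventually_happens'[OF _ this] show "\<exists>t. 0 < t \<and> t < 1 \<and> W x \<omega> < B (dir t) Splus x (x + e2) \<omega>"
        by auto
    next
      fix t :: real and x :: "int \<times> int" assume "t \<in> \<rat>" "0 < t" "t < 1"
      then show "B (dir t) Splus x (x + e1) \<omega> \<noteq> B (dir t) Splus x (x + e2) \<omega>" using tie by simp
    qed
  qed
qed

lemma AE_generic_realization:
  "AE \<omega> in M. generic_realization (realization B \<omega>) (\<lambda>z. W z \<omega>)"
proof -
  have coal: "AE \<omega> in M. \<forall>t\<in>\<rat> \<inter> {0<..<1}.
      coalescing (\<lambda>x. B (dir t) Splus x (x + e1) \<omega> \<le> B (dir t) Splus x (x + e2) \<omega>)"
    by (rule AE_rational_dirs) (rule AE_coalescing)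
  have no_back: "AE \<omega> in M. \<forall>t\<in>\<rat> \<inter> {0<..<1}. \<forall>v.
      \<not> backward_infinite (\<lambda>x. B (dir t) Splus x (x + e1) \<omega> \<le> B (dir t) Splus x (x + e2) \<omega>) v"
    by (rule AE_rational_dirs) (rule AE_no_backward_infinite)
  show ?thesis
  using AE_busemann_realization AE_weights_independent coal no_back
proof eventually_elim
  case (elim \<omega>)
  interpret busemann_realization "realization B \<omega>" "\<lambda>z. W z \<omega>" by (rule elim(1))
  have st_eq: "st t Splus = (\<lambda>x. B (dir t) Splus x (x + e1) \<omega> \<le> B (dir t) Splus x (x + e2) \<omega>)"
    if "0 < t" "t < 1" for t
    using that by (intro ext) (auto simp: st_def h_eq realization_apply)
  show ?case
  proof
    show "coalescing (st t Splus)" if "t \<in> \<rat>" "0 < t" "t < 1" for t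
      using elim(3) that unfolding st_eq[OF that(2,3)] by simp
    show "\<not> backward_infinite (st t Splus) v" if "t \<in> \<rat>" "0 < t" "t < 1" for t v
      using elim(4) that unfolding st_eq[OF that(2,3)] by simp
    show "P = P' \<and> Q = Q'" if "finite P" "finite Q" "finite P'" "finite Q'" "P \<inter> Q = {}" "P' \<inter> Q' = {}"
      "(\<Sum>z\<in>P. W z \<omega>) - (\<Sum>z\<in>Q. W z \<omega>) = (\<Sum>z\<in>P'. W z \<omega>) - (\<Sum>z\<in>Q'. W z \<omega>)" for P Q P' Q'
      using elim(2) that by blast
  qed
qed
qed

end

theorem theorem4p4:
  fixes M :: "'w::polish_space measure"
    and T :: "int \<times> int \<Rightarrow> 'w \<Rightarrow> 'w"
    and W :: "int \<times> int \<Rightarrow> 'w \<Rightarrow> real"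
    and g :: "real \<times> real \<Rightarrow> real"
    and B :: "real \<times> real \<Rightarrow> sign \<Rightarrow> int \<times> int \<Rightarrow> int \<times> int \<Rightarrow> 'w \<Rightarrow> real"
  assumes "busemann_process M T W g B"
  shows "AE \<omega> in M.
    (let b = realization B \<omega> in
     (\<forall>\<zeta>\<in>ri_dirs. \<forall>\<eta>\<in>ri_dirs. \<zeta> \<preceq>\<^sub>1 \<eta> \<and> dir_cc \<zeta> \<eta> \<inter> exceptional_dirs b \<noteq> {} \<longrightarrow>
        \<comment> \<open>(a)\<close>
        (\<forall>x. branch_point b \<zeta> \<eta> (dual x) \<longleftrightarrow>
               competition_direction (realization B (T x \<omega>)) \<in> dir_cc \<zeta> \<eta>) \<and>
        \<comment> \<open>(b)\<close>
        (\<zeta> \<prec>\<^sub>1 \<eta> \<longrightarrow>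
           (\<forall>u\<in>instability_points b \<zeta> \<eta>. \<forall>v\<in>instability_points b \<zeta> \<eta>.
              \<exists>z\<in>instability_points b \<zeta> \<eta>. ancestor b \<zeta> \<eta> u z \<and> ancestor b \<zeta> \<eta> v z)) \<and>
        (no_nontrivial_biinfinite M W \<and> \<zeta> = \<eta> \<longrightarrow>
           (\<forall>u\<in>instability_points b \<zeta> \<eta>. \<forall>v\<in>instability_points b \<zeta> \<eta>.
              \<exists>z\<in>instability_points b \<zeta> \<eta>. ancestor b \<zeta> \<eta> u z \<and> ancestor b \<zeta> \<eta> v z)) \<and>
        \<comment> \<open>(c)\<close>
        (jump_condition M B \<longrightarrow>
           (\<forall>u\<in>instability_points b \<zeta> \<eta>. \<forall>v\<in>instability_points b \<zeta> \<eta>.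
              \<exists>z\<in>instability_points b \<zeta> \<eta>. ancestor b \<zeta> \<eta> z u \<and> ancestor b \<zeta> \<eta> z v)) \<and>
        \<comment> \<open>(d)\<close>
        (\<zeta> \<prec>\<^sub>1 \<eta> \<and> dir_oo \<zeta> \<eta> \<inter> exceptional_dirs b \<noteq> {} \<longrightarrow>
           (\<forall>z. \<exists>s. branch_sequence b \<zeta> \<eta> z s) \<and>
           infinite {u. coalescence_point b \<zeta> \<eta> u})) \<and>
     \<comment> \<open>(e)\<close>
     (\<forall>\<xi>\<in>exceptional_dirs b. jump_condition M B \<longrightarrow>
        (\<forall>z. \<exists>s. branch_sequence b \<xi> \<xi> z s) \<and>
        (no_nontrivial_biinfinite M W \<longrightarrow> infinite {u. coalescence_point b \<xi> \<xi> u})))"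
proof -
  interpret busemann_process M T W g B by (rule assms)
  \<comment> \<open>Whether (J) holds does not depend on the realization, so the exceptional null
    set may be chosen after this is decided, and the implication can be stated for almost every
    realization.\<close>
  have J: "AE \<omega> in M. jump_condition M B \<longrightarrow> (\<forall>x y. \<forall>\<xi>\<in>busemann_supp (realization B \<omega>) x y.
      \<xi> isolated_in busemann_supp (realization B \<omega>) x y)"
    by (cases "jump_condition M B") (auto simp: jump_condition_def)
  have N: "AE \<omega> in M. no_nontrivial_biinfinite M W \<longrightarrow>
      (\<forall>\<pi>. biinfinite_geodesic (\<lambda>z. W z \<omega>) \<pi> \<longrightarrow> trivial_path \<pi>)"
    by (cases "no_nontrivial_biinfinite M W") (auto simp: no_nontrivial_biinfinite_def)
  show ?thesis
    using AE_generic_realization AE_B_shift J N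
  proof eventually_elim
    case (elim \<omega>)
    define b where "b = realization B \<omega>"
    interpret generic_realization b "\<lambda>z. W z \<omega>" unfolding b_def by (rule elim(1))
    have iso: "isolated_instabilities" if "jump_condition M B"
      using elim(3) that by (intro isolated_instabilities_if_isolated_in) (auto simp: b_def)
    have triv: "trivial_path \<pi>" if "no_nontrivial_biinfinite M W" "biinfinite_geodesic (\<lambda>z. W z \<omega>) \<pi>" for \<pi>
      using elim(4) that by blast
    have competition: "competition_direction (realization B (T x \<omega>)) = dir (cd x)" for x
    proof (rule competition_direction_eq)
      fix t :: real and \<sigma> assume "0 < t" "t < 1"
      then have "dir t \<in> ri_dirs" by simp
      then have "B (dir t) \<sigma> (e1 + x) (e2 + x) \<omega> = B (dir t) \<sigma> e1 e2 (T x \<omega>)"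
        using elim(2) by blast
      then show "realization B (T x \<omega>) (dir t) \<sigma> e1 e2 = h t \<sigma> x"
        by (simp add: h_def realization_apply b_def[THEN fun_cong, THEN fun_cong, THEN fun_cong, THEN fun_cong] add.commute)
    qed
    show ?case
      unfolding Let_def b_def[symmetric]
    proof (rule conjI, goal_cases)
      case 1
      show ?case
      proof (intro ballI impI, goal_cases)
        case (1 \<zeta> \<eta>)
        obtain p q where dirs: "\<zeta> = dir p" "\<eta> = dir q" and "0 < p" "q < 1"
          using 1(1,2) unfolding ri_dirs_eq by (force simp del: dir_eq_iff)
        with 1(3) have pq: "0 < p" "p \<le> q" "q < 1" by simp_all
        have branch: "\<exists>u. v \<le> u \<and> p \<le> cd u \<and> cd u \<le> q"
          if meets: "dir_oo (dir p) (dir q) \<inter> exceptional_dirs b \<noteq> {}" for v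
        proof -
          obtain t x where "p < t" "t < q" "unst x t"
            using meets pq by (auto simp: dir_intervals exceptional_dirs_eq)
          then show ?thesis using ex_branch_strict pq by blast
        qed
        show ?case
          unfolding dirs
        proof (intro conjI impI, goal_cases)
          case 1
          show ?case using pq by (auto simp: branch_point_iff competition dir_intervals)
        next
          case 2
          then show ?case
            unfolding instability_points_Ball_Bex[OF pq] using common_descendant_strict pq by simp
        next
          case 3
          then show ?case
            unfolding instability_points_Ball_Bex[OF pq] using common_descendant_single[OF triv] pq by simp
        next
          case 4
          then show ?case
            unfolding instability_points_Ball_Bex[OF pq] using common_ancestor_isolated[OF iso pq] by blast
        next
          case 5
          then show ?case using ex_branch_sequence[OF pq branch] by blast
        next
          case 6
          then show ?case
            using pq by (intro infinite_coalescence_points common_descendant_strict branch) auto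
        qed
      qed
    next
      case 2
      show ?case
      proof (intro ballI impI, goal_cases)
        case (1 \<xi>)
        then obtain t x where "\<xi> = dir t" "unst x t" unfolding exceptional_dirs_eq by blast
        then have t: "0 < t" "t \<le> t" "t < 1" using unst_bounds by auto
        have branch: "\<exists>u. v \<le> u \<and> t \<le> cd u \<and> cd u \<le> t" for v
          using ex_branch_single[OF iso[OF 1(2)] \<open>unst x t\<close>] .
        show ?case
          unfolding \<open>\<xi> = dir t\<close>
        proof (intro conjI impI, goal_cases)
          case 1
          show ?case using ex_branch_sequence[OF t branch] by blast
        next
          case 2
          then show ?case
            using t by (intro infinite_coalescence_points common_descendant_single[OF triv] branch) auto
        qed
      qed
    qed
  qed
qed

end
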